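(* Consider the Gaussian/Poisson product mixture model described in the context, with bounded parameter space $\Theta$ and true mixing distribution $g_0\in\mathcal G$. (1) If $g_0$ is discrete with finitely many support points, then for any $c<0$, $$\sup_{g\in\mathcal G_n(c)} n\,\chi^2(f_g,f_{g_0})=O_{\mathbb P}(1).$$ (2) If $g_0$ is not finitely discrete, then for any $c>0$, $$\sup_{g\in\mathcal G_n(c)} n\,\chi^2(f_g,f_{g_0})\to\infty\quad\text{in probability as } n\to\infty.$$
   Context: Model: let $\mathbb N=\{0,1,2,\dots\}$, $d\ge 1$, fix $b\in\{0,1,\dots,d\}$, and let $\Theta\subseteq\mathbb R^b\times(0,\infty)^{d-b}$ be bounded. For $\theta\in\Theta$ let $p_\theta(x)=\prod_{l=1}^d p_{\theta_l}(x_l)$ for $x\in\mathbb R^b\times\mathbb N^{d-b}$, where $p_{\theta_l}(x_l)=\phi(x_l-\theta_l)$ with $\phi(t)=\frac{1}{\sqrt{2\pi}}e^{-t^2/2}$ for $1\le l\le b$, and $p_{\theta_l}(x_l)=\frac{\theta_l^{x_l}}{x_l!}e^{-\theta_l}$ for $b+1\le l\le d$. The base measure $\mu$ is the product of Lebesgue measure on $\mathbb R^b$ and counting measure on $\mathbb N^{d-b}$. $\mathcal G$ is the set of all probability measures supported on $\Theta$, and $f_g(x)=\int_\Theta p_\theta(x)\,dg(\theta)$ for $g\in\mathcal G$. One observes i.i.d. $X_1,\dots,X_n$ with density $f_{g_0}$ with respect to $\mu$, where $g_0\in\mathcal G$ is fixed. The log-likelihood is $\ell_n(f)=\sum_{i=1}^n\log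 f(X_i)$, and the NPMLE $\hat g$ is any maximizer of $g\mapsto\ell_n(f_g)$ over $\mathcal G$. For $c\in\mathbb R$, $$\mathcal G_n(c)=\{g\in\mathcal G:\ \ell_n(f_g)\ge\ell_n(f_{g_0})+c\}\cup\{\hat g\}.$$ The chi-square divergence is $\chi^2(f,f_0)=\|f/f_0-1\|^2_{L_2(f_0\,d\mu)}$. "Finitely discrete" means discrete and supported on finitely many points. *)

theory Defs
  imports "HOL-Probability.Probability"
begin

text \<open>
  The parameter space is the type \<^typ>\<open>real ^ 'd\<close>, so that \<open>d = CARD('d)\<close> is an arbitrary
  positive integer. Instead of numbering the coordinates, \<open>B :: 'd set\<close> is the set of Gaussian
  coordinates and its complement the set of Poisson coordinates; \<open>b = card B\<close> ranges over
  \<open>0, \<dots>, d\<close>. An observation is a pair of a real vector indexed by \<open>B\<close> and a vector of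
  natural numbers indexed by the complement of \<open>B\<close>.
\<close>

type_synonym 'd observation = "('d \<Rightarrow> real) \<times> ('d \<Rightarrow> nat)"

definition base_measure :: "'d::finite set \<Rightarrow> 'd observation measure" where
  "base_measure B = (\<Pi>\<^sub>M l\<in>B. lborel) \<Otimes>\<^sub>M (\<Pi>\<^sub>M l\<in>- B. count_space UNIV)"

definition component_density :: "'d::finite set \<Rightarrow> real ^ 'd \<Rightarrow> 'd observation \<Rightarrow> real" where
  "component_density B \<theta> x =
     (\<Prod>l\<in>B. std_normal_density (fst x l - \<theta> $ l)) *
     (\<Prod>l\<in>- B. (\<theta> $ l) ^ (snd x l) / fact (snd x l) * exp (- (\<theta> $ l)))"

text \<open>
  Probability measures supported on \<open>\<Theta>\<close>. No measurability of \<open>\<Theta>\<close> is required: the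
  condition says that the complement of \<open>\<Theta>\<close> is contained in a Borel null set. Hence
  integrals over \<open>\<Theta>\<close> with respect to such a measure are integrals over the whole space.
\<close>

definition mixing_measures :: "(real ^ 'd::finite) set \<Rightarrow> (real ^ 'd) measure set" where
  "mixing_measures \<Theta> = {g. prob_space g \<and> sets g = sets borel \<and> (AE \<theta> in g. \<theta> \<in> \<Theta>)}"

definition mixture_density ::
    "'d::finite set \<Rightarrow> (real ^ 'd) measure \<Rightarrow> 'd observation \<Rightarrow> real" where
  "mixture_density B g x = (LINT \<theta>|g. component_density B \<theta> x)"

definition finitely_discrete :: "'a measure \<Rightarrow> bool" where
  "finitely_discrete g \<longleftrightarrow> (\<exists>S. finite S \<and> S \<in> sets g \<and> emeasure g S = 1)"

text \<open>A sample of size \<open>n\<close> is given by the values \<open>x 0, \<dots>, x (n - 1)\<close>.\<close>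

definition log_likelihood :: "nat \<Rightarrow> (nat \<Rightarrow> 'a) \<Rightarrow> ('a \<Rightarrow> real) \<Rightarrow> real" where
  "log_likelihood n x f = (\<Sum>i<n. ln (f (x i)))"

definition is_NPMLE ::
    "'d::finite set \<Rightarrow> (real ^ 'd) set \<Rightarrow> nat \<Rightarrow> (nat \<Rightarrow> 'd observation) \<Rightarrow> (real ^ 'd) measure \<Rightarrow> bool"
  where
  "is_NPMLE B \<Theta> n x g \<longleftrightarrow> g \<in> mixing_measures \<Theta> \<and>
     (\<forall>h \<in> mixing_measures \<Theta>.
        log_likelihood n x (mixture_density B h) \<le> log_likelihood n x (mixture_density B g))"

text \<open>
  The measure \<open>gh\<close> is the chosen NPMLE. If \<open>\<Theta>\<close> is not closed, a maximizer of the likelihood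
  need not exist; for such samples nothing is added to the first set.
\<close>

definition likelihood_set ::
    "'d::finite set \<Rightarrow> (real ^ 'd) set \<Rightarrow> (real ^ 'd) measure \<Rightarrow> (real ^ 'd) measure \<Rightarrow>
     nat \<Rightarrow> (nat \<Rightarrow> 'd observation) \<Rightarrow> real \<Rightarrow> (real ^ 'd) measure set" where
  "likelihood_set B \<Theta> g0 gh n x c =
     {g \<in> mixing_measures \<Theta>.
        log_likelihood n x (mixture_density B g) \<ge> log_likelihood n x (mixture_density B g0) + c}
     \<union> {g. g = gh \<and> is_NPMLE B \<Theta> n x gh}"

definition chi_square :: "'a measure \<Rightarrow> ('a \<Rightarrow> real) \<Rightarrow> ('a \<Rightarrow> real) \<Rightarrow> ennreal" where
  "chi_square \<mu> f f0 = (\<integral>\<^sup>+ x. ennreal ((f x / f0 x - 1)\<^sup>2) \<partial>density \<mu> (\<lambda>x. ennreal (f0 x)))"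

text \<open>
  Stochastic order symbols for nonnegative extended-real-valued maps. A supremum over an
  uncountable class need not be measurable, so the probabilities are outer probabilities; for
  measurable maps these are the usual notions.
\<close>

definition bounded_in_probability :: "'w measure \<Rightarrow> (nat \<Rightarrow> 'w \<Rightarrow> ennreal) \<Rightarrow> bool" where
  "bounded_in_probability M Y \<longleftrightarrow>
     (\<forall>\<epsilon>>0. \<exists>K::real. \<forall>n. outer_measure_of M {\<omega> \<in> space M. Y n \<omega> > ennreal K} \<le> ennreal \<epsilon>)"

definition diverges_in_probability :: "'w measure \<Rightarrow> (nat \<Rightarrow> 'w \<Rightarrow> ennreal) \<Rightarrow> bool" where
  "diverges_in_probability M Y \<longleftrightarrow>
     (\<forall>K::real. (\<lambda>n. outer_measure_of M {\<omega> \<in> space M. Y n \<omega> \<le> ennreal K}) \<longlonglongrightarrow> 0)"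

end

theory Submission
  imports Defs
begin

text \<open>
Write \<open>f0\<close> for the true density and \<open>f\<^sub>g / f0 = 1 + s * h\<close> with \<open>h\<close> of norm one in \<open>L2(f0 d\<mu>)\<close>, so
that \<open>s\<^sup>2\<close> is the chi-square divergence. The log-likelihood ratio is the sum of
\<open>ln (1 + s * h (X i))\<close>, roughly \<open>s * (\<Sum>i. h (X i)) - s\<^sup>2 / 2 * (\<Sum>i. (h (X i))\<^sup>2)\<close>. For a single
\<open>h\<close> the first sum is of order \<open>sqrt n\<close> and the second of order \<open>n\<close>, which forces \<open>n * s\<^sup>2\<close> to be
bounded once the ratio is bounded below. The two statements say that this holds uniformly in \<open>g\<close>
precisely when \<open>g0\<close> has finite support.

Finite support. Expand \<open>exp (x * \<theta>)\<close> in powers of \<open>\<theta>\<close> in the Gaussian coordinates, and according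
to the value of the count in the Poisson coordinates. Then \<open>h\<close> is a series in fixed functions of
\<open>x\<close> whose coefficients are the integrals of fixed functions \<open>a\<close> of \<open>\<theta>\<close> against \<open>(g - g0) / s\<close>.
These coefficients are bounded, uniformly in \<open>g\<close> and up to factors growing exponentially in the
degree (\<open>jet_dual_bound\<close>): a nonnegative polynomial in \<open>exp \<theta>\<close> that vanishes exactly on the
support, to second order, has integral \<open>O(s)\<close> against \<open>g\<close>, so \<open>g\<close> lies quadratically close to the
support; up to that error \<open>a\<close> is its own Hermite interpolation at the support points, and integrals
of polynomials in \<open>exp \<theta>\<close> against \<open>g - g0\<close> are \<open>O(s)\<close> because such polynomials are means of
explicit square integrable functions of \<open>x\<close>. The factorials in the expansion absorb the exponential
factors and leave a geometrically dominated series with an envelope in \<open>L4(f0 d\<mu>)\<close>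
(\<open>relative_expansion\<close>). The linear and quadratic sums over all such \<open>h\<close> are then controlled by two
random variables that do not depend on \<open>h\<close>, with explicit first moments
(\<open>likelihood_ratio_scale_bounded\<close>).

Infinite support. Now the map that sends a bounded mixing weight \<open>\<phi>\<close> to its score
\<open>f\<^bsub>\<phi> g0\<^esub> / f0\<close> has infinite rank: it is injective, by the Stone-Weierstrass theorem, and there are
arbitrarily many disjoint balls charged by \<open>g0\<close>. Hence for every \<open>k\<close> there are \<open>k\<close> bounded weights
of mean zero with orthonormal scores (\<open>orthonormal_weights_exist\<close>). Let \<open>G\<close> be the vector of sums
of these scores over the sample, divided by \<open>sqrt n\<close>. For large \<open>n\<close> its squared length has mean \<open>k\<close> and
variance of order \<open>k\<close>, so for large \<open>k\<close> it exceeds any given level with high probability. Tilting \<open>g0\<close> along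
\<open>G / (8 * sqrt n)\<close> raises the log-likelihood by at least a fixed fraction of \<open>\<bar>G\<bar>\<^sup>2\<close>, while \<open>n\<close>
times the chi-square divergence of the tilted mixture is \<open>\<bar>G\<bar>\<^sup>2 / 64\<close>
(\<open>likelihood_set_contains_distant_mixture\<close>).
\<close>

section \<open>Independent samples\<close>

locale iid_sample = prob_space M for M :: "'w measure" +
  fixes L :: "'a measure" and X :: "nat \<Rightarrow> 'w \<Rightarrow> 'a"
  assumes indep: "indep_vars (\<lambda>_. L) X UNIV"
    and law: "\<And>i. distr M L (X i) = L"
begin

lemma sample_measurable [measurable]: "X i \<in> measurable M L"
  using indep by (auto simp: indep_vars_def)

lemma prob_space_law: "prob_space L"
  using prob_space_distr[OF sample_measurable, of 0] law by simp

lemma integrable_sample: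
  fixes f :: "'a \<Rightarrow> real"
  assumes "f \<in> borel_measurable L"
  shows "integrable M (\<lambda>\<omega>. f (X i \<omega>)) \<longleftrightarrow> integrable L f"
  using integrable_distr_eq[OF sample_measurable assms, of i] law by simp

lemma expectation_sample:
  fixes f :: "'a \<Rightarrow> real"
  assumes "f \<in> borel_measurable L"
  shows "expectation (\<lambda>\<omega>. f (X i \<omega>)) = (LINT x|L. f x)"
  using integral_distr[OF sample_measurable assms, of i] law by simp

lemma nn_integral_sample:
  assumes "f \<in> borel_measurable L"
  shows "(\<integral>\<^sup>+\<omega>. f (X i \<omega>) \<partial>M) = (\<integral>\<^sup>+x. f x \<partial>L)"
  using nn_integral_distr[OF sample_measurable, of f i] assms law by simp

text \<open>
The functional is defined on whole sequences and merely depends on the first \<open>n\<close> entries, so that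
statistics of the sample need not be restricted to finite index sets by hand.
\<close>

lemma indep_past:
  fixes F :: "(nat \<Rightarrow> 'a) \<Rightarrow> real" and f :: "'a \<Rightarrow> real"
  assumes F: "F \<in> borel_measurable (\<Pi>\<^sub>M i\<in>{..<n}. L)" and f: "f \<in> borel_measurable L"
    and past: "\<And>x. F (restrict x {..<n}) = F x"
  shows "indep_var borel (\<lambda>\<omega>. F (\<lambda>i. X i \<omega>)) borel (\<lambda>\<omega>. f (X n \<omega>))"
proof -
  have "indep_var (PiM {..<n} (\<lambda>_. L)) (\<lambda>\<omega>. restrict (\<lambda>i. X i \<omega>) {..<n})
          (PiM {n} (\<lambda>_. L)) (\<lambda>\<omega>. restrict (\<lambda>i. X i \<omega>) {n})"
    by (rule indep_var_restrict[OF indep]) auto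
  from indep_var_compose[OF this F, of "\<lambda>y. f (y n)" borel]
  have "indep_var borel (F \<circ> (\<lambda>\<omega>. restrict (\<lambda>i. X i \<omega>) {..<n})) borel
          ((\<lambda>y. f (y n)) \<circ> (\<lambda>\<omega>. restrict (\<lambda>i. X i \<omega>) {n}))"
    using f by measurable
  then show ?thesis by (simp add: comp_def past)
qed

lemma sum_square_mean_zero:
  fixes f :: "'a \<Rightarrow> real"
  assumes f [measurable]: "f \<in> borel_measurable L" and f2: "integrable L (\<lambda>x. (f x)\<^sup>2)"
    and mean: "(LINT x|L. f x) = 0"
  shows "integrable M (\<lambda>\<omega>. (\<Sum>i<n. f (X i \<omega>))\<^sup>2) \<and>
     expectation (\<lambda>\<omega>. (\<Sum>i<n. f (X i \<omega>))\<^sup>2) = real n * (LINT x|L. (f x)\<^sup>2)"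
proof (induction n)
  case 0 then show ?case by simp
next
  case (Suc n)
  let ?S = "\<lambda>\<omega>. \<Sum>i<n. f (X i \<omega>)"
  interpret L: prob_space L by (rule prob_space_law)
  have fi: "integrable L f"
    using f2 f by (rule L.square_integrable_imp_integrable[rotated])
  have int_f: "integrable M (\<lambda>\<omega>. f (X i \<omega>))" for i
    by (simp add: integrable_sample fi)
  have int_f2: "integrable M (\<lambda>\<omega>. (f (X i \<omega>))\<^sup>2)" for i
    using integrable_sample[of "\<lambda>x. (f x)\<^sup>2" i] f2 by simp
  have ind: "indep_var borel ?S borel (\<lambda>\<omega>. f (X n \<omega>))"
    by (rule indep_past[where F="\<lambda>x. \<Sum>i<n. f (x i)"]) auto
  have int_S: "integrable M ?S" by (simp add: int_f)
  note prod = indep_var_lebesgue_integral[OF ind int_S int_f] indep_var_integrable[OF ind int_S int_f]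
  have eq: "(\<Sum>i<Suc n. f (X i \<omega>))\<^sup>2 = (?S \<omega>)\<^sup>2 + 2 * (?S \<omega> * f (X n \<omega>)) + (f (X n \<omega>))\<^sup>2" for \<omega>
    by (simp add: power2_eq_square algebra_simps)
  have "expectation (\<lambda>\<omega>. f (X n \<omega>)) = 0" by (simp add: expectation_sample mean)
  moreover have "expectation (\<lambda>\<omega>. (f (X n \<omega>))\<^sup>2) = (LINT x|L. (f x)\<^sup>2)"
    using expectation_sample[of "\<lambda>x. (f x)\<^sup>2"] by simp
  ultimately show ?case
    unfolding eq using Suc prod int_f2 by (simp add: algebra_simps)
qed

lemma centered_sum_square_le:
  fixes f :: "'a \<Rightarrow> real"
  assumes f [measurable]: "f \<in> borel_measurable L" and f2: "integrable L (\<lambda>x. (f x)\<^sup>2)"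
  defines "m \<equiv> LINT x|L. f x"
  shows "integrable M (\<lambda>\<omega>. (\<Sum>i<n. f (X i \<omega>) - m)\<^sup>2)"
    and "expectation (\<lambda>\<omega>. (\<Sum>i<n. f (X i \<omega>) - m)\<^sup>2) \<le> real n * (LINT x|L. (f x)\<^sup>2)"
proof -
  interpret L: prob_space L by (rule prob_space_law)
  have fi: "integrable L f"
    using f2 f by (rule L.square_integrable_imp_integrable[rotated])
  have eq: "(f x - m)\<^sup>2 = (f x)\<^sup>2 - 2 * m * f x + m\<^sup>2" for x
    by (simp add: power2_eq_square algebra_simps)
  have i2: "integrable L (\<lambda>x. (f x - m)\<^sup>2)" unfolding eq using f2 fi by simp
  have mz: "(LINT x|L. f x - m) = 0" using fi by (simp add: m_def L.prob_space)
  have "(LINT x|L. (f x - m)\<^sup>2) = (LINT x|L. (f x)\<^sup>2) - m\<^sup>2"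
    unfolding eq using f2 fi by (simp add: L.prob_space m_def power2_eq_square)
  then have le: "(LINT x|L. (f x - m)\<^sup>2) \<le> (LINT x|L. (f x)\<^sup>2)" by simp
  note * = sum_square_mean_zero[OF _ i2 mz, of n]
  show "integrable M (\<lambda>\<omega>. (\<Sum>i<n. f (X i \<omega>) - m)\<^sup>2)" using * by simp
  show "expectation (\<lambda>\<omega>. (\<Sum>i<n. f (X i \<omega>) - m)\<^sup>2) \<le> real n * (LINT x|L. (f x)\<^sup>2)"
    using * le by (simp add: mult_left_mono)
qed

text \<open>
A first-moment bound from the variance, through \<open>2 * a * \<bar>S\<bar> \<le> a\<^sup>2 + S\<^sup>2\<close> with \<open>a = sqrt n * v\<close>.
First moments are needed because they can be added over infinitely many functions \<open>f\<close>.
\<close>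

lemma nn_integral_abs_centered_sum_le:
  fixes f :: "'a \<Rightarrow> real"
  assumes f [measurable]: "f \<in> borel_measurable L" and f2: "integrable L (\<lambda>x. (f x)\<^sup>2)"
    and le: "(LINT x|L. (f x)\<^sup>2) \<le> v\<^sup>2" and v: "v > 0"
  shows "(\<integral>\<^sup>+\<omega>. ennreal \<bar>\<Sum>i<n. f (X i \<omega>) - (LINT x|L. f x)\<bar> \<partial>M) \<le> ennreal (sqrt (real n) * v)"
proof (cases "n = 0")
  case False
  let ?S = "\<lambda>\<omega>. \<Sum>i<n. f (X i \<omega>) - (LINT x|L. f x)"
  define a where "a = sqrt (real n) * v"
  have a: "a > 0" using False v by (simp add: a_def)
  note S2 = centered_sum_square_le[OF f f2, of n]
  have "(\<integral>\<^sup>+\<omega>. ennreal \<bar>?S \<omega>\<bar> \<partial>M) \<le> (\<integral>\<^sup>+\<omega>. ennreal (a / 2 + (?S \<omega>)\<^sup>2 / (2 * a)) \<partial>M)"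
  proof (intro nn_integral_mono ennreal_leI)
    fix \<omega>
    have "0 \<le> (a - \<bar>?S \<omega>\<bar>)\<^sup>2" by simp
    then have "2 * a * \<bar>?S \<omega>\<bar> \<le> a\<^sup>2 + (?S \<omega>)\<^sup>2" by (simp add: power2_diff)
    then show "\<bar>?S \<omega>\<bar> \<le> a / 2 + (?S \<omega>)\<^sup>2 / (2 * a)"
      using a by (simp add: field_simps power2_eq_square)
  qed
  also have "\<dots> = ennreal (expectation (\<lambda>\<omega>. a / 2 + (?S \<omega>)\<^sup>2 / (2 * a)))"
    using S2(1) a by (intro nn_integral_eq_integral) auto
  also have "\<dots> \<le> ennreal a"
  proof (rule ennreal_leI)
    have "expectation (\<lambda>\<omega>. a / 2 + (?S \<omega>)\<^sup>2 / (2 * a)) = a / 2 + expectation (\<lambda>\<omega>. (?S \<omega>)\<^sup>2) / (2 * a)"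
      using S2(1) by (simp add: prob_space)
    also have "expectation (\<lambda>\<omega>. (?S \<omega>)\<^sup>2) \<le> a\<^sup>2"
      using S2(2) mult_left_mono[OF le, of "real n"] by (simp add: a_def power_mult_distrib)
    then have "a / 2 + expectation (\<lambda>\<omega>. (?S \<omega>)\<^sup>2) / (2 * a) \<le> a / 2 + a\<^sup>2 / (2 * a)"
      using a by (simp add: divide_right_mono)
    also have "\<dots> = a" using a by (simp add: power2_eq_square)
    finally show "expectation (\<lambda>\<omega>. a / 2 + (?S \<omega>)\<^sup>2 / (2 * a)) \<le> a" .
  qed
  finally show ?thesis by (simp add: a_def)
qed simp

lemma integrable_bounded_sample:
  fixes G :: "(nat \<Rightarrow> 'a) \<Rightarrow> real"
  assumes "(\<lambda>\<omega>. G (\<lambda>i. X i \<omega>)) \<in> borel_measurable M" 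
    and "\<And>x. (\<And>i. x i \<in> space L) \<Longrightarrow> \<bar>G x\<bar> \<le> C"
  shows "integrable M (\<lambda>\<omega>. G (\<lambda>i. X i \<omega>))"
  by (rule integrable_const_bound[where B=C])
     (use assms measurable_space[OF sample_measurable] in auto)

end

section \<open>Score statistics of high dimension\<close>

context iid_sample begin

text \<open>
Bounded functionals of the first \<open>n\<close> observations form an algebra. This makes every product in the
second-moment recursion below integrable and independent of the next observation.
\<close>

definition bounded_statistic :: "nat \<Rightarrow> ((nat \<Rightarrow> 'a) \<Rightarrow> real) \<Rightarrow> bool" where
  "bounded_statistic n F \<longleftrightarrow> F \<in> borel_measurable (\<Pi>\<^sub>M i\<in>{..<n}. L) \<and>
     (\<forall>x. F (restrict x {..<n}) = F x) \<and> (\<exists>C. \<forall>x. (\<forall>i. x i \<in> space L) \<longrightarrow> \<bar>F x\<bar> \<le> C)"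

lemma bounded_statistic_const: "bounded_statistic n (\<lambda>_. c)"
  by (auto simp: bounded_statistic_def)

lemma bounded_statistic_add:
  assumes "bounded_statistic n F" "bounded_statistic n G"
  shows "bounded_statistic n (\<lambda>x. F x + G x)"
proof -
  from assms obtain C D where "\<And>x. (\<forall>i. x i \<in> space L) \<Longrightarrow> \<bar>F x\<bar> \<le> C"
    "\<And>x. (\<forall>i. x i \<in> space L) \<Longrightarrow> \<bar>G x\<bar> \<le> D"
    by (auto simp: bounded_statistic_def)
  then have "\<forall>x. (\<forall>i. x i \<in> space L) \<longrightarrow> \<bar>F x + G x\<bar> \<le> C + D"
    by (smt (verit))
  with assms show ?thesis unfolding bounded_statistic_def by auto
qed

lemma bounded_statistic_mult:
  assumes "bounded_statistic n F" "bounded_statistic n G"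
  shows "bounded_statistic n (\<lambda>x. F x * G x)"
proof -
  from assms obtain C D where "\<And>x. (\<forall>i. x i \<in> space L) \<Longrightarrow> \<bar>F x\<bar> \<le> C"
    "\<And>x. (\<forall>i. x i \<in> space L) \<Longrightarrow> \<bar>G x\<bar> \<le> D"
    by (auto simp: bounded_statistic_def)
  then have "\<bar>F x\<bar> * \<bar>G x\<bar> \<le> \<bar>C\<bar> * \<bar>D\<bar>" if "\<forall>i. x i \<in> space L" for x
    using that by (intro mult_mono) (force intro: order_trans[OF _ abs_ge_self])+
  then have "\<bar>F x * G x\<bar> \<le> \<bar>C\<bar> * \<bar>D\<bar>" if "\<forall>i. x i \<in> space L" for x
    using that by (simp add: abs_mult)
  with assms show ?thesis unfolding bounded_statistic_def by auto
qed

lemma bounded_statistic_sum: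
  assumes "finite I" "\<And>i. i \<in> I \<Longrightarrow> bounded_statistic n (F i)"
  shows "bounded_statistic n (\<lambda>x. \<Sum>i\<in>I. F i x)"
  using assms by (induction I rule: finite_induct) (auto simp: bounded_statistic_const bounded_statistic_add)

lemma bounded_statistic_observation:
  assumes [measurable]: "f \<in> borel_measurable L" and "\<And>x. x \<in> space L \<Longrightarrow> \<bar>f x\<bar> \<le> C" and i: "i < n"
  shows "bounded_statistic n (\<lambda>x. f (x i))"
proof -
  have [measurable]: "(\<lambda>x. x i) \<in> measurable (\<Pi>\<^sub>M i\<in>{..<n}. L) L"
    using i by (intro measurable_component_singleton) auto
  show ?thesis unfolding bounded_statistic_def using assms by auto
qed

lemma integrable_bounded_statistic:
  assumes "bounded_statistic n F"
  shows "integrable M (\<lambda>\<omega>. F (\<lambda>i. X i \<omega>))"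
proof -
  from assms have F: "F \<in> borel_measurable (\<Pi>\<^sub>M i\<in>{..<n}. L)" by (simp add: bounded_statistic_def)
  have "(\<lambda>\<omega>. F (restrict (\<lambda>i. X i \<omega>) {..<n})) \<in> borel_measurable M"
    by (rule measurable_compose[OF _ F]) simp
  then have "(\<lambda>\<omega>. F (\<lambda>i. X i \<omega>)) \<in> borel_measurable M"
    using assms by (simp add: bounded_statistic_def)
  moreover from assms obtain C where "\<And>x. (\<forall>i. x i \<in> space L) \<Longrightarrow> \<bar>F x\<bar> \<le> C"
    by (auto simp: bounded_statistic_def)
  ultimately show ?thesis by (intro integrable_bounded_sample) auto
qed

lemma expectation_past_times_new:
  assumes F: "bounded_statistic n F" and f: "f \<in> borel_measurable L" "integrable L f"
  shows "expectation (\<lambda>\<omega>. F (\<lambda>i. X i \<omega>) * f (X n \<omega>)) = expectation (\<lambda>\<omega>. F (\<lambda>i. X i \<omega>)) * (LINT x|L. f x)"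
    and "integrable M (\<lambda>\<omega>. F (\<lambda>i. X i \<omega>) * f (X n \<omega>))"
proof -
  have ind: "indep_var borel (\<lambda>\<omega>. F (\<lambda>i. X i \<omega>)) borel (\<lambda>\<omega>. f (X n \<omega>))"
    using F f by (intro indep_past) (auto simp: bounded_statistic_def simp del: restrict_apply)
  have i: "integrable M (\<lambda>\<omega>. F (\<lambda>i. X i \<omega>))" "integrable M (\<lambda>\<omega>. f (X n \<omega>))"
    using F f by (auto simp: integrable_bounded_statistic integrable_sample)
  show "expectation (\<lambda>\<omega>. F (\<lambda>i. X i \<omega>) * f (X n \<omega>)) = expectation (\<lambda>\<omega>. F (\<lambda>i. X i \<omega>)) * (LINT x|L. f x)"
    using indep_var_lebesgue_integral[OF ind i] f by (simp add: expectation_sample)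
  show "integrable M (\<lambda>\<omega>. F (\<lambda>i. X i \<omega>) * f (X n \<omega>))"
    by (rule indep_var_integrable[OF ind i])
qed

end

text \<open>
The squared length of the vector of sums \<open>\<Sum>i<n. h j (x i)\<close>, without its diagonal: the sum of
\<open>h j (x i) * h j (x i')\<close> over all \<open>j\<close> and all \<open>i \<noteq> i'\<close>.
\<close>

definition off_diagonal :: "nat \<Rightarrow> (nat \<Rightarrow> 'a \<Rightarrow> real) \<Rightarrow> nat \<Rightarrow> (nat \<Rightarrow> 'a) \<Rightarrow> real" where
  "off_diagonal k h n x = (\<Sum>j<k. (\<Sum>i<n. h j (x i))\<^sup>2 - (\<Sum>i<n. (h j (x i))\<^sup>2))"

locale orthonormal_scores = iid_sample M L X
  for M :: "'w measure" and L :: "'a measure" and X :: "nat \<Rightarrow> 'w \<Rightarrow> 'a" +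
  fixes k :: nat and h :: "nat \<Rightarrow> 'a \<Rightarrow> real" and C :: real
  assumes h_measurable [measurable]: "\<And>j. h j \<in> borel_measurable L"
    and h_bounded: "\<And>j x. x \<in> space L \<Longrightarrow> \<bar>h j x\<bar> \<le> C"
    and h_mean: "\<And>j. j < k \<Longrightarrow> (LINT x|L. h j x) = 0"
    and h_orthonormal: "\<And>j l. j < k \<Longrightarrow> l < k \<Longrightarrow> (LINT x|L. h j x * h l x) = (if j = l then 1 else 0)"
begin

lemma C_nonneg: "C \<ge> 0"
proof -
  interpret L: prob_space L by (rule prob_space_law)
  obtain x where "x \<in> space L" using L.not_empty by auto
  from h_bounded[OF this, of 0] show ?thesis by linarith
qed

lemma integrable_h: "integrable L (h j)"
proof -
  interpret L: prob_space L by (rule prob_space_law)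
  show ?thesis by (rule L.integrable_const_bound[where B=C]) (auto simp: h_bounded)
qed

lemma abs_hh_le: "x \<in> space L \<Longrightarrow> \<bar>h j x * h l x\<bar> \<le> C\<^sup>2"
  unfolding abs_mult power2_eq_square using h_bounded C_nonneg by (intro mult_mono) auto

lemma integrable_hh: "integrable L (\<lambda>x. h j x * h l x)"
proof -
  interpret L: prob_space L by (rule prob_space_law)
  show ?thesis by (rule L.integrable_const_bound[where B="C\<^sup>2"]) (auto simp: abs_hh_le)
qed

text \<open>
A new observation adds \<open>2 * (\<Sum>j. S j * h j (X n))\<close> to the off-diagonal part, where \<open>S\<close> is the
vector of the sums so far. This increment has conditional mean zero given the past, and by
orthonormality its second moment is \<open>4 * n * k\<close>. The second moments of the increments therefore
add up, to \<open>2 * k * n * (n - 1)\<close>.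
\<close>

lemma off_diagonal_second_moment:
  "bounded_statistic n (off_diagonal k h n) \<and>
   expectation (\<lambda>\<omega>. (off_diagonal k h n (\<lambda>i. X i \<omega>))\<^sup>2) \<le> 2 * real k * (real n)\<^sup>2"
proof
  have bs: "bounded_statistic n (\<lambda>x. \<Sum>i<n. h j (x i))" for n j
    by (intro bounded_statistic_sum bounded_statistic_observation[where C=C]) (auto simp: h_bounded)
  have W: "bounded_statistic n (off_diagonal k h n)" for n
    unfolding off_diagonal_def power2_eq_square diff_conv_add_uminus
    by (subst mult_minus1[symmetric],
        intro bounded_statistic_sum bounded_statistic_add bounded_statistic_mult bs bounded_statistic_const
         bounded_statistic_observation[where C=C]) (auto simp: h_bounded)
  show "bounded_statistic n (off_diagonal k h n)" by (rule W)
  let ?X = "\<lambda>\<omega> i. X i \<omega>"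
  let ?W = "\<lambda>n \<omega>. off_diagonal k h n (?X \<omega>)" and ?S = "\<lambda>n j \<omega>. \<Sum>i<n. h j (X i \<omega>)"
  show "expectation (\<lambda>\<omega>. (?W n \<omega>)\<^sup>2) \<le> 2 * real k * (real n)\<^sup>2"
  proof (induction n)
    case 0 then show ?case by (simp add: off_diagonal_def)
  next
    case (Suc n)
    let ?T = "\<lambda>\<omega>. \<Sum>j<k. ?S n j \<omega> * h j (X n \<omega>)"
    have rec: "?W (Suc n) \<omega> = ?W n \<omega> + 2 * ?T \<omega>" for \<omega>
      by (simp add: off_diagonal_def sum_distrib_left sum.distrib[symmetric])
         (intro sum.cong; simp add: power2_eq_square algebra_simps)
    have sq: "(?W (Suc n) \<omega>)\<^sup>2 = (?W n \<omega>)\<^sup>2 +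
        (\<Sum>j<k. 4 * ((?W n \<omega> * ?S n j \<omega>) * h j (X n \<omega>))) +
        (\<Sum>j<k. \<Sum>l<k. 4 * ((?S n j \<omega> * ?S n l \<omega>) * (h j (X n \<omega>) * h l (X n \<omega>))))" for \<omega>
    proof -
      have "(?W (Suc n) \<omega>)\<^sup>2 = (?W n \<omega>)\<^sup>2 + 4 * (?W n \<omega> * ?T \<omega>) + 4 * (?T \<omega> * ?T \<omega>)"
        unfolding rec by (simp add: power2_eq_square algebra_simps)
      also have "?W n \<omega> * ?T \<omega> = (\<Sum>j<k. (?W n \<omega> * ?S n j \<omega>) * h j (X n \<omega>))"
        by (subst sum_distrib_left, intro sum.cong refl) (simp only: mult.assoc)
      also have "?T \<omega> * ?T \<omega> = (\<Sum>j<k. \<Sum>l<k. (?S n j \<omega> * ?S n l \<omega>) * (h j (X n \<omega>) * h l (X n \<omega>)))"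
        by (subst sum_product, intro sum.cong refl) (simp only: mult_ac)
      finally show ?thesis by (simp only: sum_distrib_left)
    qed
    have b1: "bounded_statistic n (\<lambda>x. off_diagonal k h n x * (\<Sum>i<n. h j (x i)))" for j
      by (intro bounded_statistic_mult W bs)
    have b2: "bounded_statistic n (\<lambda>x. (\<Sum>i<n. h j (x i)) * (\<Sum>i<n. h l (x i)))" for j l
      by (intro bounded_statistic_mult bs)
    have b3: "bounded_statistic n (\<lambda>x. (off_diagonal k h n x)\<^sup>2)"
      unfolding power2_eq_square by (intro bounded_statistic_mult W)
    note e1 = expectation_past_times_new[OF b1 h_measurable integrable_h]
    note e2 = expectation_past_times_new[OF b2 _ integrable_hh]
    have S2: "expectation (\<lambda>\<omega>. ?S n j \<omega> * ?S n j \<omega>) = real n" if "j < k" for j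
      using sum_square_mean_zero[OF h_measurable, of j n] h_orthonormal[of j j] integrable_hh[of j j] h_mean[OF that] that
      by (simp add: power2_eq_square)
    have "expectation (\<lambda>\<omega>. (?W (Suc n) \<omega>)\<^sup>2) = expectation (\<lambda>\<omega>. (?W n \<omega>)\<^sup>2) +
       (\<Sum>j<k. 4 * (expectation (\<lambda>\<omega>. ?W n \<omega> * ?S n j \<omega>) * (LINT x|L. h j x))) +
       (\<Sum>j<k. \<Sum>l<k. 4 * (expectation (\<lambda>\<omega>. ?S n j \<omega> * ?S n l \<omega>) * (LINT x|L. h j x * h l x)))"
      unfolding sq using integrable_bounded_statistic[OF b3] e1 e2 by simp
    also have "(\<Sum>j<k. 4 * (expectation (\<lambda>\<omega>. ?W n \<omega> * ?S n j \<omega>) * (LINT x|L. h j x))) = 0"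
      by (simp add: h_mean)
    also have "(\<Sum>j<k. \<Sum>l<k. 4 * (expectation (\<lambda>\<omega>. ?S n j \<omega> * ?S n l \<omega>) * (LINT x|L. h j x * h l x))) =
       (\<Sum>j<k. 4 * real n)"
    proof (rule sum.cong[OF refl])
      fix j assume j: "j \<in> {..<k}"
      have "(\<Sum>l<k. 4 * (expectation (\<lambda>\<omega>. ?S n j \<omega> * ?S n l \<omega>) * (LINT x|L. h j x * h l x))) =
        (\<Sum>l<k. if j = l then 4 * real n else 0)"
        using j S2 h_orthonormal by (intro sum.cong) auto
      then show "(\<Sum>l<k. 4 * (expectation (\<lambda>\<omega>. ?S n j \<omega> * ?S n l \<omega>) * (LINT x|L. h j x * h l x))) = 4 * real n"
        using j by simp
    qed
    finally show ?case using Suc.IH by (simp add: power2_eq_square algebra_simps)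
  qed
qed


text \<open>
Chebyshev's inequality for the off-diagonal part and for every entry of the empirical Gram matrix.
For large \<open>n\<close> the squared length of the vector of sums has mean \<open>n * k\<close> but standard deviation of
order \<open>n * sqrt k\<close> only, so it concentrates as \<open>k\<close> grows.
\<close>

lemma typical_event:
  fixes n :: nat
  assumes k: "k \<ge> 2" and n: "n > 0"
  shows "\<exists>E\<in>events. prob E \<le> 32 / k + real k ^ 4 * C ^ 4 / n \<and>
    (\<forall>\<omega>\<in>space M - E.
       real k / 4 * n \<le> (\<Sum>j<k. (\<Sum>i<n. h j (X i \<omega>))\<^sup>2) \<and>
       (\<Sum>j<k. (\<Sum>i<n. h j (X i \<omega>))\<^sup>2) \<le> 3 * real k * n \<and>
       (\<forall>j<k. \<forall>l<k. \<bar>(\<Sum>i<n. h j (X i \<omega>) * h l (X i \<omega>)) - (if j = l then real n else 0)\<bar> \<le> real n / real k))"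
proof -
  let ?W = "\<lambda>\<omega>. off_diagonal k h n (\<lambda>i. X i \<omega>)"
  let ?D = "\<lambda>j l \<omega>. \<Sum>i<n. h j (X i \<omega>) * h l (X i \<omega>) - (LINT x|L. h j x * h l x)"
  define E0 where "E0 = {\<omega>\<in>space M. (?W \<omega>)\<^sup>2 \<ge> (real n * k / 4)\<^sup>2}"
  define E1 where "E1 j l = {\<omega>\<in>space M. (?D j l \<omega>)\<^sup>2 \<ge> (real n / k)\<^sup>2}" for j l
  have [measurable]: "?W \<in> borel_measurable M" unfolding off_diagonal_def by measurable
  have [measurable]: "E0 \<in> events" "E1 j l \<in> events" for j l
    unfolding E0_def E1_def by measurable
  have W2: "integrable M (\<lambda>\<omega>. (?W \<omega>)\<^sup>2)"
    unfolding power2_eq_square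
    using off_diagonal_second_moment by (intro integrable_bounded_statistic bounded_statistic_mult) auto
  have "prob E0 \<le> expectation (\<lambda>\<omega>. (?W \<omega>)\<^sup>2) / (real n * k / 4)\<^sup>2"
    unfolding E0_def using W2 k n by (intro integral_Markov_inequality_measure[where A="{}"]) auto
  also have "\<dots> \<le> (2 * real k * (real n)\<^sup>2) / (real n * k / 4)\<^sup>2"
    using off_diagonal_second_moment by (intro divide_right_mono) auto
  also have "\<dots> = 32 / k" using k n by (simp add: power2_eq_square field_simps)
  finally have P0: "prob E0 \<le> 32 / k" .
  have P1: "prob (E1 j l) \<le> real k ^ 2 * C ^ 4 / n" for j l
  proof -
    have le4: "\<bar>(h j x * h l x)\<^sup>2\<bar> \<le> C ^ 4" if "x \<in> space L" for x
      using abs_hh_le[OF that, of j l] power_mono[of "\<bar>h j x * h l x\<bar>" "C\<^sup>2" 2] by simp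
    interpret L: prob_space L by (rule prob_space_law)
    have i4: "integrable L (\<lambda>x. (h j x * h l x)\<^sup>2)"
      by (rule L.integrable_const_bound[where B="C^4"]) (use le4 in auto)
    have "(LINT x|L. (h j x * h l x)\<^sup>2) \<le> (LINT x|L. C ^ 4)"
      using i4 le4 by (intro integral_mono) auto
    then have le: "(LINT x|L. (h j x * h l x)\<^sup>2) \<le> C ^ 4" by (simp add: L.prob_space)
    have "prob (E1 j l) \<le> expectation (\<lambda>\<omega>. (?D j l \<omega>)\<^sup>2) / (real n / k)\<^sup>2"
      unfolding E1_def using centered_sum_square_le(1)[OF _ i4, of n] k n
      by (intro integral_Markov_inequality_measure[where A="{}"]) auto
    also have "\<dots> \<le> (real n * C ^ 4) / (real n / k)\<^sup>2"
      using centered_sum_square_le(2)[OF _ i4, of n] mult_left_mono[OF le, of "real n"]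
      by (intro divide_right_mono) auto
    also have "\<dots> = real k ^ 2 * C ^ 4 / n" using k n by (simp add: power2_eq_square field_simps)
    finally show ?thesis .
  qed
  define E where "E = E0 \<union> (\<Union>j<k. \<Union>l<k. E1 j l)"
  have "prob E \<le> prob E0 + prob (\<Union>j<k. \<Union>l<k. E1 j l)"
    unfolding E_def by (intro measure_Un_le) auto
  also have "prob (\<Union>j<k. \<Union>l<k. E1 j l) \<le> (\<Sum>j<k. prob (\<Union>l<k. E1 j l))"
    by (intro measure_UNION_le) auto
  also have "\<dots> \<le> (\<Sum>j<k. \<Sum>l<k. prob (E1 j l))"
    by (intro sum_mono measure_UNION_le) auto
  also have "\<dots> \<le> (\<Sum>j<k. \<Sum>l<k. real k ^ 2 * C ^ 4 / n)" by (intro sum_mono P1)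
  also have "\<dots> = real k ^ 4 * C ^ 4 / n" by (simp add: power2_eq_square power4_eq_xxxx)
  finally have PE: "prob E \<le> 32 / k + real k ^ 4 * C ^ 4 / n" using P0 by linarith
  show ?thesis
  proof (rule bexI[of _ E], intro conjI ballI PE)
    show "E \<in> events" unfolding E_def by auto
    fix \<omega> assume w: "\<omega> \<in> space M - E"
    have W: "\<bar>?W \<omega>\<bar> \<le> real n * k / 4"
      using w by (auto simp: E_def E0_def abs_le_square_iff[of "?W \<omega>" "real n * k / 4", simplified])
    have D: "\<bar>?D j l \<omega>\<bar> \<le> real n / k" if "j < k" "l < k" for j l
    proof -
      have "\<omega> \<notin> E1 j l" using w that by (auto simp: E_def)
      then have "(?D j l \<omega>)\<^sup>2 \<le> (real n / k)\<^sup>2" using w by (auto simp: E1_def)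
      then show ?thesis using abs_le_square_iff[of "?D j l \<omega>" "real n / k"] by simp
    qed
    show D': "\<forall>j<k. \<forall>l<k. \<bar>(\<Sum>i<n. h j (X i \<omega>) * h l (X i \<omega>)) - (if j = l then real n else 0)\<bar> \<le> real n / real k"
    proof (intro allI impI)
      fix j l assume "j < k" "l < k"
      then show "\<bar>(\<Sum>i<n. h j (X i \<omega>) * h l (X i \<omega>)) - (if j = l then real n else 0)\<bar> \<le> real n / real k"
        using D[of j l] by (cases "j = l") (simp_all add: sum_subtractf h_orthonormal)
    qed
    have "\<bar>(\<Sum>j<k. \<Sum>i<n. (h j (X i \<omega>))\<^sup>2) - real n * k\<bar> = \<bar>\<Sum>j<k. (\<Sum>i<n. (h j (X i \<omega>))\<^sup>2) - n\<bar>"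
      by (simp add: sum_subtractf mult.commute)
    also have "\<dots> \<le> (\<Sum>j<k. \<bar>(\<Sum>i<n. (h j (X i \<omega>))\<^sup>2) - n\<bar>)" by (rule sum_abs)
    also have "\<dots> \<le> (\<Sum>j<k. n / k)"
    proof (rule sum_mono)
      fix j assume "j \<in> {..<k}"
      with D'[rule_format, of j j] show "\<bar>(\<Sum>i<n. (h j (X i \<omega>))\<^sup>2) - n\<bar> \<le> n / k"
        by (simp add: power2_eq_square)
    qed
    also have "\<dots> = n" using k by simp
    finally have diag: "\<bar>(\<Sum>j<k. \<Sum>i<n. (h j (X i \<omega>))\<^sup>2) - real n * k\<bar> \<le> n" .
    have "(\<Sum>j<k. (\<Sum>i<n. h j (X i \<omega>))\<^sup>2) = ?W \<omega> + (\<Sum>j<k. \<Sum>i<n. (h j (X i \<omega>))\<^sup>2)"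
      by (simp add: off_diagonal_def sum_subtractf)
    moreover have "real n * 2 \<le> real n * k" using k by (intro mult_left_mono) auto
    ultimately show "real k / 4 * n \<le> (\<Sum>j<k. (\<Sum>i<n. h j (X i \<omega>))\<^sup>2)"
       "(\<Sum>j<k. (\<Sum>i<n. h j (X i \<omega>))\<^sup>2) \<le> 3 * real k * n"
      using W diag by (auto simp: field_simps abs_le_iff)
  qed
qed


end

lemma sum_ln_one_plus_ge:
  fixes u :: "nat \<Rightarrow> real"
  assumes "\<And>i. i < n \<Longrightarrow> \<bar>u i\<bar> \<le> 1 / 2"
  shows "(\<Sum>i<n. ln (1 + u i)) \<ge> (\<Sum>i<n. u i) - 2 * (\<Sum>i<n. (u i)\<^sup>2)"
proof -
  have "u i - 2 * (u i)\<^sup>2 \<le> ln (1 + u i)" if "i < n" for i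
    using abs_ln_one_plus_x_minus_x_bound[OF assms[OF that]] by (simp add: abs_le_iff)
  then have "(\<Sum>i<n. u i - 2 * (u i)\<^sup>2) \<le> (\<Sum>i<n. ln (1 + u i))" by (intro sum_mono) auto
  then show ?thesis by (simp add: sum_subtractf sum_distrib_left)
qed

text \<open>
Errors of size \<open>n / k\<close> in the entries change the quadratic form by at most
\<open>n / k * (\<Sum>j<k. \<bar>t j\<bar>)\<^sup>2\<close>, which the Cauchy-Schwarz inequality bounds by \<open>n * (\<Sum>j<k. (t j)\<^sup>2)\<close>.
\<close>

lemma quadratic_form_le:
  fixes t :: "nat \<Rightarrow> real" and A :: "nat \<Rightarrow> nat \<Rightarrow> real"
  assumes A: "\<And>j l. j < k \<Longrightarrow> l < k \<Longrightarrow> \<bar>A j l - (if j = l then n else 0)\<bar> \<le> n / real k" and n: "n \<ge> 0"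
  shows "(\<Sum>j<k. \<Sum>l<k. t j * t l * A j l) \<le> 2 * n * (\<Sum>j<k. (t j)\<^sup>2)"
proof -
  let ?d = "\<lambda>j l. if j = l then n else 0"
  have "(\<Sum>j<k. \<Sum>l<k. t j * t l * A j l) = (\<Sum>j<k. \<Sum>l<k. t j * t l * (A j l - ?d j l)) + (\<Sum>j<k. \<Sum>l<k. t j * t l * ?d j l)"
    by (simp add: sum.distrib[symmetric] algebra_simps)
  also have "(\<Sum>j<k. \<Sum>l<k. t j * t l * ?d j l) = n * (\<Sum>j<k. (t j)\<^sup>2)"
    by (simp add: if_distrib[of "\<lambda>x. _ * x"] sum_distrib_left power2_eq_square mult.commute cong: if_cong)
  also have "(\<Sum>j<k. \<Sum>l<k. t j * t l * (A j l - ?d j l)) \<le> (\<Sum>j<k. \<Sum>l<k. \<bar>t j\<bar> * \<bar>t l\<bar> * (n / k))"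
  proof (intro sum_mono)
    fix j l assume "j \<in> {..<k}" "l \<in> {..<k}"
    then have "\<bar>t j * t l * (A j l - ?d j l)\<bar> \<le> \<bar>t j\<bar> * \<bar>t l\<bar> * (n / k)"
      unfolding abs_mult by (intro mult_left_mono A) auto
    then show "t j * t l * (A j l - ?d j l) \<le> \<bar>t j\<bar> * \<bar>t l\<bar> * (n / k)" by linarith
  qed
  also have "\<dots> = (\<Sum>j<k. \<bar>t j\<bar>)\<^sup>2 * (n / k)"
    by (simp add: power2_eq_square sum_product flip: sum_distrib_right sum_divide_distrib)
  also have "\<dots> \<le> (k * (\<Sum>j<k. (t j)\<^sup>2)) * (n / k)"
    using Cauchy_Schwarz_ineq_sum[of "\<lambda>_. 1" "\<lambda>j. \<bar>t j\<bar>" "{..<k}"] n by (intro mult_right_mono) auto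
  also have "\<dots> \<le> n * (\<Sum>j<k. (t j)\<^sup>2)" by (cases "k = 0") auto
  finally show ?thesis by linarith
qed

context orthonormal_scores begin

text \<open>
The vector \<open>t\<close> points in the direction of the sums \<open>G\<close>. With the factor \<open>1 / 8\<close>, the linear term
of the log-likelihood is \<open>\<bar>G\<bar>\<^sup>2 / (8 * n)\<close>, and the quadratic loss, where the error of the logarithm
contributes a factor \<open>2\<close> and the Gram matrix another one, takes away at most half of it.
\<close>

lemma likelihood_gain:
  fixes \<omega> :: 'w and n :: nat and G t :: "nat \<Rightarrow> real"
  defines "G \<equiv> \<lambda>j. (\<Sum>i<n. h j (X i \<omega>))"
  defines "t \<equiv> \<lambda>j. G j / (8 * real n)"
  assumes n: "n > 0" "48 * real k ^ 3 * C\<^sup>2 \<le> 64 * n" and \<omega>: "\<omega> \<in> space M"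
    and lower: "real k / 4 * n \<le> (\<Sum>j<k. (G j)\<^sup>2)" and upper: "(\<Sum>j<k. (G j)\<^sup>2) \<le> 3 * real k * n"
    and gram: "\<forall>j<k. \<forall>l<k. \<bar>(\<Sum>i<n. h j (X i \<omega>) * h l (X i \<omega>)) - (if j = l then real n else 0)\<bar> \<le> real n / real k"
  shows "\<And>y. (\<And>j. j < k \<Longrightarrow> \<bar>y j\<bar> \<le> C) \<Longrightarrow> \<bar>\<Sum>j<k. t j * y j\<bar> \<le> 1 / 2"
    and "(\<Sum>i<n. ln (1 + (\<Sum>j<k. t j * h j (X i \<omega>)))) \<ge> k / 64"
    and "n * (\<Sum>j<k. (t j)\<^sup>2) \<ge> k / 256"
proof -
  have t2: "(\<Sum>j<k. (t j)\<^sup>2) = (\<Sum>j<k. (G j)\<^sup>2) / (64 * real n ^ 2)"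
    by (simp add: t_def power_divide sum_divide_distrib power_mult_distrib)
  show small: "\<bar>\<Sum>j<k. t j * y j\<bar> \<le> 1 / 2" if y: "\<And>j. j < k \<Longrightarrow> \<bar>y j\<bar> \<le> C" for y
  proof -
    have "(\<Sum>j<k. t j * y j)\<^sup>2 \<le> (\<Sum>j<k. (t j)\<^sup>2) * (\<Sum>j<k. (y j)\<^sup>2)" by (rule Cauchy_Schwarz_ineq_sum)
    also have "\<dots> \<le> (3 * real k * n / (64 * real n ^ 2)) * (\<Sum>j<k. C\<^sup>2)"
      unfolding t2 using upper y C_nonneg by (intro mult_mono divide_right_mono sum_mono sum_nonneg)
        (auto simp: abs_le_square_iff[symmetric])
    also have "\<dots> = 3 * (real k)\<^sup>2 * C\<^sup>2 / (64 * n)" using n by (simp add: power2_eq_square field_simps)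
    also have "\<dots> \<le> 1 / 4"
    proof (cases "k = 0")
      case False
      have "12 * real k ^ 2 * C\<^sup>2 \<le> 48 * real k ^ 3 * C\<^sup>2"
        using False by (intro mult_right_mono) (auto simp: power3_eq_cube power2_eq_square)
      then show ?thesis using n by (simp add: field_simps)
    qed simp
    also have "\<dots> = (1 / 2)\<^sup>2" by (simp add: power2_eq_square)
    finally show ?thesis using abs_le_square_iff[of "\<Sum>j<k. t j * y j" "1 / 2"] by simp
  qed
  let ?u = "\<lambda>i. \<Sum>j<k. t j * h j (X i \<omega>)"
  have X: "X i \<omega> \<in> space L" for i using measurable_space[OF sample_measurable \<omega>] .
  have "(\<Sum>i<n. ?u i) = (\<Sum>j<k. t j * G j)"
    unfolding G_def sum_distrib_left by (rule sum.swap)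
  also have "\<dots> = (\<Sum>j<k. (G j)\<^sup>2) / (8 * n)"
    by (simp add: t_def sum_divide_distrib power2_eq_square)
  finally have lin: "(\<Sum>i<n. ?u i) = (\<Sum>j<k. (G j)\<^sup>2) / (8 * n)" .
  have "(\<Sum>i<n. (?u i)\<^sup>2) = (\<Sum>i<n. \<Sum>j<k. \<Sum>l<k. t j * t l * (h j (X i \<omega>) * h l (X i \<omega>)))"
    unfolding power2_eq_square sum_product by (intro sum.cong refl) (simp add: algebra_simps)
  also have "\<dots> = (\<Sum>j<k. \<Sum>i<n. \<Sum>l<k. t j * t l * (h j (X i \<omega>) * h l (X i \<omega>)))" by (rule sum.swap)
  also have "\<dots> = (\<Sum>j<k. \<Sum>l<k. \<Sum>i<n. t j * t l * (h j (X i \<omega>) * h l (X i \<omega>)))"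
    by (intro sum.cong refl sum.swap)
  also have "\<dots> = (\<Sum>j<k. \<Sum>l<k. t j * t l * (\<Sum>i<n. h j (X i \<omega>) * h l (X i \<omega>)))"
    by (simp add: sum_distrib_left)
  also have "\<dots> \<le> 2 * real n * (\<Sum>j<k. (t j)\<^sup>2)"
    using gram by (intro quadratic_form_le) auto
  finally have quad: "(\<Sum>i<n. (?u i)\<^sup>2) \<le> (\<Sum>j<k. (G j)\<^sup>2) / (32 * n)"
    unfolding t2 using n by (simp add: power2_eq_square)
  have "(\<Sum>i<n. ?u i) - 2 * (\<Sum>i<n. (?u i)\<^sup>2) \<le> (\<Sum>i<n. ln (1 + ?u i))"
    by (intro sum_ln_one_plus_ge small h_bounded X)
  moreover have "k / 64 \<le> (\<Sum>j<k. (G j)\<^sup>2) / (16 * n)" using lower n by (simp add: field_simps)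
  moreover have "(\<Sum>j<k. (G j)\<^sup>2) / (8 * n) - 2 * ((\<Sum>j<k. (G j)\<^sup>2) / (32 * n)) = (\<Sum>j<k. (G j)\<^sup>2) / (16 * n)"
    using n by (simp add: field_simps)
  ultimately show "(\<Sum>i<n. ln (1 + ?u i)) \<ge> k / 64" using lin quad by linarith
  show "n * (\<Sum>j<k. (t j)\<^sup>2) \<ge> k / 256"
    unfolding t2 using lower n by (simp add: field_simps power2_eq_square)
qed

end

section \<open>Likelihood ratios over dominated series\<close>

lemma (in prob_space) prob_ge_le_nn_integral:
  assumes u [measurable]: "u \<in> borel_measurable M" and le: "(\<integral>\<^sup>+\<omega>. u \<omega> \<partial>M) \<le> ennreal b" and a: "a > 0" and b: "b \<ge> 0"
  shows "prob {\<omega>\<in>space M. ennreal a \<le> u \<omega>} \<le> b / a"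
proof -
  have "1 \<le> ennreal (1 / a) * u \<omega>" if "ennreal a \<le> u \<omega>" for \<omega>
  proof -
    have "1 = ennreal (1 / a) * ennreal a" using a by (simp add: ennreal_mult[symmetric])
    also have "\<dots> \<le> ennreal (1 / a) * u \<omega>" by (intro mult_left_mono that) simp
    finally show ?thesis .
  qed
  then have "emeasure M {\<omega>\<in>space M. ennreal a \<le> u \<omega>} \<le> emeasure M {\<omega>\<in>space M. 1 \<le> ennreal (1 / a) * u \<omega>}"
    by (intro emeasure_mono) auto
  also have "\<dots> \<le> ennreal (1 / a) * (\<integral>\<^sup>+\<omega>. u \<omega> * indicator (space M) \<omega> \<partial>M)"
    using nn_integral_Markov_inequality[of u "space M" M "ennreal (1 / a)"] u by simp
  also have "(\<integral>\<^sup>+\<omega>. u \<omega> * indicator (space M) \<omega> \<partial>M) = (\<integral>\<^sup>+\<omega>. u \<omega> \<partial>M)"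
    by (intro nn_integral_cong) auto
  also have "ennreal (1 / a) * (\<integral>\<^sup>+\<omega>. u \<omega> \<partial>M) \<le> ennreal (1 / a) * ennreal b"
    by (intro mult_left_mono le) simp
  also have "\<dots> = ennreal (b / a)" using a b by (simp add: ennreal_mult[symmetric])
  finally show ?thesis using a b by (simp add: emeasure_eq_measure)
qed

text \<open>
Only the negative part of \<open>y\<close> earns a quadratic correction: for large positive \<open>y\<close> the logarithm
exceeds every bound of the form \<open>y - c * y\<^sup>2\<close>.
\<close>

lemma ln_one_plus_le_negative_part:
  fixes y :: real
  assumes "y > -1"
  shows "ln (1 + y) \<le> y - (max (- y) 0)\<^sup>2 / 2"
proof (cases "y \<ge> 0")
  case True then show ?thesis using ln_add_one_self_le_self[of y] by simp
next
  case False
  define f where "f = (\<lambda>x::real. x - x\<^sup>2 / 2 - ln (1 + x))"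
  have "f 0 \<le> f y"
  proof (rule DERIV_nonpos_imp_nonincreasing[of y 0 f])
    fix x assume x: "y \<le> x" "x \<le> 0"
    have "(f has_real_derivative (1 - x - 1 / (1 + x))) (at x)"
      unfolding f_def using x assms by (auto intro!: derivative_eq_intros)
    moreover have "1 - x - 1 / (1 + x) = - (x\<^sup>2 / (1 + x))"
      using x assms by (simp add: field_simps power2_eq_square)
    moreover have "x\<^sup>2 / (1 + x) \<ge> 0" using x assms by simp
    ultimately show "\<exists>d. (f has_real_derivative d) (at x) \<and> d \<le> 0" by auto
  qed (use False in simp)
  with False show ?thesis by (simp add: f_def)
qed

text \<open>
The deterministic core of the finite-support case. From \<open>y\<^sup>2 \<le> m * \<bar>y\<bar> + y ^ 4 / m\<^sup>2\<close> the lower bound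
on the second moments and the upper bound on the fourth moments give a lower bound for
\<open>\<Sum>i<n. \<bar>y i\<bar>\<close> of order \<open>n\<close>. As \<open>\<Sum>i<n. y i\<close> is only of order \<open>sqrt n\<close>, about half of it comes
from negative \<open>y i\<close>, so that the quadratic correction is at least \<open>n * s\<^sup>2 * \<kappa> / 2\<close>. What remains
is a quadratic inequality for \<open>s * sqrt n\<close>.
\<close>

lemma likelihood_ratio_forces_small_scale:
  fixes y :: "nat \<Rightarrow> real"
  assumes n: "n > 0" "16 * m\<^sup>2 * K1\<^sup>2 \<le> real n" and m: "m > 0" "4 * K2 \<le> m\<^sup>2" and K1: "K1 \<ge> 0"
    and s: "s \<ge> 0" and pos: "\<And>i. i < n \<Longrightarrow> 1 + s * y i > 0"
    and ln: "(\<Sum>i<n. ln (1 + s * y i)) \<ge> - c" and c: "c \<ge> 0"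
    and y1: "\<bar>\<Sum>i<n. y i\<bar> \<le> K1 * sqrt n" and y2: "3 / 4 * n \<le> (\<Sum>i<n. (y i)\<^sup>2)"
    and y4: "(\<Sum>i<n. (y i) ^ 4) \<le> K2 * n"
  defines "\<kappa> \<equiv> 1 / (64 * m\<^sup>2)"
  shows "n * s\<^sup>2 \<le> 4 / \<kappa> * (c + K1\<^sup>2 / \<kappa>)"
proof -
  have \<kappa>: "\<kappa> > 0" using m by (simp add: \<kappa>_def)
  let ?neg = "\<lambda>i. max (- y i) 0"
  have "(y i)\<^sup>2 \<le> m * \<bar>y i\<bar> + (y i) ^ 4 / m\<^sup>2" for i
  proof (cases "\<bar>y i\<bar> \<le> m")
    case True
    then have "\<bar>y i\<bar> * \<bar>y i\<bar> \<le> m * \<bar>y i\<bar>" by (intro mult_right_mono) auto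
    moreover have "0 \<le> (y i) ^ 4 / m\<^sup>2" by simp
    ultimately show ?thesis by (simp only: abs_mult_self_eq power2_eq_square[of "y i"])
  next
    case False
    then have "m\<^sup>2 \<le> (y i)\<^sup>2" using m by (simp add: abs_le_square_iff[symmetric])
    then have "(y i)\<^sup>2 * m\<^sup>2 \<le> (y i)\<^sup>2 * (y i)\<^sup>2" by (intro mult_left_mono) auto
    then have "(y i)\<^sup>2 \<le> (y i) ^ 4 / m\<^sup>2" using m by (simp add: field_simps power2_eq_square power4_eq_xxxx)
    moreover have "0 \<le> m * \<bar>y i\<bar>" using m by simp
    ultimately show ?thesis by linarith
  qed
  then have "(\<Sum>i<n. (y i)\<^sup>2) \<le> (\<Sum>i<n. m * \<bar>y i\<bar> + (y i) ^ 4 / m\<^sup>2)" by (intro sum_mono) auto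
  also have "\<dots> = m * (\<Sum>i<n. \<bar>y i\<bar>) + (\<Sum>i<n. (y i) ^ 4) / m\<^sup>2"
    by (simp add: sum.distrib sum_distrib_left sum_divide_distrib)
  also have "(\<Sum>i<n. (y i) ^ 4) / m\<^sup>2 \<le> n / 4"
  proof -
    have "4 * (\<Sum>i<n. (y i) ^ 4) \<le> (4 * K2) * n" using y4 by simp
    also have "\<dots> \<le> m\<^sup>2 * n" using m by (intro mult_right_mono) auto
    finally show ?thesis using m by (simp add: field_simps)
  qed
  finally have "m * (\<Sum>i<n. \<bar>y i\<bar>) \<ge> n / 2" using y2 by simp
  then have abs: "(\<Sum>i<n. \<bar>y i\<bar>) \<ge> n / (2 * m)" using m by (simp add: field_simps)
  have "K1 * sqrt n \<le> n / (4 * m)"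
  proof -
    have "(4 * m * K1)\<^sup>2 \<le> (sqrt n)\<^sup>2" using n by (simp add: power_mult_distrib)
    then have "4 * m * K1 \<le> sqrt n" by (rule power2_le_imp_le) simp
    then have "4 * m * K1 * sqrt n \<le> sqrt n * sqrt n" by (intro mult_right_mono) auto
    then show ?thesis using m by (simp add: field_simps)
  qed
  moreover have "(\<Sum>i<n. ?neg i) = ((\<Sum>i<n. \<bar>y i\<bar>) - (\<Sum>i<n. y i)) / 2"
    unfolding sum_subtractf[symmetric] sum_divide_distrib by (intro sum.cong) (auto simp: max_def)
  ultimately have neg1: "(\<Sum>i<n. ?neg i) \<ge> n / (8 * m)" using abs y1 by (simp add: field_simps abs_le_iff)
  have "(n / (8 * m))\<^sup>2 \<le> (\<Sum>i<n. ?neg i)\<^sup>2" using neg1 m by (intro power_mono) auto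
  also have "\<dots> \<le> n * (\<Sum>i<n. (?neg i)\<^sup>2)"
    using Cauchy_Schwarz_ineq_sum[of "\<lambda>_. 1" ?neg "{..<n}"] by simp
  finally have neg2: "n * \<kappa> \<le> (\<Sum>i<n. (?neg i)\<^sup>2)"
    using n m by (simp add: \<kappa>_def power_divide power_mult_distrib power2_eq_square field_simps)
  have "- c \<le> (\<Sum>i<n. s * y i - (max (- (s * y i)) 0)\<^sup>2 / 2)"
  proof (intro order_trans[OF ln] sum_mono ln_one_plus_le_negative_part)
    fix i assume "i \<in> {..<n}"
    then show "s * y i > - 1" using pos[of i] by simp
  qed
  also have "\<dots> = (\<Sum>i<n. s * y i - s\<^sup>2 * (?neg i)\<^sup>2 / 2)"
    using s by (intro sum.cong refl) (auto simp: max_def power_mult_distrib zero_le_mult_iff mult_le_0_iff)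
  also have "\<dots> = s * (\<Sum>i<n. y i) - s\<^sup>2 * (\<Sum>i<n. (?neg i)\<^sup>2) / 2"
    by (simp add: sum_subtractf sum_distrib_left sum_divide_distrib)
  also have "\<dots> \<le> s * (K1 * sqrt n) - s\<^sup>2 * (n * \<kappa>) / 2"
    using s y1 neg2 by (intro diff_mono mult_left_mono divide_right_mono) (auto simp: abs_le_iff)
  finally have ineq: "\<kappa> / 2 * (s * sqrt n)\<^sup>2 \<le> K1 * (s * sqrt n) + c"
    by (simp add: power_mult_distrib algebra_simps)
  have "0 \<le> (\<kappa> / 2 * (s * sqrt n) - K1)\<^sup>2 / \<kappa>" using \<kappa> by simp
  also have "\<dots> = \<kappa> / 4 * (s * sqrt n)\<^sup>2 - K1 * (s * sqrt n) + K1\<^sup>2 / \<kappa>"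
    using \<kappa> by (simp add: power2_diff field_simps power2_eq_square)
  finally have "\<kappa> / 4 * (s * sqrt n)\<^sup>2 \<le> c + K1\<^sup>2 / \<kappa>" using ineq by linarith
  then have "(s * sqrt n)\<^sup>2 \<le> 4 / \<kappa> * (c + K1\<^sup>2 / \<kappa>)" using \<kappa> by (simp add: field_simps)
  then show ?thesis by (simp add: power_mult_distrib mult.commute)
qed

context iid_sample begin

text \<open>
Each function contributes to the mean at most a multiple of \<open>r i\<close>, and these bounds are summable.
\<close>

lemma nn_integral_deviations_le:
  fixes \<phi> :: "nat \<Rightarrow> 'a \<Rightarrow> real"
  assumes meas [measurable]: "\<And>i. \<phi> i \<in> borel_measurable L" and \<Phi>: "integrable L (\<lambda>x. (\<Phi> x)\<^sup>2)"
    and r: "summable r" "\<And>i. r i > 0" and dom: "\<And>i x. x \<in> space L \<Longrightarrow> \<bar>\<phi> i x\<bar> \<le> r i * \<Phi> x"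
  shows "(\<integral>\<^sup>+\<omega>. (\<Sum>i. ennreal \<bar>\<Sum>m<n. \<phi> i (X m \<omega>) - (LINT x|L. \<phi> i x)\<bar>) \<partial>M) \<le>
     ennreal (sqrt n * ((sqrt (LINT x|L. (\<Phi> x)\<^sup>2) + 1) * suminf r))"
proof -
  \<comment> \<open>The summand \<open>1\<close> keeps \<open>v\<close> positive when \<open>\<Phi>\<close> vanishes almost everywhere.\<close>
  define v where "v = sqrt (LINT x|L. (\<Phi> x)\<^sup>2) + 1"
  have v: "v > 0" unfolding v_def by (intro add_nonneg_pos) auto
  have "(sqrt (LINT x|L. (\<Phi> x)\<^sup>2))\<^sup>2 \<le> v\<^sup>2" unfolding v_def by (intro power_mono) auto
  then have v2: "(LINT x|L. (\<Phi> x)\<^sup>2) \<le> v\<^sup>2" by simp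
  have sq: "(\<phi> i x)\<^sup>2 \<le> (r i)\<^sup>2 * (\<Phi> x)\<^sup>2" if "x \<in> space L" for i x
    using power_mono[OF dom[OF that], of i 2] by (simp add: power_mult_distrib)
  have sqi: "integrable L (\<lambda>x. (\<phi> i x)\<^sup>2)" for i
    by (rule Bochner_Integration.integrable_bound[of L "\<lambda>x. (r i)\<^sup>2 * (\<Phi> x)\<^sup>2"]) (use \<Phi> sq in \<open>auto intro!: AE_I2\<close>)
  have "(LINT x|L. (\<phi> i x)\<^sup>2) \<le> (LINT x|L. (r i)\<^sup>2 * (\<Phi> x)\<^sup>2)" for i
    using sqi \<Phi> sq by (intro integral_mono) auto
  then have le: "(LINT x|L. (\<phi> i x)\<^sup>2) \<le> (r i * v)\<^sup>2" for i
    using mult_left_mono[OF v2, of "(r i)\<^sup>2"] by (simp add: power_mult_distrib) (meson order_trans)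
  have "(\<integral>\<^sup>+\<omega>. (\<Sum>i. ennreal \<bar>\<Sum>m<n. \<phi> i (X m \<omega>) - (LINT x|L. \<phi> i x)\<bar>) \<partial>M) =
      (\<Sum>i. \<integral>\<^sup>+\<omega>. ennreal \<bar>\<Sum>m<n. \<phi> i (X m \<omega>) - (LINT x|L. \<phi> i x)\<bar> \<partial>M)"
    by (rule nn_integral_suminf) measurable
  also have "\<dots> \<le> (\<Sum>i. ennreal (sqrt n * (r i * v)))"
    by (intro suminf_le nn_integral_abs_centered_sum_le) (use sqi le r v in auto)
  also have "\<dots> = ennreal (\<Sum>i. sqrt n * (r i * v))"
    using r v by (intro suminf_ennreal2) (auto simp: less_imp_le intro!: summable_mult summable_mult2)
  also have "(\<Sum>i. sqrt n * (r i * v)) = sqrt n * (v * suminf r)"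
    using r(1) by (simp add: suminf_mult summable_mult2 suminf_mult2[symmetric] mult.commute)
  finally show ?thesis by (simp add: v_def)
qed

text \<open>
The right-hand side does not depend on the coefficients \<open>e\<close>: it bounds the deviations of all
functions \<open>H\<close> of the class at once.
\<close>

lemma abs_series_deviation_le:
  fixes \<phi> :: "nat \<Rightarrow> 'a \<Rightarrow> real"
  assumes meas [measurable]: "\<And>i. \<phi> i \<in> borel_measurable L" and \<Phi>: "integrable L \<Phi>"
    and r: "summable r" and dom: "\<And>i x. x \<in> space L \<Longrightarrow> \<bar>\<phi> i x\<bar> \<le> r i * \<Phi> x"
    and e: "\<And>i. \<bar>e i\<bar> \<le> (1::real)" and H: "\<And>x. x \<in> space L \<Longrightarrow> H x = (\<Sum>i. e i * \<phi> i x)" and \<omega>: "\<omega> \<in> space M"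
  shows "ennreal \<bar>\<Sum>m<n. H (X m \<omega>) - (LINT x|L. H x)\<bar> \<le>
     (\<Sum>i. ennreal \<bar>\<Sum>m<n. \<phi> i (X m \<omega>) - (LINT x|L. \<phi> i x)\<bar>)"
proof -
  have X: "X m \<omega> \<in> space L" for m using measurable_space[OF sample_measurable \<omega>] .
  have dom': "\<bar>e i * \<phi> i x\<bar> \<le> r i * \<Phi> x" if "x \<in> space L" for i x
    using mult_mono[OF e dom[OF that], of i i] by (simp add: abs_mult)
  have sm: "summable (\<lambda>i. \<bar>e i * \<phi> i x\<bar>)" if "x \<in> space L" for x
    by (rule summable_comparison_test'[of "\<lambda>i. r i * \<Phi> x" 0]) (use r dom'[OF that] in \<open>auto intro: summable_mult2\<close>)
  have ii: "integrable L (\<lambda>x. e i * \<phi> i x)" for i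
    by (rule Bochner_Integration.integrable_bound[of L "\<lambda>x. r i * \<Phi> x"])
      (use \<Phi> in \<open>auto intro!: AE_I2 order_trans[OF dom' abs_ge_self]\<close>)
  have ib: "(LINT x|L. \<bar>e i * \<phi> i x\<bar>) \<le> r i * (LINT x|L. \<Phi> x)" for i
  proof -
    have "(LINT x|L. \<bar>e i * \<phi> i x\<bar>) \<le> (LINT x|L. r i * \<Phi> x)"
      using ii \<Phi> dom' by (intro integral_mono) auto
    then show ?thesis by simp
  qed
  have sI: "summable (\<lambda>i. LINT x|L. \<bar>e i * \<phi> i x\<bar>)"
    by (rule summable_comparison_test'[of "\<lambda>i. r i * (LINT x|L. \<Phi> x)" 0]) (use r ib in \<open>auto intro: summable_mult2\<close>)
  have "(LINT x|L. H x) = (LINT x|L. (\<Sum>i. e i * \<phi> i x))" by (intro Bochner_Integration.integral_cong refl H)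
  also have "(\<lambda>i. LINT x|L. e i * \<phi> i x) sums \<dots>"
    using ii sm sI by (intro sums_integral) auto
  finally have sumI: "(\<lambda>i. LINT x|L. e i * \<phi> i x) sums (LINT x|L. H x)" .
  have sumH: "(\<lambda>i. e i * \<phi> i x) sums H x" if "x \<in> space L" for x
    using summable_rabs_cancel[OF sm[OF that]] H[OF that] by (simp add: summable_sums)
  define d where "d i = (\<Sum>m<n. \<phi> i (X m \<omega>) - (LINT x|L. \<phi> i x))" for i
  have "(\<lambda>i. \<Sum>m<n. e i * \<phi> i (X m \<omega>) - (LINT x|L. e i * \<phi> i x)) sums (\<Sum>m<n. H (X m \<omega>) - (LINT x|L. H x))"
    by (intro sums_sum sums_diff sumH sumI X)
  also have "(\<lambda>i. \<Sum>m<n. e i * \<phi> i (X m \<omega>) - (LINT x|L. e i * \<phi> i x)) = (\<lambda>i. e i * d i)"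
    by (simp add: d_def sum_distrib_left right_diff_distrib)
  finally have sums: "(\<lambda>i. e i * d i) sums (\<Sum>m<n. H (X m \<omega>) - (LINT x|L. H x))" .
  show ?thesis
  proof (cases "summable (\<lambda>i. \<bar>d i\<bar>)")
    case True
    have le: "\<bar>e i * d i\<bar> \<le> \<bar>d i\<bar>" for i using e[of i] by (simp add: abs_mult mult_left_le_one_le)
    have sm: "summable (\<lambda>i. \<bar>e i * d i\<bar>)"
      by (rule summable_comparison_test'[OF True, of 0]) (use le in auto)
    have "\<bar>\<Sum>m<n. H (X m \<omega>) - (LINT x|L. H x)\<bar> = \<bar>\<Sum>i. e i * d i\<bar>" using sums by (simp add: sums_iff)
    also have "\<dots> \<le> (\<Sum>i. \<bar>e i * d i\<bar>)" using summable_rabs[OF sm] by simp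
    also have "\<dots> \<le> (\<Sum>i. \<bar>d i\<bar>)" using sm True le by (intro suminf_le) auto
    finally have "ennreal \<bar>\<Sum>m<n. H (X m \<omega>) - (LINT x|L. H x)\<bar> \<le> ennreal (\<Sum>i. \<bar>d i\<bar>)" by (rule ennreal_leI)
    also have "\<dots> = (\<Sum>i. ennreal \<bar>d i\<bar>)" using True by (simp add: suminf_ennreal2)
    finally show ?thesis by (simp add: d_def)
  next
    case False
    then have "(\<Sum>i. ennreal \<bar>d i\<bar>) = \<top>"
      using summable_suminf_not_top[of "\<lambda>i. \<bar>d i\<bar>"] by (metis abs_ge_zero)
    then show ?thesis by (simp add: d_def)
  qed
qed

end

text \<open>
A countable family of functions below a summable multiple of a common envelope with finite fourth
moment. The class under study consists of the series \<open>\<Sum>i. e i * \<psi> i x\<close> with \<open>\<bar>e i\<bar> \<le> 1\<close>.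
\<close>

locale dominated_series = iid_sample M L X
  for M :: "'w measure" and L :: "'a measure" and X :: "nat \<Rightarrow> 'w \<Rightarrow> 'a" +
  fixes \<psi> :: "nat \<Rightarrow> 'a \<Rightarrow> real" and r :: "nat \<Rightarrow> real" and \<Psi> :: "'a \<Rightarrow> real"
  assumes \<psi>_measurable [measurable]: "\<And>i. \<psi> i \<in> borel_measurable L"
    and \<Psi>_measurable [measurable]: "\<Psi> \<in> borel_measurable L"
    and r_pos: "\<And>i. r i > 0" and r_summable: "summable r"
    and dom: "\<And>i x. x \<in> space L \<Longrightarrow> \<bar>\<psi> i x\<bar> \<le> r i * \<Psi> x"
    and \<Psi>4: "integrable L (\<lambda>x. (\<Psi> x) ^ 4)"
begin

lemma \<Psi>_nonneg: "x \<in> space L \<Longrightarrow> \<Psi> x \<ge> 0"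
  using dom[of x 0] r_pos[of 0] by (meson abs_ge_zero order_trans zero_le_mult_iff not_le)

lemma \<Psi>2: "integrable L (\<lambda>x. (\<Psi> x)\<^sup>2)"
proof -
  interpret L: prob_space L by (rule prob_space_law)
  show ?thesis
    by (rule L.square_integrable_imp_integrable) (use \<Psi>4 in \<open>simp_all flip: power_mult\<close>)
qed

lemma \<Psi>1: "integrable L \<Psi>"
proof -
  interpret L: prob_space L by (rule prob_space_law)
  show ?thesis
    by (rule L.square_integrable_imp_integrable) (use \<Psi>2 in simp_all)
qed

lemma dom2: "x \<in> space L \<Longrightarrow> \<bar>\<psi> i x * \<psi> j x\<bar> \<le> r i * r j * (\<Psi> x)\<^sup>2"
  using mult_mono[OF dom[of x i] dom[of x j]] r_pos[of i] \<Psi>_nonneg[of x]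
  by (simp add: abs_mult power2_eq_square mult_ac)

text \<open>
Uniform bounds over the class: \<open>dev1\<close> for the deviation of the sum of \<open>h\<close> from its mean, and \<open>dev2\<close>
for the deviation of the sum of \<open>h\<^sup>2\<close>, whose double series arises by squaring that of \<open>h\<close>.
\<close>

definition dev1 :: "nat \<Rightarrow> 'w \<Rightarrow> ennreal" where
  "dev1 n \<omega> = (\<Sum>i. ennreal \<bar>\<Sum>m<n. \<psi> i (X m \<omega>) - (LINT x|L. \<psi> i x)\<bar>)"

definition dev2 :: "nat \<Rightarrow> 'w \<Rightarrow> ennreal" where
  "dev2 n \<omega> = (\<Sum>i. \<Sum>j. ennreal \<bar>\<Sum>m<n. \<psi> i (X m \<omega>) * \<psi> j (X m \<omega>) - (LINT x|L. \<psi> i x * \<psi> j x)\<bar>)"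

lemma dev_measurable [measurable]: "dev1 n \<in> borel_measurable M" "dev2 n \<in> borel_measurable M"
  unfolding dev1_def dev2_def by measurable

lemma nn_integral_dev1: "\<exists>v>0. \<forall>n. (\<integral>\<^sup>+\<omega>. dev1 n \<omega> \<partial>M) \<le> ennreal (sqrt n * v)"
proof -
  define v where "v = (sqrt (LINT x|L. (\<Psi> x)\<^sup>2) + 1) * suminf r"
  have "v > 0" unfolding v_def by (intro mult_pos_pos add_nonneg_pos suminf_pos r_summable r_pos) auto
  moreover have "(\<integral>\<^sup>+\<omega>. dev1 n \<omega> \<partial>M) \<le> ennreal (sqrt n * v)" for n
    unfolding dev1_def v_def by (rule nn_integral_deviations_le) (use r_pos r_summable \<Psi>2 dom in auto)
  ultimately show ?thesis by blast
qed

lemma nn_integral_dev2: "\<exists>v>0. \<forall>n. (\<integral>\<^sup>+\<omega>. dev2 n \<omega> \<partial>M) \<le> ennreal (sqrt n * v)"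
proof -
  define v where "v = sqrt (LINT x|L. ((\<Psi> x)\<^sup>2)\<^sup>2) + 1"
  have v: "v > 0" unfolding v_def by (intro add_nonneg_pos) auto
  have R: "suminf r > 0" by (intro suminf_pos r_summable r_pos)
  have \<Psi>4': "integrable L (\<lambda>x. ((\<Psi> x)\<^sup>2)\<^sup>2)" using \<Psi>4 by (simp flip: power_mult)
  have "(\<integral>\<^sup>+\<omega>. dev2 n \<omega> \<partial>M) \<le> ennreal (sqrt n * (v * (suminf r * suminf r)))" for n
  proof -
    have "(\<integral>\<^sup>+\<omega>. dev2 n \<omega> \<partial>M) = (\<Sum>i. \<integral>\<^sup>+\<omega>. (\<Sum>j. ennreal
        \<bar>\<Sum>m<n. \<psi> i (X m \<omega>) * \<psi> j (X m \<omega>) - (LINT x|L. \<psi> i x * \<psi> j x)\<bar>) \<partial>M)"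
      unfolding dev2_def by (rule nn_integral_suminf) measurable
    also have "\<dots> \<le> (\<Sum>i. ennreal (sqrt n * (v * (\<Sum>j. r i * r j))))"
    proof (rule suminf_le)
      fix i
      have "summable (\<lambda>j. r i * r j)" by (rule summable_mult[OF r_summable])
      then show "(\<integral>\<^sup>+\<omega>. (\<Sum>j. ennreal \<bar>\<Sum>m<n. \<psi> i (X m \<omega>) * \<psi> j (X m \<omega>) - (LINT x|L. \<psi> i x * \<psi> j x)\<bar>) \<partial>M) \<le>
          ennreal (sqrt n * (v * (\<Sum>j. r i * r j)))"
        unfolding v_def
        by (intro nn_integral_deviations_le \<Psi>4') (measurable, simp_all only: r_pos mult_pos_pos dom2)
    qed auto
    also have "\<dots> = (\<Sum>i. ennreal ((sqrt n * v * suminf r) * r i))"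
      using r_summable by (simp add: suminf_mult mult_ac)
    also have "\<dots> = ennreal (sqrt n * v * suminf r * suminf r)"
      using v R r_pos r_summable
      by (subst suminf_ennreal2) (auto simp: suminf_mult less_imp_le summable_mult)
    finally show ?thesis by (simp add: mult_ac)
  qed
  moreover have "v * (suminf r * suminf r) > 0" using v R by simp
  ultimately show ?thesis by blast
qed

lemma series_bound:
  assumes e: "\<And>i. \<bar>e i\<bar> \<le> (1::real)" and x: "x \<in> space L"
  shows "\<bar>\<Sum>i. e i * \<psi> i x\<bar> \<le> suminf r * \<Psi> x"
proof -
  have le: "\<bar>e i * \<psi> i x\<bar> \<le> r i * \<Psi> x" for i
    using mult_mono[OF e dom[OF x], of i i] by (simp add: abs_mult)
  have s: "summable (\<lambda>i. \<bar>e i * \<psi> i x\<bar>)"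
    by (rule summable_comparison_test'[of "\<lambda>i. r i * \<Psi> x" 0]) (use r_summable le in \<open>auto intro: summable_mult2\<close>)
  have "\<bar>\<Sum>i. e i * \<psi> i x\<bar> \<le> (\<Sum>i. \<bar>e i * \<psi> i x\<bar>)" using summable_rabs[OF s] .
  also have "\<dots> \<le> (\<Sum>i. r i * \<Psi> x)" using s r_summable le by (intro suminf_le) (auto intro: summable_mult2)
  also have "\<dots> = suminf r * \<Psi> x" using r_summable by (simp add: suminf_mult2)
  finally show ?thesis .
qed

lemma series_deviation:
  assumes e: "\<And>i. \<bar>e i\<bar> \<le> (1::real)" and h: "\<And>x. x \<in> space L \<Longrightarrow> h x = (\<Sum>i. e i * \<psi> i x)" and \<omega>: "\<omega> \<in> space M"
  shows "ennreal \<bar>\<Sum>m<n. h (X m \<omega>) - (LINT x|L. h x)\<bar> \<le> dev1 n \<omega>"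
    and "ennreal \<bar>\<Sum>m<n. (h (X m \<omega>))\<^sup>2 - (LINT x|L. (h x)\<^sup>2)\<bar> \<le> dev2 n \<omega>"
proof -
  show "ennreal \<bar>\<Sum>m<n. h (X m \<omega>) - (LINT x|L. h x)\<bar> \<le> dev1 n \<omega>"
    unfolding dev1_def by (rule abs_series_deviation_le[OF \<psi>_measurable \<Psi>1 r_summable dom e h \<omega>])
  have hb: "\<bar>h x\<bar> \<le> suminf r * \<Psi> x" if "x \<in> space L" for x
    using series_bound[of e, OF e that] h[OF that] by simp
  have hm [measurable]: "h \<in> borel_measurable L"
    by (subst measurable_cong[OF h]) (auto intro!: borel_measurable_suminf)
  have dom_h: "\<bar>\<psi> i x * h x\<bar> \<le> r i * (suminf r * (\<Psi> x)\<^sup>2)" if "x \<in> space L" for i x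
    using mult_mono[OF dom[OF that] hb[OF that], of i] r_pos[of i] \<Psi>_nonneg[OF that]
    by (simp add: abs_mult power2_eq_square mult_ac)
  have sq: "(h x)\<^sup>2 = (\<Sum>i. e i * (\<psi> i x * h x))" if "x \<in> space L" for x
  proof -
    have le: "\<bar>e i * \<psi> i x\<bar> \<le> r i * \<Psi> x" for i
      using mult_mono[OF e dom[OF that], of i i] by (simp add: abs_mult)
    have s: "summable (\<lambda>i. e i * \<psi> i x)"
      by (rule summable_rabs_cancel, rule summable_comparison_test'[of "\<lambda>i. r i * \<Psi> x" 0])
         (use r_summable le in \<open>auto intro: summable_mult2\<close>)
    show ?thesis using suminf_mult2[OF s, of "h x"] h[OF that] by (simp add: power2_eq_square mult_ac)
  qed
  have "ennreal \<bar>\<Sum>m<n. (h (X m \<omega>))\<^sup>2 - (LINT x|L. (h x)\<^sup>2)\<bar> \<le>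
     (\<Sum>i. ennreal \<bar>\<Sum>m<n. \<psi> i (X m \<omega>) * h (X m \<omega>) - (LINT x|L. \<psi> i x * h x)\<bar>)"
    by (rule abs_series_deviation_le[where \<phi>="\<lambda>i x. \<psi> i x * h x" and \<Phi>="\<lambda>x. suminf r * (\<Psi> x)\<^sup>2", OF _ _ r_summable dom_h e sq \<omega>])
       (use \<Psi>2 in auto)
  also have "\<dots> \<le> dev2 n \<omega>"
    unfolding dev2_def
  proof (rule suminf_le)
    fix i
    have s: "\<psi> i x * h x = (\<Sum>j. e j * (\<psi> i x * \<psi> j x))" if "x \<in> space L" for x
    proof -
      have le: "\<bar>e i * \<psi> i x\<bar> \<le> r i * \<Psi> x" for i
        using mult_mono[OF e dom[OF that], of i i] by (simp add: abs_mult)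
      have s: "summable (\<lambda>i. e i * \<psi> i x)"
        by (rule summable_rabs_cancel, rule summable_comparison_test'[of "\<lambda>i. r i * \<Psi> x" 0])
           (use r_summable le in \<open>auto intro: summable_mult2\<close>)
      show ?thesis using suminf_mult[OF s, of "\<psi> i x"] h[OF that] by (simp add: mult_ac)
    qed
    show "ennreal \<bar>\<Sum>m<n. \<psi> i (X m \<omega>) * h (X m \<omega>) - (LINT x|L. \<psi> i x * h x)\<bar> \<le>
      (\<Sum>j. ennreal \<bar>\<Sum>m<n. \<psi> i (X m \<omega>) * \<psi> j (X m \<omega>) - (LINT x|L. \<psi> i x * \<psi> j x)\<bar>)"
      by (rule abs_series_deviation_le[where \<phi>="\<lambda>j x. \<psi> i x * \<psi> j x" and \<Phi>="\<lambda>x. r i * (\<Psi> x)\<^sup>2", OF _ _ r_summable _ e s \<omega>])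
         (use \<Psi>2 dom2 in \<open>auto simp: mult_ac\<close>)
  qed auto
  finally show "ennreal \<bar>\<Sum>m<n. (h (X m \<omega>))\<^sup>2 - (LINT x|L. (h x)\<^sup>2)\<bar> \<le> dev2 n \<omega>" .
qed

text \<open>
The functions \<open>h\<close> here are the normalised elements of the class, and \<open>1 + s * h\<close> plays the part of a
density ratio: if its log-likelihood over the sample is at least \<open>- c\<close>, then \<open>n * s\<^sup>2\<close> is at most \<open>K\<close>.
\<close>

definition scale_bound_holds :: "nat \<Rightarrow> real \<Rightarrow> real \<Rightarrow> 'w \<Rightarrow> bool" where
  "scale_bound_holds n c K \<omega> \<longleftrightarrow> (\<forall>e h s. (\<forall>i. \<bar>e i\<bar> \<le> (1::real)) \<longrightarrow> (\<forall>x\<in>space L. h x = (\<Sum>i. e i * \<psi> i x)) \<longrightarrow>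
       (LINT x|L. h x) = 0 \<longrightarrow> (LINT x|L. (h x)\<^sup>2) = 1 \<longrightarrow> 0 \<le> s \<longrightarrow>
       (\<forall>m<n. 1 + s * h (X m \<omega>) > 0) \<longrightarrow> (\<Sum>m<n. ln (1 + s * h (X m \<omega>))) \<ge> - c \<longrightarrow> real n * s\<^sup>2 \<le> K)"

text \<open>
Outside an event of small probability, \<open>dev1\<close> is of order \<open>sqrt n\<close>, \<open>dev2\<close> is at most \<open>n / 4\<close> and
the sum of the fourth powers of the envelope is of order \<open>n\<close>. Every normalised \<open>h\<close> then satisfies
the hypotheses of the deterministic estimate with the same constants.
\<close>

theorem likelihood_ratio_scale_bounded:
  assumes \<epsilon>: "\<epsilon> > 0" and c: "c \<ge> 0"
  shows "\<exists>K N. \<forall>n\<ge>N. \<exists>E\<in>events. prob E \<le> \<epsilon> \<and>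
    (\<forall>\<omega>\<in>space M - E. scale_bound_holds n c K \<omega>)"
proof -
  obtain v1 where v1: "v1 > 0" "\<And>n. (\<integral>\<^sup>+\<omega>. dev1 n \<omega> \<partial>M) \<le> ennreal (sqrt n * v1)" using nn_integral_dev1 by blast
  obtain v2 where v2: "v2 > 0" "\<And>n. (\<integral>\<^sup>+\<omega>. dev2 n \<omega> \<partial>M) \<le> ennreal (sqrt n * v2)" using nn_integral_dev2 by blast
  define v4 where "v4 = (LINT x|L. (\<Psi> x) ^ 4)"
  have v4: "v4 \<ge> 0" unfolding v4_def by simp
  define K1 where "K1 = 3 * v1 / \<epsilon>"
  define q where "q = 3 * (v4 + 1) / \<epsilon>"
  define K2 where "K2 = (suminf r) ^ 4 * q"
  define m where "m = 2 * sqrt K2 + 1"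
  define \<kappa> where "\<kappa> = 1 / (64 * m\<^sup>2)"
  define N where "N = nat \<lceil>16 * m\<^sup>2 * K1\<^sup>2\<rceil> + nat \<lceil>(12 * v2 / \<epsilon>)\<^sup>2\<rceil> + 1"
  have K1: "K1 > 0" using v1 \<epsilon> by (simp add: K1_def)
  have q: "q > 0" using v4 \<epsilon> by (simp add: q_def)
  have K2: "K2 \<ge> 0" using q by (simp add: K2_def)
  have "(2 * sqrt K2)\<^sup>2 \<le> m\<^sup>2" unfolding m_def using K2 by (intro power_mono) auto
  then have m: "m > 0" "4 * K2 \<le> m\<^sup>2" using K2 by (auto simp: m_def power_mult_distrib intro: add_nonneg_pos)
  show ?thesis
  proof (rule exI[of _ "4 / \<kappa> * (c + K1\<^sup>2 / \<kappa>)"], rule exI[of _ N], intro allI impI)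
    fix n assume "n \<ge> N"
    then have n0: "n > 0" and n1: "16 * m\<^sup>2 * K1\<^sup>2 \<le> real n" and n2: "(12 * v2 / \<epsilon>)\<^sup>2 \<le> real n"
      unfolding N_def by linarith+
    \<comment> \<open>The three parts of the exceptional event have probability at most \<open>\<epsilon> / 3\<close> each.\<close>
    define E1 where "E1 = {\<omega>\<in>space M. ennreal (K1 * sqrt n) \<le> dev1 n \<omega>}"
    define E2 where "E2 = {\<omega>\<in>space M. ennreal (n / 4) \<le> dev2 n \<omega>}"
    define E3 where "E3 = {\<omega>\<in>space M. ennreal (q * n) \<le> (\<Sum>m<n. ennreal ((\<Psi> (X m \<omega>)) ^ 4))}"
    have [measurable]: "E1 \<in> events" "E2 \<in> events" "E3 \<in> events" unfolding E1_def E2_def E3_def by measurable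
    have "prob E1 \<le> (sqrt n * v1) / (K1 * sqrt n)"
      unfolding E1_def by (rule prob_ge_le_nn_integral) (use v1 K1 n0 in auto)
    also have "\<dots> = \<epsilon> / 3" using n0 v1 \<epsilon> by (simp add: K1_def)
    finally have P1: "prob E1 \<le> \<epsilon> / 3" .
    have "prob E2 \<le> (sqrt n * v2) / (n / 4)"
      unfolding E2_def by (rule prob_ge_le_nn_integral) (use v2 n0 in auto)
    also have "\<dots> = 4 * v2 / sqrt n"
      using n0 real_sqrt_mult_self[of "real n"] by (simp add: field_simps)
    also have "\<dots> \<le> \<epsilon> / 3"
    proof -
      have "12 * v2 / \<epsilon> \<le> sqrt n" using n2 by (rule real_le_rsqrt)
      then show ?thesis using \<epsilon> n0 by (simp add: field_simps)
    qed
    finally have P2: "prob E2 \<le> \<epsilon> / 3" .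
    have "(\<integral>\<^sup>+\<omega>. (\<Sum>m<n. ennreal ((\<Psi> (X m \<omega>)) ^ 4)) \<partial>M) = (\<Sum>m<n. \<integral>\<^sup>+x. ennreal ((\<Psi> x) ^ 4) \<partial>L)"
      by (subst nn_integral_sum, measurable)
        (simp add: nn_integral_sample[where f="\<lambda>x. ennreal ((\<Psi> x) ^ 4)"])
    also have "\<dots> = (\<Sum>m<n. ennreal v4)"
      unfolding v4_def using \<Psi>4 by (intro sum.cong refl nn_integral_eq_integral) auto
    also have "\<dots> = ennreal (n * v4)" using v4 by (simp add: ennreal_mult ennreal_of_nat_eq_real_of_nat)
    finally have Q: "(\<integral>\<^sup>+\<omega>. (\<Sum>m<n. ennreal ((\<Psi> (X m \<omega>)) ^ 4)) \<partial>M) = ennreal (n * v4)" .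
    have "prob E3 \<le> (n * v4) / (q * n)"
      unfolding E3_def by (rule prob_ge_le_nn_integral) (use v4 q n0 Q in auto)
    also have "\<dots> \<le> \<epsilon> / 3"
    proof -
      have "v4 \<le> \<epsilon> / 3 * q" using \<epsilon> by (simp add: q_def)
      then have "v4 / q \<le> \<epsilon> / 3" using q by (simp only: pos_divide_le_eq)
      then show ?thesis using n0 by simp
    qed
    finally have P3: "prob E3 \<le> \<epsilon> / 3" .
    define E where "E = E1 \<union> E2 \<union> E3"
    have "prob E \<le> prob E1 + prob E2 + prob E3"
      unfolding E_def by (intro order_trans[OF measure_Un_le] add_mono measure_Un_le) auto
    then have PE: "prob E \<le> \<epsilon>" using P1 P2 P3 by linarith
    show "\<exists>E\<in>events. prob E \<le> \<epsilon> \<and>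
      (\<forall>\<omega>\<in>space M - E. scale_bound_holds n c (4 / \<kappa> * (c + K1\<^sup>2 / \<kappa>)) \<omega>)"
    proof (rule bexI[of _ E], intro conjI ballI PE)
      show "E \<in> events" unfolding E_def by auto
      fix \<omega> assume \<omega>E: "\<omega> \<in> space M - E"
      show "scale_bound_holds n c (4 / \<kappa> * (c + K1\<^sup>2 / \<kappa>)) \<omega>"
        unfolding scale_bound_holds_def
      proof (intro allI impI)
        fix e h s
        assume e: "\<forall>i. \<bar>e i\<bar> \<le> (1::real)" and h: "\<forall>x\<in>space L. h x = (\<Sum>i. e i * \<psi> i x)"
          and h0: "(LINT x|L. h x) = 0" and h2: "(LINT x|L. (h x)\<^sup>2) = 1" and s: "0 \<le> s"
          and pos: "\<forall>m<n. 1 + s * h (X m \<omega>) > 0" and ln: "(\<Sum>m<n. ln (1 + s * h (X m \<omega>))) \<ge> - c"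
        have \<omega>: "\<omega> \<in> space M" and nE: "\<not> ennreal (K1 * sqrt n) \<le> dev1 n \<omega>" "\<not> ennreal (n / 4) \<le> dev2 n \<omega>"
           "\<not> ennreal (q * n) \<le> (\<Sum>m<n. ennreal ((\<Psi> (X m \<omega>)) ^ 4))"
          using \<omega>E by (auto simp: E_def E1_def E2_def E3_def)
        have X: "X m \<omega> \<in> space L" for m using measurable_space[OF sample_measurable \<omega>] .
        note dev = series_deviation[of e h \<omega> n, OF e[rule_format] h[rule_format] \<omega>]
        have "ennreal \<bar>\<Sum>m<n. h (X m \<omega>) - (LINT x|L. h x)\<bar> < ennreal (K1 * sqrt n)"
          using dev(1) nE(1) by (meson le_less_trans not_le)
        then have y1: "\<bar>\<Sum>m<n. h (X m \<omega>)\<bar> \<le> K1 * sqrt n" using h0 by (simp add: ennreal_less_iff)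
        have "ennreal \<bar>\<Sum>m<n. (h (X m \<omega>))\<^sup>2 - (LINT x|L. (h x)\<^sup>2)\<bar> < ennreal (n / 4)"
          using dev(2) nE(2) by (meson le_less_trans not_le)
        then have "\<bar>\<Sum>m<n. (h (X m \<omega>))\<^sup>2 - 1\<bar> < n / 4" using h2 by (simp add: ennreal_less_iff)
        then have y2: "3 / 4 * n \<le> (\<Sum>m<n. (h (X m \<omega>))\<^sup>2)" by (simp add: sum_subtractf abs_if split: if_splits)
        have "(\<Sum>m<n. ennreal ((\<Psi> (X m \<omega>)) ^ 4)) = ennreal (\<Sum>m<n. (\<Psi> (X m \<omega>)) ^ 4)" by simp
        then have Q: "(\<Sum>m<n. (\<Psi> (X m \<omega>)) ^ 4) \<le> q * n"
          using nE(3) by (simp add: not_le ennreal_less_iff sum_nonneg)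
        have "(\<Sum>m<n. (h (X m \<omega>)) ^ 4) \<le> (\<Sum>m<n. (suminf r) ^ 4 * (\<Psi> (X m \<omega>)) ^ 4)"
        proof (rule sum_mono)
          fix m
          have "\<bar>h (X m \<omega>)\<bar> \<le> suminf r * \<Psi> (X m \<omega>)"
            using series_bound[of e, OF e[rule_format] X] h X by simp
          from power_mono[OF this, of 4] show "(h (X m \<omega>)) ^ 4 \<le> (suminf r) ^ 4 * (\<Psi> (X m \<omega>)) ^ 4"
            by (simp add: power_mult_distrib)
        qed
        also have "\<dots> \<le> (suminf r) ^ 4 * (q * n)"
          unfolding sum_distrib_left[symmetric] using Q by (intro mult_left_mono) auto
        finally have y4: "(\<Sum>m<n. (h (X m \<omega>)) ^ 4) \<le> K2 * n" by (simp add: K2_def mult.assoc)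
        show "real n * s\<^sup>2 \<le> 4 / \<kappa> * (c + K1\<^sup>2 / \<kappa>)"
          unfolding \<kappa>_def
          by (rule likelihood_ratio_forces_small_scale[OF n0 n1 m _ s _ ln c y1 y2 y4]) (use K1 pos in auto)
      qed
    qed
  qed
qed

end

section \<open>Gaussian-Poisson products and exponential test functions\<close>

lemma sigma_finite_PiM_lborel: "sigma_finite_measure (\<Pi>\<^sub>M l\<in>B. lborel :: real measure)" if "finite B"
proof -
  interpret finite_product_sigma_finite "\<lambda>_. lborel :: real measure" B
    by standard (use that in auto)
  show ?thesis by (rule sigma_finite_measure_axioms)
qed

lemma sigma_finite_PiM_count: "sigma_finite_measure (\<Pi>\<^sub>M l\<in>B. count_space (UNIV :: nat set))" if "finite B"
proof -
  interpret product_sigma_finite "\<lambda>_. count_space (UNIV :: nat set)"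
    by (simp add: product_sigma_finite_def sigma_finite_measure_count_space)
  interpret finite_product_sigma_finite "\<lambda>_. count_space (UNIV :: nat set)" B
    by standard (use that in auto)
  show ?thesis by (rule sigma_finite_measure_axioms)
qed

lemma sigma_finite_base_measure: "sigma_finite_measure (base_measure B)"
proof -
  interpret P: sigma_finite_measure "\<Pi>\<^sub>M l\<in>B. lborel :: real measure" by (rule sigma_finite_PiM_lborel) simp
  interpret Q: sigma_finite_measure "\<Pi>\<^sub>M l\<in>- B. count_space (UNIV :: nat set)" by (rule sigma_finite_PiM_count) simp
  interpret pair_sigma_finite "\<Pi>\<^sub>M l\<in>B. lborel :: real measure" "\<Pi>\<^sub>M l\<in>- B. count_space (UNIV :: nat set)" ..
  show ?thesis unfolding base_measure_def by (rule sigma_finite_measure_axioms)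
qed

lemma measurable_gaussian_coordinate [measurable]:
  assumes "l \<in> B" shows "(\<lambda>x. fst x l) \<in> borel_measurable (base_measure B)"
  unfolding base_measure_def
  by (rule measurable_compose[OF measurable_fst]) (use measurable_component_singleton[OF assms, of "\<lambda>_. lborel"] in simp)

lemma measurable_poisson_coordinate [measurable]:
  assumes "l \<in> - B" shows "(\<lambda>x. snd x l) \<in> measurable (base_measure B) (count_space UNIV)"
  unfolding base_measure_def
  by (rule measurable_compose[OF measurable_snd]) (rule measurable_component_singleton[OF assms])

lemma borel_measurable_base_product:
  assumes "\<And>l. l \<in> B \<Longrightarrow> f l \<in> borel_measurable borel"
  shows "(\<lambda>x. (\<Prod>l\<in>B. f l (fst x l)) * (\<Prod>l\<in>- B. h l (snd x l)) :: real) \<in> borel_measurable (base_measure B)"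
  using assms
  by (intro borel_measurable_times borel_measurable_prod measurable_compose[OF measurable_gaussian_coordinate]
     measurable_compose[OF measurable_poisson_coordinate]) auto

lemma nn_integral_base_measure_product:
  assumes f [measurable]: "\<And>l. l \<in> B \<Longrightarrow> f l \<in> borel_measurable borel"
  shows "(\<integral>\<^sup>+x. (\<Prod>l\<in>B. f l (fst x l)) * (\<Prod>l\<in>- B. h l (snd x l)) \<partial>base_measure B) =
    (\<Prod>l\<in>B. \<integral>\<^sup>+x. f l x \<partial>lborel) * (\<Prod>l\<in>- B. \<integral>\<^sup>+n. h l n \<partial>count_space UNIV)"
proof -
  let ?P = "\<Pi>\<^sub>M l\<in>B. lborel :: real measure" and ?Q = "\<Pi>\<^sub>M l\<in>- B. count_space (UNIV :: nat set)"
  interpret Q: sigma_finite_measure ?Q by (rule sigma_finite_PiM_count) simp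
  interpret P1: product_sigma_finite "\<lambda>_. lborel :: real measure"
    by (simp add: product_sigma_finite_def lborel.sigma_finite_measure_axioms)
  interpret Q1: product_sigma_finite "\<lambda>_. count_space (UNIV :: nat set)"
    by (simp add: product_sigma_finite_def sigma_finite_measure_count_space)
  have mf: "(\<lambda>p. \<Prod>l\<in>B. f l (p l)) \<in> borel_measurable ?P"
    by (intro borel_measurable_prod_ennreal) (rule measurable_compose[OF measurable_component_singleton], assumption, simp add: f)
  have mh: "(\<lambda>q. \<Prod>l\<in>- B. h l (q l)) \<in> borel_measurable ?Q"
    by (intro borel_measurable_prod_ennreal measurable_compose[OF measurable_component_singleton]) auto
  have m: "(\<lambda>x. (\<Prod>l\<in>B. f l (fst x l)) * (\<Prod>l\<in>- B. h l (snd x l))) \<in> borel_measurable (?P \<Otimes>\<^sub>M ?Q)"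
    by (intro borel_measurable_times_ennreal measurable_compose[OF measurable_fst mf] measurable_compose[OF measurable_snd mh])
  have "(\<integral>\<^sup>+x. (\<Prod>l\<in>B. f l (fst x l)) * (\<Prod>l\<in>- B. h l (snd x l)) \<partial>base_measure B) =
     (\<integral>\<^sup>+p. \<integral>\<^sup>+q. (\<Prod>l\<in>B. f l (p l)) * (\<Prod>l\<in>- B. h l (q l)) \<partial>?Q \<partial>?P)"
    unfolding base_measure_def using Q.nn_integral_fst[OF m] by simp
  also have "\<dots> = (\<integral>\<^sup>+p. (\<Prod>l\<in>B. f l (p l)) * (\<integral>\<^sup>+q. (\<Prod>l\<in>- B. h l (q l)) \<partial>?Q) \<partial>?P)"
    using mh by (simp add: nn_integral_cmult)
  also have "\<dots> = (\<integral>\<^sup>+p. (\<Prod>l\<in>B. f l (p l)) \<partial>?P) * (\<integral>\<^sup>+q. (\<Prod>l\<in>- B. h l (q l)) \<partial>?Q)"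
    using mf by (simp add: nn_integral_multc)
  also have "(\<integral>\<^sup>+p. (\<Prod>l\<in>B. f l (p l)) \<partial>?P) = (\<Prod>l\<in>B. \<integral>\<^sup>+x. f l x \<partial>lborel)"
    by (intro P1.product_nn_integral_prod) auto
  also have "(\<integral>\<^sup>+q. (\<Prod>l\<in>- B. h l (q l)) \<partial>?Q) = (\<Prod>l\<in>- B. \<integral>\<^sup>+n. h l n \<partial>count_space UNIV)"
    by (intro Q1.product_nn_integral_prod) auto
  finally show ?thesis .
qed

lemma nn_integral_base_measure_real_product:
  assumes f: "\<And>l. l \<in> B \<Longrightarrow> f l \<in> borel_measurable borel" "\<And>l y. l \<in> B \<Longrightarrow> 0 \<le> f l y"
    and h: "\<And>l n. l \<in> - B \<Longrightarrow> 0 \<le> h l n"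
  shows "(\<integral>\<^sup>+x. ennreal ((\<Prod>l\<in>B. f l (fst x l)) * (\<Prod>l\<in>- B. h l (snd x l))) \<partial>base_measure B) =
    (\<Prod>l\<in>B. \<integral>\<^sup>+y. ennreal (f l y) \<partial>lborel) * (\<Prod>l\<in>- B. \<integral>\<^sup>+n. ennreal (h l n) \<partial>count_space UNIV)"
proof -
  have "(\<Prod>l\<in>B. ennreal (f l (fst x l))) * (\<Prod>l\<in>- B. ennreal (h l (snd x l))) =
      ennreal (\<Prod>l\<in>B. f l (fst x l)) * ennreal (\<Prod>l\<in>- B. h l (snd x l))" for x
    by (intro arg_cong2[where f="(*)"] prod_ennreal f(2) h)
  also have "\<dots> x = ennreal ((\<Prod>l\<in>B. f l (fst x l)) * (\<Prod>l\<in>- B. h l (snd x l)))" for x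
    by (intro ennreal_mult[symmetric] prod_nonneg f(2) h)
  finally show ?thesis
    using nn_integral_base_measure_product[of B "\<lambda>l y. ennreal (f l y)" "\<lambda>l n. ennreal (h l n)"] f(1) by simp
qed

lemma std_normal_density_shift: "std_normal_density (x - t) = normal_density t 1 x"
  by (simp add: normal_density_def)

lemma nn_integral_shifted_std_normal: "(\<integral>\<^sup>+x. ennreal (std_normal_density (x - t)) \<partial>lborel) = 1"
proof -
  interpret prob_space "density lborel (normal_density t 1)" by (rule prob_space_normal_density) simp
  show ?thesis using emeasure_space_1 by (simp add: std_normal_density_shift emeasure_density)
qed

lemma nn_integral_exp_std_normal:
  "(\<integral>\<^sup>+x. ennreal (exp (a * x - a\<^sup>2 / 2) * std_normal_density (x - t)) \<partial>lborel) = ennreal (exp (a * t))"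
proof -
  have "exp (a * x - a\<^sup>2 / 2) * std_normal_density (x - t) = exp (a * t) * std_normal_density (x - (t + a))" for x
    by (simp add: normal_density_def mult_exp_exp power2_eq_square field_simps)
  then have "(\<integral>\<^sup>+x. ennreal (exp (a * x - a\<^sup>2 / 2) * std_normal_density (x - t)) \<partial>lborel) =
      (\<integral>\<^sup>+x. ennreal (exp (a * t)) * ennreal (std_normal_density (x - (t + a))) \<partial>lborel)"
    by (simp add: ennreal_mult)
  also have "\<dots> = ennreal (exp (a * t))" by (subst nn_integral_cmult) (auto simp: nn_integral_shifted_std_normal)
  finally show ?thesis .
qed

lemma nn_integral_power_over_fact:
  assumes "z \<ge> 0"
  shows "(\<integral>\<^sup>+n. ennreal (z ^ n / fact n) \<partial>count_space UNIV) = ennreal (exp z)"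
proof -
  have "(\<lambda>n. z ^ n / fact n) sums exp z"
    using exp_converges[of z] by (simp add: divide_inverse mult.commute)
  then show ?thesis using assms
    by (simp add: nn_integral_count_space_nat suminf_ennreal2 sums_iff)
qed

lemma nn_integral_power_poisson:
  assumes "z \<ge> 0" "t \<ge> 0"
  shows "(\<integral>\<^sup>+n. ennreal (z ^ n * (t ^ n / fact n * exp (- t))) \<partial>count_space UNIV) = ennreal (exp (t * (z - 1)))"
proof -
  have "(\<integral>\<^sup>+n. ennreal (z ^ n * (t ^ n / fact n * exp (- t))) \<partial>count_space UNIV) =
     (\<integral>\<^sup>+n. ennreal ((z * t) ^ n / fact n) * ennreal (exp (- t)) \<partial>count_space UNIV)"
    using assms by (intro nn_integral_cong) (simp add: power_mult_distrib ennreal_mult[symmetric])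
  also have "\<dots> = ennreal (exp (z * t)) * ennreal (exp (- t))"
    using assms by (subst nn_integral_multc) (auto simp: nn_integral_power_over_fact)
  also have "\<dots> = ennreal (exp (t * (z - 1)))"
    by (simp add: ennreal_mult[symmetric] mult_exp_exp algebra_simps)
  finally show ?thesis .
qed

definition exp_monomial :: "('d \<Rightarrow> nat) \<Rightarrow> real ^ 'd::finite \<Rightarrow> real" where
  "exp_monomial k \<theta> = exp (\<Sum>l\<in>UNIV. real (k l) * \<theta> $ l)"

text \<open>
These functions of the observation have mean \<open>exp (\<Sum>l. k l * \<theta> $ l)\<close> under the component with
parameter \<open>\<theta>\<close>. In a Gaussian coordinate this is the moment generating function at \<open>k\<close>, in a Poisson
coordinate the probability generating function at \<open>k + 1\<close>; both produce the same exponential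
monomials in \<open>\<theta>\<close>, so the two kinds of coordinates need no separate treatment later.
\<close>

definition test_function :: "'d::finite set \<Rightarrow> ('d \<Rightarrow> nat) \<Rightarrow> 'd observation \<Rightarrow> real" where
  "test_function B k x = (\<Prod>l\<in>B. exp (real (k l) * fst x l - (real (k l))\<^sup>2 / 2)) * (\<Prod>l\<in>- B. (real (k l) + 1) ^ snd x l)"

lemma test_function_pos: "test_function B k x > 0"
  unfolding test_function_def by (intro mult_pos_pos prod_pos) auto

lemma component_density_nonneg: "(\<And>l. l \<notin> B \<Longrightarrow> 0 \<le> \<theta> $ l) \<Longrightarrow> component_density B \<theta> x \<ge> 0"
  unfolding component_density_def by (intro mult_nonneg_nonneg prod_nonneg) auto

lemma component_density_pos: "(\<And>l. l \<notin> B \<Longrightarrow> 0 < \<theta> $ l) \<Longrightarrow> component_density B \<theta> x > 0"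
  unfolding component_density_def by (intro mult_pos_pos prod_pos) (auto simp: normal_density_pos)

lemma test_function_measurable [measurable]: "test_function B k \<in> borel_measurable (base_measure B)"
  unfolding test_function_def[abs_def]
  by (rule borel_measurable_base_product[where h="\<lambda>l n. (real (k l) + 1) ^ n"]) measurable

lemma nn_integral_test_function:
  assumes \<theta>: "\<And>l. l \<notin> B \<Longrightarrow> 0 \<le> \<theta> $ l"
  shows "(\<integral>\<^sup>+x. ennreal (test_function B k x * component_density B \<theta> x) \<partial>base_measure B) = ennreal (exp_monomial k \<theta>)"
proof -
  let ?f = "\<lambda>l x. exp (real (k l) * x - (real (k l))\<^sup>2 / 2) * std_normal_density (x - \<theta> $ l)"
  let ?h = "\<lambda>l n. (real (k l) + 1) ^ n * ((\<theta> $ l) ^ n / fact n * exp (- (\<theta> $ l)))"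
  have "test_function B k x * component_density B \<theta> x = (\<Prod>l\<in>B. ?f l (fst x l)) * (\<Prod>l\<in>- B. ?h l (snd x l))" for x
    by (simp only: test_function_def component_density_def prod.distrib mult_ac)
  then have "(\<integral>\<^sup>+x. ennreal (test_function B k x * component_density B \<theta> x) \<partial>base_measure B) =
      (\<Prod>l\<in>B. \<integral>\<^sup>+x. ennreal (?f l x) \<partial>lborel) * (\<Prod>l\<in>- B. \<integral>\<^sup>+n. ennreal (?h l n) \<partial>count_space UNIV)"
    using \<theta> by (simp only:) (rule nn_integral_base_measure_real_product, auto)
  also have "(\<Prod>l\<in>B. \<integral>\<^sup>+x. ennreal (?f l x) \<partial>lborel) = (\<Prod>l\<in>B. ennreal (exp (real (k l) * \<theta> $ l)))"
    by (simp add: nn_integral_exp_std_normal)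
  also have "(\<Prod>l\<in>- B. \<integral>\<^sup>+n. ennreal (?h l n) \<partial>count_space UNIV) = (\<Prod>l\<in>- B. ennreal (exp (real (k l) * \<theta> $ l)))"
    using \<theta> by (intro prod.cong refl) (subst nn_integral_power_poisson, auto simp: mult.commute)
  also have "(\<Prod>l\<in>B. ennreal (exp (real (k l) * \<theta> $ l))) * (\<Prod>l\<in>- B. ennreal (exp (real (k l) * \<theta> $ l))) =
     (\<Prod>l\<in>UNIV. ennreal (exp (real (k l) * \<theta> $ l)))"
    by (subst prod.union_disjoint[symmetric]) (auto simp: Compl_partition)
  also have "\<dots> = ennreal (exp_monomial k \<theta>)"
    by (subst prod_ennreal) (auto simp: exp_monomial_def exp_sum)
  finally show ?thesis .
qed

lemma component_density_measurable [measurable]: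
  fixes B :: "'d::finite set"
  shows "(\<lambda>(\<theta>, x). component_density B \<theta> x) \<in> borel_measurable (borel \<Otimes>\<^sub>M base_measure B)"
proof -
  have [measurable]: "(\<lambda>z. fst (snd z) l) \<in> borel_measurable (borel \<Otimes>\<^sub>M base_measure B)" if "l \<in> B" for l
    by (rule measurable_compose[OF measurable_snd measurable_gaussian_coordinate[OF that]])
  have s: "(\<lambda>z. snd (snd z) l) \<in> measurable (borel \<Otimes>\<^sub>M base_measure B) (count_space UNIV)" if "l \<in> - B" for l
    by (rule measurable_compose[OF measurable_snd measurable_poisson_coordinate[OF that]])
  have c [measurable]: "(\<lambda>z. (fst z :: real ^ 'd) $ l) \<in> borel_measurable (borel \<Otimes>\<^sub>M base_measure B)" for l
    by (rule measurable_compose[OF measurable_fst]) (intro borel_measurable_continuous_onI continuous_intros)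
  have "(\<lambda>z. ((fst z :: real ^ 'd) $ l) ^ snd (snd z) l / fact (snd (snd z) l) * exp (- (fst z $ l)))
      \<in> borel_measurable (borel \<Otimes>\<^sub>M base_measure B)" if "l \<in> - B" for l
  proof -
    have "(\<lambda>z. (\<lambda>n z. ((fst z :: real ^ 'd) $ l) ^ n / fact n * exp (- (fst z $ l))) (snd (snd z) l) z)
        \<in> borel_measurable (borel \<Otimes>\<^sub>M base_measure B)"
    proof (rule measurable_compose_countable[OF _ s[OF that]])
      fix i
      have "(\<lambda>a::real. a ^ i / fact i * exp (- a)) \<in> borel_measurable borel"
        by (intro borel_measurable_continuous_onI continuous_intros) simp
      from measurable_compose[OF c this]
      show "(\<lambda>z. ((fst z :: real ^ 'd) $ l) ^ i / fact i * exp (- (fst z $ l))) \<in> borel_measurable (borel \<Otimes>\<^sub>M base_measure B)" .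
    qed
    then show ?thesis by simp
  qed
  then show ?thesis
    unfolding component_density_def case_prod_beta'
    using c by (intro borel_measurable_times borel_measurable_prod) (auto intro: borel_measurable_diff)
qed

lemma component_density_measurable1 [measurable]: "component_density B \<theta> \<in> borel_measurable (base_measure B)"
proof -
  have "(\<lambda>x. (\<lambda>(\<theta>, x). component_density B \<theta> x) (\<theta>, x)) \<in> borel_measurable (base_measure B)"
    by (rule measurable_compose[OF measurable_Pair1' component_density_measurable]) simp
  then show ?thesis by simp
qed

lemma power_over_fact_le_exp:
  assumes "y \<ge> (0::real)" shows "y ^ n / fact n \<le> exp y"
proof -
  have "(\<lambda>m. y ^ m / fact m) sums exp y"
    using exp_converges[of y] by (simp add: divide_inverse mult.commute)
  from sum_le_suminf[of _ "{n}", OF sums_summable[OF this]] assms this show ?thesis by (simp add: sums_iff)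
qed

lemma component_density_le_1:
  assumes \<theta>: "\<And>l. l \<notin> B \<Longrightarrow> 0 \<le> \<theta> $ l"
  shows "component_density B \<theta> x \<le> 1"
proof -
  have g: "std_normal_density y \<le> 1" for y
  proof -
    have "1 / sqrt (2 * pi) \<le> 1" using pi_gt3 by (simp add: real_le_rsqrt)
    then show ?thesis unfolding std_normal_density_def by (intro mult_le_one) auto
  qed
  have p: "t ^ n / fact n * exp (- t) \<le> 1" if "t \<ge> 0" for t :: real and n
  proof -
    have "t ^ n / fact n \<le> exp t" using that by (rule power_over_fact_le_exp)
    then have "t ^ n / fact n * exp (- t) \<le> exp t * exp (- t)" by (intro mult_right_mono) auto
    then show ?thesis by (simp add: mult_exp_exp)
  qed
  have "(\<Prod>l\<in>B. std_normal_density (fst x l - \<theta> $ l)) \<le> 1"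
    by (intro prod_le_1) (auto simp: g)
  moreover have "0 \<le> (\<Prod>l\<in>- B. (\<theta> $ l) ^ (snd x l) / fact (snd x l) * exp (- (\<theta> $ l)))"
    using \<theta> by (intro prod_nonneg) auto
  moreover have "(\<Prod>l\<in>- B. (\<theta> $ l) ^ (snd x l) / fact (snd x l) * exp (- (\<theta> $ l))) \<le> 1"
  proof (rule prod_le_1)
    fix l assume "l \<in> - B"
    then show "0 \<le> (\<theta> $ l) ^ (snd x l) / fact (snd x l) * exp (- (\<theta> $ l)) \<and>
        (\<theta> $ l) ^ (snd x l) / fact (snd x l) * exp (- (\<theta> $ l)) \<le> 1"
      using p[of "\<theta> $ l" "snd x l"] \<theta>[of l] by auto
  qed
  ultimately show ?thesis unfolding component_density_def by (rule mult_le_one)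
qed

section \<open>Mixtures over a bounded parameter space\<close>

text \<open>
The mixture of the components with respect to the signed measure \<open>\<phi> dg\<close>.
\<close>

definition signed_mixture ::
    "'d::finite set \<Rightarrow> (real ^ 'd) measure \<Rightarrow> (real ^ 'd \<Rightarrow> real) \<Rightarrow> 'd observation \<Rightarrow> real" where
  "signed_mixture B g \<phi> x = (LINT \<theta>|g. \<phi> \<theta> * component_density B \<theta> x)"

lemma mixture_density_eq_signed: "mixture_density B g = signed_mixture B g (\<lambda>_. 1)"
  by (simp add: fun_eq_iff mixture_density_def signed_mixture_def)

locale parameter_space =
  fixes B :: "'d::finite set" and \<Theta> :: "(real ^ 'd) set"
  assumes bounded_\<Theta>: "bounded \<Theta>" and \<Theta>_pos: "\<And>\<theta> l. \<theta> \<in> \<Theta> \<Longrightarrow> l \<notin> B \<Longrightarrow> 0 < \<theta> $ l"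
begin

abbreviation "\<mu> \<equiv> base_measure B"

lemma coordinates_bounded:
  obtains R where "R > 0" "\<And>\<theta> l. \<theta> \<in> \<Theta> \<Longrightarrow> \<bar>\<theta> $ l\<bar> \<le> R"
proof -
  obtain R where R: "R > 0" "\<And>\<theta>. \<theta> \<in> \<Theta> \<Longrightarrow> norm \<theta> \<le> R"
    using bounded_\<Theta> by (auto simp: bounded_pos)
  show ?thesis by (rule that[of R]) (use R component_le_norm_cart order_trans in blast)+
qed

lemma exp_monomial_bounded:
  obtains C where "C > 0" "\<And>\<theta>. \<theta> \<in> \<Theta> \<Longrightarrow> exp_monomial k \<theta> \<le> C"
proof -
  obtain R where R: "R > 0" "\<And>\<theta> l. \<theta> \<in> \<Theta> \<Longrightarrow> \<bar>\<theta> $ l\<bar> \<le> R" using coordinates_bounded by blast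
  have "exp_monomial k \<theta> \<le> exp (\<Sum>l\<in>UNIV. real (k l) * R)" if "\<theta> \<in> \<Theta>" for \<theta>
    unfolding exp_monomial_def using R(2)[OF that]
    by (intro exp_le_cancel_iff[THEN iffD2] sum_mono mult_left_mono) (auto simp: abs_le_iff)
  then show ?thesis by (intro that[of "exp (\<Sum>l\<in>UNIV. real (k l) * R)"]) auto
qed

lemma exp_monomial_nonneg: "exp_monomial k \<theta> \<ge> 0"
  by (simp add: exp_monomial_def)

lemma exp_monomial_measurable [measurable]: "exp_monomial k \<in> borel_measurable borel"
  unfolding exp_monomial_def[abs_def] by (intro borel_measurable_continuous_onI continuous_intros)

lemma component_nonneg: "\<theta> \<in> \<Theta> \<Longrightarrow> 0 \<le> component_density B \<theta> x"
  using component_density_nonneg \<Theta>_pos by (metis less_imp_le)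

lemma component_le_1: "\<theta> \<in> \<Theta> \<Longrightarrow> component_density B \<theta> x \<le> 1"
  using component_density_le_1 \<Theta>_pos by (metis less_imp_le)

context
  fixes g assumes g: "g \<in> mixing_measures \<Theta>"
begin

lemma g_prob: "prob_space g" and g_sets [measurable_cong]: "sets g = sets borel" and g_AE: "AE \<theta> in g. \<theta> \<in> \<Theta>"
  using g by (auto simp: mixing_measures_def)

lemma integrable_bounded_on_parameters:
  fixes F :: "real ^ 'd \<Rightarrow> real"
  assumes "F \<in> borel_measurable borel" "\<And>\<theta>. \<theta> \<in> \<Theta> \<Longrightarrow> \<bar>F \<theta>\<bar> \<le> C"
  shows "integrable g F"
proof -
  interpret prob_space g by (rule g_prob)
  have [measurable]: "F \<in> borel_measurable g" using assms by measurable
  show ?thesis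
    by (rule integrable_const_bound[where B=C]) (use assms g_AE in \<open>auto elim: AE_mp\<close>)
qed

lemma abs_integral_le_on_parameters:
  fixes F :: "real ^ 'd \<Rightarrow> real"
  assumes "F \<in> borel_measurable borel" "\<And>\<theta>. \<theta> \<in> \<Theta> \<Longrightarrow> \<bar>F \<theta>\<bar> \<le> G \<theta>" "integrable g G"
  shows "\<bar>LINT \<theta>|g. F \<theta>\<bar> \<le> (LINT \<theta>|g. G \<theta>)"
proof -
  have [measurable]: "F \<in> borel_measurable g" using assms by measurable
  have AE: "AE \<theta> in g. \<bar>F \<theta>\<bar> \<le> G \<theta>" using g_AE by eventually_elim (rule assms(2))
  have i: "integrable g F"
    by (rule Bochner_Integration.integrable_bound[OF assms(3)]) (use AE in \<open>auto elim: AE_mp\<close>)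
  have "\<bar>LINT \<theta>|g. F \<theta>\<bar> \<le> (LINT \<theta>|g. \<bar>F \<theta>\<bar>)" by (rule integral_abs_bound)
  also have "\<dots> \<le> (LINT \<theta>|g. G \<theta>)" using i assms(3) AE by (intro integral_mono_AE) auto
  finally show ?thesis .
qed

lemma density_measurable_parameter [measurable]: "(\<lambda>\<theta>. component_density B \<theta> x) \<in> borel_measurable borel"
proof -
  have "(\<lambda>\<theta>. (\<Prod>l\<in>B. std_normal_density (fst x l - \<theta> $ l)) *
     (\<Prod>l\<in>- B. (\<theta> $ l) ^ (snd x l) / fact (snd x l) * exp (- (\<theta> $ l)))) \<in> borel_measurable borel"
    unfolding std_normal_density_def
    by (intro borel_measurable_continuous_onI continuous_intros) auto
  then show ?thesis by (simp add: component_density_def)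
qed

context
  fixes \<phi> :: "real ^ 'd \<Rightarrow> real" and D :: real
  assumes \<phi> [measurable]: "\<phi> \<in> borel_measurable borel" and \<phi>_le: "\<And>\<theta>. \<bar>\<phi> \<theta>\<bar> \<le> D"
begin

lemma D_nonneg: "D \<ge> 0" using \<phi>_le[of 0] by linarith

lemma integrable_signed_mixture: "integrable g (\<lambda>\<theta>. \<phi> \<theta> * component_density B \<theta> x)"
proof (rule integrable_bounded_on_parameters[where C="D * 1"])
  fix \<theta> assume "\<theta> \<in> \<Theta>"
  then show "\<bar>\<phi> \<theta> * component_density B \<theta> x\<bar> \<le> D * 1"
    unfolding abs_mult using \<phi>_le[of \<theta>] component_nonneg[of \<theta> x] component_le_1[of \<theta> x]
    by (intro mult_mono) auto
qed measurable

lemma signed_mixture_measurable [measurable]: "signed_mixture B g \<phi> \<in> borel_measurable \<mu>"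
proof -
  interpret prob_space g by (rule g_prob)
  have "(\<lambda>(x, \<theta>). \<phi> \<theta> * component_density B \<theta> x) \<in> borel_measurable (\<mu> \<Otimes>\<^sub>M g)"
  proof -
    have "(\<lambda>z. (\<lambda>(\<theta>, x). component_density B \<theta> x) (snd z, fst z)) \<in> borel_measurable (\<mu> \<Otimes>\<^sub>M g)"
      by (rule measurable_compose[OF _ component_density_measurable]) measurable
    then show ?thesis unfolding case_prod_beta' by measurable
  qed
  then show ?thesis unfolding signed_mixture_def[abs_def] by (rule borel_measurable_lebesgue_integral)
qed

text \<open>
Fubini's theorem turns integrals of mixtures against test functions into integrals of exponential
monomials against the mixing measure. Both the testing bound and the identifiability argument rest
on this duality.
\<close>

lemma integral_test_signed_mixture:
  "integrable \<mu> (\<lambda>x. test_function B k x * signed_mixture B g \<phi> x)"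
  "(LINT x|\<mu>. test_function B k x * signed_mixture B g \<phi> x) = (LINT \<theta>|g. \<phi> \<theta> * exp_monomial k \<theta>)"
proof -
  interpret g: prob_space g by (rule g_prob)
  interpret \<mu>: sigma_finite_measure \<mu> by (rule sigma_finite_base_measure)
  interpret pair_sigma_finite g \<mu> ..
  let ?F = "\<lambda>\<theta> x. \<phi> \<theta> * (test_function B k x * component_density B \<theta> x)"
  have mc: "(\<lambda>z. component_density B (fst z) (snd z)) \<in> borel_measurable (g \<Otimes>\<^sub>M \<mu>)"
    using component_density_measurable by (simp add: case_prod_beta' measurable_cong_sets[OF sets_pair_measure_cong[OF g_sets refl] refl])
  have mF: "(\<lambda>(\<theta>, x). ?F \<theta> x) \<in> borel_measurable (g \<Otimes>\<^sub>M \<mu>)"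
    unfolding case_prod_beta'
    by (intro borel_measurable_times mc measurable_compose[OF measurable_snd test_function_measurable] measurable_compose[OF measurable_fst]) measurable
  have AE_nn: "AE \<theta> in g. (\<integral>\<^sup>+x. ennreal \<bar>?F \<theta> x\<bar> \<partial>\<mu>) = ennreal (\<bar>\<phi> \<theta>\<bar> * exp_monomial k \<theta>)"
    using g_AE
  proof eventually_elim
    case (elim \<theta>)
    have "(\<integral>\<^sup>+x. ennreal \<bar>?F \<theta> x\<bar> \<partial>\<mu>) = (\<integral>\<^sup>+x. ennreal \<bar>\<phi> \<theta>\<bar> * ennreal (test_function B k x * component_density B \<theta> x) \<partial>\<mu>)"
      using component_nonneg[OF elim] test_function_pos[of B k]
      by (intro nn_integral_cong) (simp add: abs_mult ennreal_mult[symmetric] less_imp_le abs_of_pos)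
    also have "\<dots> = ennreal \<bar>\<phi> \<theta>\<bar> * ennreal (exp_monomial k \<theta>)"
      by (subst nn_integral_cmult, measurable, subst nn_integral_test_function) (auto simp: \<Theta>_pos[OF elim] less_imp_le)
    finally show ?case by (simp add: ennreal_mult exp_monomial_nonneg)
  qed
  have AE_int: "AE \<theta> in g. (LINT x|\<mu>. ?F \<theta> x) = \<phi> \<theta> * exp_monomial k \<theta>"
    using g_AE
  proof eventually_elim
    case (elim \<theta>)
    have nn: "0 \<le> test_function B k x * component_density B \<theta> x" for x
      by (intro mult_nonneg_nonneg component_nonneg elim less_imp_le test_function_pos)
    have "(LINT x|\<mu>. test_function B k x * component_density B \<theta> x) = exp_monomial k \<theta>"
      using nn_integral_test_function[of B \<theta> k] \<Theta>_pos[OF elim] nn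
      by (subst integral_eq_nn_integral) (auto simp: less_imp_le exp_monomial_nonneg)
    then show ?case by simp
  qed
  obtain C where C: "C > 0" "\<And>\<theta>. \<theta> \<in> \<Theta> \<Longrightarrow> exp_monomial k \<theta> \<le> C" using exp_monomial_bounded by blast
  have iF: "integrable (g \<Otimes>\<^sub>M \<mu>) (\<lambda>(\<theta>, x). ?F \<theta> x)"
  proof (rule integrableI_bounded[OF mF])
    have "(\<integral>\<^sup>+z. ennreal (norm (case z of (\<theta>, x) \<Rightarrow> ?F \<theta> x)) \<partial>(g \<Otimes>\<^sub>M \<mu>)) = (\<integral>\<^sup>+\<theta>. \<integral>\<^sup>+x. ennreal \<bar>?F \<theta> x\<bar> \<partial>\<mu> \<partial>g)"
      using mF by (subst \<mu>.nn_integral_fst[symmetric]) auto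
    also have "\<dots> = (\<integral>\<^sup>+\<theta>. ennreal (\<bar>\<phi> \<theta>\<bar> * exp_monomial k \<theta>) \<partial>g)" by (rule nn_integral_cong_AE[OF AE_nn])
    also have "\<dots> \<le> (\<integral>\<^sup>+\<theta>. ennreal (D * C) \<partial>g)"
    proof (rule nn_integral_mono_AE)
      show "AE \<theta> in g. ennreal (\<bar>\<phi> \<theta>\<bar> * exp_monomial k \<theta>) \<le> ennreal (D * C)"
        using g_AE
        by eventually_elim (intro ennreal_leI mult_mono \<phi>_le C exp_monomial_nonneg D_nonneg)
    qed
    also have "\<dots> < \<infinity>" by (simp add: g.emeasure_space_1)
    finally show "(\<integral>\<^sup>+z. ennreal (norm (case z of (\<theta>, x) \<Rightarrow> ?F \<theta> x)) \<partial>(g \<Otimes>\<^sub>M \<mu>)) < \<infinity>" .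
  qed
  have eq: "test_function B k x * signed_mixture B g \<phi> x = (LINT \<theta>|g. ?F \<theta> x)" for x
    by (simp only: signed_mixture_def mult.left_commute[of "\<phi> _"] integral_mult_right_zero)
  show "integrable \<mu> (\<lambda>x. test_function B k x * signed_mixture B g \<phi> x)"
    unfolding eq by (rule integrable_snd[OF iF])
  have "(LINT x|\<mu>. test_function B k x * signed_mixture B g \<phi> x) = (LINT \<theta>|g. LINT x|\<mu>. ?F \<theta> x)"
    unfolding eq by (rule Fubini_integral[OF iF])
  also have "\<dots> = (LINT \<theta>|g. \<phi> \<theta> * exp_monomial k \<theta>)"
  proof (rule integral_cong_AE)
    show "(\<lambda>\<theta>. LINT x|\<mu>. ?F \<theta> x) \<in> borel_measurable g"
      using mF by (rule \<mu>.borel_measurable_lebesgue_integral)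
  qed (use AE_int in auto)
  finally show "(LINT x|\<mu>. test_function B k x * signed_mixture B g \<phi> x) = (LINT \<theta>|g. \<phi> \<theta> * exp_monomial k \<theta>)" .
qed

end

lemma mixture_density_measurable [measurable]: "mixture_density B g \<in> borel_measurable \<mu>"
  unfolding mixture_density_eq_signed by (rule signed_mixture_measurable[where D=1]) auto

lemma integrable_component: "integrable g (\<lambda>\<theta>. component_density B \<theta> x)"
  using integrable_signed_mixture[of "\<lambda>_. 1" 1 x] by simp

lemma mixture_density_pos: "mixture_density B g x > 0"
proof -
  interpret prob_space g by (rule g_prob)
  have AE: "AE \<theta> in g. component_density B \<theta> x > 0"
    using g_AE by eventually_elim (rule component_density_pos, rule \<Theta>_pos)
  then have "mixture_density B g x \<ge> 0"
    unfolding mixture_density_def by (intro integral_nonneg_AE) (auto elim: AE_mp)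
  moreover have "mixture_density B g x \<noteq> 0"
  proof
    assume "mixture_density B g x = 0"
    then have "AE \<theta> in g. component_density B \<theta> x = 0"
      unfolding mixture_density_def using integrable_component AE
      by (subst (asm) integral_nonneg_eq_0_iff_AE) (auto elim: AE_mp)
    with AE have "AE \<theta> in g. False" by eventually_elim auto
    then show False by simp
  qed
  ultimately show ?thesis by simp
qed

lemma mixture_density_integral: "integrable \<mu> (mixture_density B g)" "(LINT x|\<mu>. mixture_density B g x) = 1"
proof -
  interpret prob_space g by (rule g_prob)
  have t: "test_function B (\<lambda>_. 0) x = 1" for x by (simp add: test_function_def)
  have e: "exp_monomial (\<lambda>_. 0) \<theta> = 1" for \<theta> :: "real ^ 'd" by (simp add: exp_monomial_def)
  show "integrable \<mu> (mixture_density B g)" "(LINT x|\<mu>. mixture_density B g x) = 1"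
    using integral_test_signed_mixture[of "\<lambda>_. 1" 1 "\<lambda>_. 0"]
    by (simp_all add: t e mixture_density_eq_signed prob_space)
qed

text \<open>
The family of test functions is closed under squaring up to constants, whence their square
integrability under every mixture.
\<close>

lemma test_function_square:
  "(test_function B k x)\<^sup>2 = (\<Prod>l\<in>B. exp ((real (k l))\<^sup>2)) * test_function B (\<lambda>l. if l \<in> B then 2 * k l else (k l + 1)\<^sup>2 - 1) x"
proof -
  have 1: "(exp (real (k l) * y - (real (k l))\<^sup>2 / 2))\<^sup>2 = exp ((real (k l))\<^sup>2) * exp (real (2 * k l) * y - (real (2 * k l))\<^sup>2 / 2)" for l y
    by (simp add: power2_eq_square mult_exp_exp field_simps)
  have 2: "((real (k l) + 1) ^ n)\<^sup>2 = (real ((k l + 1)\<^sup>2 - 1) + 1) ^ n" for l n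
  proof -
    have "(k l + 1)\<^sup>2 \<ge> 1" by simp
    then have "real ((k l + 1)\<^sup>2 - 1) + 1 = (real (k l) + 1)\<^sup>2" by (subst of_nat_diff) auto
    then show ?thesis by (simp add: power_mult[symmetric] mult.commute add.commute)
  qed
  show ?thesis
    unfolding test_function_def power_mult_distrib prod_power_distrib
    by (simp only: 1 2 prod.distrib if_P if_not_P Compl_iff cong: prod.cong) (simp add: mult_ac)
qed

lemma integrable_test_function_square: "integrable \<mu> (\<lambda>x. (test_function B k x)\<^sup>2 * mixture_density B g x)"
  unfolding test_function_square mixture_density_eq_signed mult.assoc
  by (intro integrable_mult_right integral_test_signed_mixture(1)[where D=1]) auto

end
end

section \<open>Exponential polynomials and second-order expansions\<close>

text \<open>
The polynomials in \<open>exp (\<theta> $ l)\<close>, introduced through linear operations only, so that linear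
statements about them follow from the case of monomials by induction.
\<close>

inductive_set exp_polynomials :: "(real ^ 'd::finite \<Rightarrow> real) set" where
  monomial: "exp_monomial k \<in> exp_polynomials"
| add: "F \<in> exp_polynomials \<Longrightarrow> G \<in> exp_polynomials \<Longrightarrow> (\<lambda>\<theta>. F \<theta> + G \<theta>) \<in> exp_polynomials"
| scale: "F \<in> exp_polynomials \<Longrightarrow> (\<lambda>\<theta>. c * F \<theta>) \<in> exp_polynomials"

lemma exp_monomial_mult: "exp_monomial k \<theta> * exp_monomial l \<theta> = exp_monomial (\<lambda>i. k i + l i) \<theta>"
  by (simp add: exp_monomial_def mult_exp_exp sum.distrib[symmetric] algebra_simps)

lemma exp_polynomials_mult:
  assumes "F \<in> exp_polynomials" "G \<in> exp_polynomials"
  shows "(\<lambda>\<theta>. F \<theta> * G \<theta>) \<in> exp_polynomials"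
  using assms(1)
proof (induction F)
  case (monomial k)
  show ?case using assms(2)
  proof (induction G)
    case (monomial l) then show ?case by (simp add: exp_monomial_mult exp_polynomials.monomial)
  next
    case (add F G) then show ?case
      using exp_polynomials.add[OF add.IH] by (simp add: distrib_left)
  next
    case (scale F c) then show ?case
      using exp_polynomials.scale[OF scale.IH, of c] by (simp add: mult_ac)
  qed
next
  case (add F F') then show ?case
    using exp_polynomials.add[OF add.IH] by (simp add: distrib_right)
next
  case (scale F c) then show ?case
    using exp_polynomials.scale[OF scale.IH, of c] by (simp add: mult_ac)
qed

lemma exp_polynomials_const: "(\<lambda>_. c) \<in> exp_polynomials"
proof -
  have "(\<lambda>\<theta>. c * exp_monomial (\<lambda>_. 0) \<theta>) \<in> exp_polynomials"
    by (intro exp_polynomials.scale exp_polynomials.monomial)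
  then show ?thesis by (simp add: exp_monomial_def)
qed

lemma exp_polynomials_diff:
  "F \<in> exp_polynomials \<Longrightarrow> G \<in> exp_polynomials \<Longrightarrow> (\<lambda>\<theta>. F \<theta> - G \<theta>) \<in> exp_polynomials"
  using exp_polynomials.add[of F "\<lambda>\<theta>. - 1 * G \<theta>"] exp_polynomials.scale[of G "-1"] by simp

lemma exp_polynomials_sum:
  "finite I \<Longrightarrow> (\<And>i. i \<in> I \<Longrightarrow> F i \<in> exp_polynomials) \<Longrightarrow> (\<lambda>\<theta>. \<Sum>i\<in>I. F i \<theta>) \<in> exp_polynomials"
  by (induction I rule: finite_induct) (auto intro: exp_polynomials_const exp_polynomials.add)

lemma exp_polynomials_prod:
  "finite I \<Longrightarrow> (\<And>i. i \<in> I \<Longrightarrow> F i \<in> exp_polynomials) \<Longrightarrow> (\<lambda>\<theta>. \<Prod>i\<in>I. F i \<theta>) \<in> exp_polynomials"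
  by (induction I rule: finite_induct) (auto intro: exp_polynomials_const exp_polynomials_mult)

lemma exp_polynomials_exp: "(\<lambda>\<theta>. exp (\<theta> $ l)) \<in> exp_polynomials"
proof -
  have "exp_monomial (\<lambda>i. if i = l then 1 else 0) = (\<lambda>\<theta>::real ^ 'a. exp (\<theta> $ l))"
    by (simp add: exp_monomial_def fun_eq_iff if_distrib[of real] if_distrib[of "\<lambda>x. x * _"] cong: if_cong)
  with exp_polynomials.monomial show ?thesis by (rule back_subst)
qed

lemma exp_polynomials_continuous: "F \<in> exp_polynomials \<Longrightarrow> continuous_on A F"
  by (induction F rule: exp_polynomials.induct)
     (auto simp: exp_monomial_def[abs_def] intro!: continuous_intros)

definition exp_vec :: "real ^ 'd::finite \<Rightarrow> real ^ 'd" where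
  "exp_vec \<theta> = (\<chi> l. exp (\<theta> $ l))"

definition exp_dist2 :: "real ^ 'd::finite \<Rightarrow> real ^ 'd \<Rightarrow> real" where
  "exp_dist2 \<sigma> \<theta> = (norm (exp_vec \<theta> - exp_vec \<sigma>))\<^sup>2"

lemma exp_dist2_eq: "exp_dist2 \<sigma> \<theta> = (\<Sum>l\<in>UNIV. (exp (\<theta> $ l) - exp (\<sigma> $ l)) * (exp (\<theta> $ l) - exp (\<sigma> $ l)))"
  by (simp add: exp_dist2_def power2_norm_eq_inner inner_vec_def exp_vec_def)

lemma exp_dist2_nonneg: "exp_dist2 \<sigma> \<theta> \<ge> 0" by (simp add: exp_dist2_def)

lemma exp_dist2_self: "exp_dist2 \<sigma> \<sigma> = 0" by (simp add: exp_dist2_def)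

lemma exp_dist2_pos: "\<sigma> \<noteq> \<tau> \<Longrightarrow> exp_dist2 \<sigma> \<tau> > 0"
proof -
  assume "\<sigma> \<noteq> \<tau>"
  then obtain l where "\<sigma> $ l \<noteq> \<tau> $ l" by (auto simp: vec_eq_iff)
  then have "exp_vec \<tau> \<noteq> exp_vec \<sigma>" by (auto simp: exp_vec_def vec_eq_iff intro!: exI[of _ l])
  then show ?thesis by (simp add: exp_dist2_def)
qed

lemma exp_polynomials_exp_dist2: "exp_dist2 \<sigma> \<in> exp_polynomials"
proof -
  have "(\<lambda>\<theta>. exp_dist2 \<sigma> \<theta>) \<in> exp_polynomials" unfolding exp_dist2_eq
    by (intro exp_polynomials_sum exp_polynomials_mult exp_polynomials_diff exp_polynomials_exp exp_polynomials_const) auto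
  then show ?thesis .
qed

context parameter_space begin

lemma exp_polynomials_bounded:
  assumes "F \<in> exp_polynomials"
  obtains C where "\<And>\<theta>. \<theta> \<in> \<Theta> \<Longrightarrow> \<bar>F \<theta>\<bar> \<le> C"
proof -
  have "compact (F ` closure \<Theta>)"
    using bounded_\<Theta> by (intro compact_continuous_image exp_polynomials_continuous assms) (simp add: compact_closure)
  then obtain C where "\<forall>y\<in>F ` closure \<Theta>. \<bar>y\<bar> \<le> C"
    using compact_imp_bounded bounded_iff by (metis real_norm_def)
  then have "\<bar>F \<theta>\<bar> \<le> C" if "\<theta> \<in> \<Theta>" for \<theta> using that closure_subset by blast
  then show ?thesis by (rule that)
qed

lemma exp_polynomials_measurable: "F \<in> exp_polynomials \<Longrightarrow> F \<in> borel_measurable borel"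
  by (intro borel_measurable_continuous_onI exp_polynomials_continuous)

lemma exp_polynomials_integrable: "F \<in> exp_polynomials \<Longrightarrow> g \<in> mixing_measures \<Theta> \<Longrightarrow> integrable g F"
  using exp_polynomials_bounded exp_polynomials_measurable integrable_bounded_on_parameters by metis


text \<open>
On \<open>\<Theta>\<close> the function \<open>F\<close> is bounded by \<open>N\<close> and differs from an affine function of \<open>exp \<theta>\<close>, with
gradient \<open>b\<close> of length at most \<open>N\<close>, by an error of second order at \<open>\<sigma>\<close>. Keeping a single constant
\<open>N\<close> allows infinitely many functions \<open>F\<close> to be treated uniformly.
\<close>

definition jet :: "real ^ 'd \<Rightarrow> (real ^ 'd \<Rightarrow> real) \<Rightarrow> real \<Rightarrow> bool" where
  "jet \<sigma> F N \<longleftrightarrow> (\<exists>b. norm b \<le> N \<and> (\<forall>\<theta>\<in>\<Theta>. \<bar>F \<theta>\<bar> \<le> N \<and>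
     \<bar>F \<theta> - F \<sigma> - b \<bullet> (exp_vec \<theta> - exp_vec \<sigma>)\<bar> \<le> N * exp_dist2 \<sigma> \<theta>))"

lemma jet_mono: "jet \<sigma> F N \<Longrightarrow> N \<le> N' \<Longrightarrow> jet \<sigma> F N'"
  unfolding jet_def using mult_right_mono[OF _ exp_dist2_nonneg, of N N'] by (meson order_trans)

lemma jet_nonneg: "jet \<sigma> F N \<Longrightarrow> N \<ge> 0"
  unfolding jet_def by (meson norm_ge_zero order_trans)

lemma jet_const: "jet \<sigma> (\<lambda>_. c) \<bar>c\<bar>"
  unfolding jet_def by (intro exI[of _ 0]) (auto simp: exp_dist2_nonneg)

lemma jet_add:
  assumes "jet \<sigma> F N" "jet \<sigma> G N'"
  shows "jet \<sigma> (\<lambda>\<theta>. F \<theta> + G \<theta>) (N + N')"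
proof -
  obtain b where b: "norm b \<le> N" "\<forall>\<theta>\<in>\<Theta>. \<bar>F \<theta>\<bar> \<le> N \<and> \<bar>F \<theta> - F \<sigma> - b \<bullet> (exp_vec \<theta> - exp_vec \<sigma>)\<bar> \<le> N * exp_dist2 \<sigma> \<theta>"
    using assms(1) by (auto simp: jet_def)
  obtain c where c: "norm c \<le> N'" "\<forall>\<theta>\<in>\<Theta>. \<bar>G \<theta>\<bar> \<le> N' \<and> \<bar>G \<theta> - G \<sigma> - c \<bullet> (exp_vec \<theta> - exp_vec \<sigma>)\<bar> \<le> N' * exp_dist2 \<sigma> \<theta>"
    using assms(2) by (auto simp: jet_def)
  show ?thesis unfolding jet_def
  proof (intro exI[of _ "b + c"] conjI ballI)
    show "norm (b + c) \<le> N + N'" using b(1) c(1) norm_triangle_ineq[of b c] by linarith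
    fix \<theta> assume t: "\<theta> \<in> \<Theta>"
    show "\<bar>F \<theta> + G \<theta>\<bar> \<le> N + N'" using b(2) c(2) t by (smt (verit))
    have "(F \<theta> + G \<theta>) - (F \<sigma> + G \<sigma>) - (b + c) \<bullet> (exp_vec \<theta> - exp_vec \<sigma>) =
       (F \<theta> - F \<sigma> - b \<bullet> (exp_vec \<theta> - exp_vec \<sigma>)) + (G \<theta> - G \<sigma> - c \<bullet> (exp_vec \<theta> - exp_vec \<sigma>))"
      by (simp add: inner_add_left)
    then show "\<bar>(F \<theta> + G \<theta>) - (F \<sigma> + G \<sigma>) - (b + c) \<bullet> (exp_vec \<theta> - exp_vec \<sigma>)\<bar> \<le> (N + N') * exp_dist2 \<sigma> \<theta>"
      using b(2) c(2) t by (simp only: distrib_right) (smt (verit))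
  qed
qed

definition exp_diameter :: real where
  "exp_diameter = (SOME D. D \<ge> 0 \<and> (\<forall>\<sigma>\<in>\<Theta>. \<forall>\<theta>\<in>\<Theta>. norm (exp_vec \<theta> - exp_vec \<sigma>) \<le> D))"

lemma exp_diameter: "exp_diameter \<ge> 0" "\<sigma> \<in> \<Theta> \<Longrightarrow> \<theta> \<in> \<Theta> \<Longrightarrow> norm (exp_vec \<theta> - exp_vec \<sigma>) \<le> exp_diameter"
proof -
  have "compact ((exp_vec :: real ^ 'd \<Rightarrow> _) ` closure \<Theta>)"
    using bounded_\<Theta> unfolding exp_vec_def[abs_def]
    by (intro compact_continuous_image continuous_intros) (simp add: compact_closure)
  then have "bounded (exp_vec ` \<Theta>)"
    by (meson bounded_subset closure_subset compact_imp_bounded image_mono)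
  then obtain D where D: "D > 0" "\<And>\<theta>. \<theta> \<in> \<Theta> \<Longrightarrow> norm (exp_vec \<theta>) \<le> D" by (auto simp: bounded_pos)
  have "norm (exp_vec \<theta> - exp_vec \<sigma>) \<le> D + D" if "\<sigma> \<in> \<Theta>" "\<theta> \<in> \<Theta>" for \<theta> \<sigma>
    using norm_triangle_ineq4[of "exp_vec \<theta>" "exp_vec \<sigma>"] D(2)[OF that(1)] D(2)[OF that(2)] by linarith
  then have "\<exists>D. D \<ge> 0 \<and> (\<forall>\<sigma>\<in>\<Theta>. \<forall>\<theta>\<in>\<Theta>. norm (exp_vec \<theta> - exp_vec \<sigma>) \<le> D)"
    using D by (intro exI[of _ "D + D"]) auto
  from someI_ex[OF this] show "exp_diameter \<ge> 0" "\<sigma> \<in> \<Theta> \<Longrightarrow> \<theta> \<in> \<Theta> \<Longrightarrow> norm (exp_vec \<theta> - exp_vec \<sigma>) \<le> exp_diameter"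
    unfolding exp_diameter_def by auto
qed

lemma jet_lipschitz:
  assumes "jet \<sigma> F N" "\<sigma> \<in> \<Theta>" "\<theta> \<in> \<Theta>"
  shows "\<bar>F \<theta> - F \<sigma>\<bar> \<le> N * (1 + exp_diameter) * norm (exp_vec \<theta> - exp_vec \<sigma>)"
proof -
  let ?d = "exp_vec \<theta> - exp_vec \<sigma>"
  obtain b where b: "norm b \<le> N" "\<bar>F \<theta> - F \<sigma> - b \<bullet> ?d\<bar> \<le> N * exp_dist2 \<sigma> \<theta>"
    using assms by (auto simp: jet_def)
  have N: "N \<ge> 0" by (rule jet_nonneg[OF assms(1)])
  have "\<bar>b \<bullet> ?d\<bar> \<le> N * norm ?d"
    by (rule order_trans[OF Cauchy_Schwarz_ineq2]) (intro mult_right_mono b norm_ge_zero)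
  moreover have "N * exp_dist2 \<sigma> \<theta> \<le> N * (exp_diameter * norm ?d)"
    unfolding exp_dist2_def power2_eq_square
    using N exp_diameter(2)[OF assms(2,3)] by (intro mult_left_mono mult_right_mono) auto
  ultimately have "\<bar>F \<theta> - F \<sigma>\<bar> \<le> N * norm ?d + N * (exp_diameter * norm ?d)" using b(2) by linarith
  then show ?thesis by (simp add: algebra_simps)
qed

text \<open>
The factor \<open>3 + exp_diameter\<close> depends on \<open>\<Theta>\<close> alone, so a product of \<open>n\<close> functions costs only a
factor exponential in \<open>n\<close>.
\<close>

lemma jet_mult:
  assumes F: "jet \<sigma> F N" and G: "jet \<sigma> G N'" and \<sigma>: "\<sigma> \<in> \<Theta>"
  shows "jet \<sigma> (\<lambda>\<theta>. F \<theta> * G \<theta>) ((3 + exp_diameter) * N * N')"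
proof -
  obtain b where b: "norm b \<le> N" "\<forall>\<theta>\<in>\<Theta>. \<bar>F \<theta>\<bar> \<le> N \<and> \<bar>F \<theta> - F \<sigma> - b \<bullet> (exp_vec \<theta> - exp_vec \<sigma>)\<bar> \<le> N * exp_dist2 \<sigma> \<theta>"
    using F by (auto simp: jet_def)
  obtain c where c: "norm c \<le> N'" "\<forall>\<theta>\<in>\<Theta>. \<bar>G \<theta>\<bar> \<le> N' \<and> \<bar>G \<theta> - G \<sigma> - c \<bullet> (exp_vec \<theta> - exp_vec \<sigma>)\<bar> \<le> N' * exp_dist2 \<sigma> \<theta>"
    using G by (auto simp: jet_def)
  have N: "N \<ge> 0" "N' \<ge> 0" using F G by (auto dest: jet_nonneg)
  have NN: "0 \<le> N * N'" using N by simp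
  have D: "exp_diameter \<ge> 0" by (rule exp_diameter)
  have F\<sigma>: "\<bar>F \<sigma>\<bar> \<le> N" "\<bar>G \<sigma>\<bar> \<le> N'" using b c \<sigma> by auto
  show ?thesis unfolding jet_def
  proof (intro exI[of _ "F \<sigma> *\<^sub>R c + G \<sigma> *\<^sub>R b"] conjI ballI)
    have "norm (F \<sigma> *\<^sub>R c + G \<sigma> *\<^sub>R b) \<le> \<bar>F \<sigma>\<bar> * norm c + \<bar>G \<sigma>\<bar> * norm b"
      by (rule order_trans[OF norm_triangle_ineq]) simp
    also have "\<dots> \<le> N * N' + N' * N" using F\<sigma> b(1) c(1) N by (intro add_mono mult_mono) auto
    also have "\<dots> = 2 * (N * N')" by simp
    also have "\<dots> \<le> (3 + exp_diameter) * (N * N')" using D NN by (intro mult_right_mono) auto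
    finally show "norm (F \<sigma> *\<^sub>R c + G \<sigma> *\<^sub>R b) \<le> (3 + exp_diameter) * N * N'" by (simp add: mult.assoc)
    fix \<theta> assume t: "\<theta> \<in> \<Theta>"
    let ?d = "exp_vec \<theta> - exp_vec \<sigma>" and ?q = "exp_dist2 \<sigma> \<theta>"
    have q: "?q \<ge> 0" by (rule exp_dist2_nonneg)
    have "\<bar>F \<theta> * G \<theta>\<bar> \<le> N * N'" unfolding abs_mult using b(2) c(2) t N by (intro mult_mono) auto
    also have "\<dots> \<le> (3 + exp_diameter) * (N * N')" using mult_right_mono[of 1 "3 + exp_diameter" "N * N'"] D NN by simp
    finally show "\<bar>F \<theta> * G \<theta>\<bar> \<le> (3 + exp_diameter) * N * N'" by (simp add: mult.assoc)
    have "F \<theta> * G \<theta> - F \<sigma> * G \<sigma> - (F \<sigma> *\<^sub>R c + G \<sigma> *\<^sub>R b) \<bullet> ?d =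
       F \<theta> * (G \<theta> - G \<sigma> - c \<bullet> ?d) + (F \<theta> - F \<sigma>) * (c \<bullet> ?d) + G \<sigma> * (F \<theta> - F \<sigma> - b \<bullet> ?d)"
      by (simp add: inner_add_left algebra_simps)
    also have "\<bar>\<dots>\<bar> \<le> \<bar>F \<theta> * (G \<theta> - G \<sigma> - c \<bullet> ?d)\<bar> + \<bar>(F \<theta> - F \<sigma>) * (c \<bullet> ?d)\<bar> + \<bar>G \<sigma> * (F \<theta> - F \<sigma> - b \<bullet> ?d)\<bar>"
      by linarith
    also have "\<dots> \<le> N * (N' * ?q) + (N * (1 + exp_diameter) * norm ?d) * (N' * norm ?d) + N' * (N * ?q)"
    proof -
      have "\<bar>c \<bullet> ?d\<bar> \<le> N' * norm ?d"
        by (rule order_trans[OF Cauchy_Schwarz_ineq2]) (intro mult_right_mono c norm_ge_zero)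
      then show ?thesis unfolding abs_mult
        using b(2) c(2) t N D F\<sigma> jet_lipschitz[OF F \<sigma> t] by (intro add_mono mult_mono) auto
    qed
    also have "\<dots> = (3 + exp_diameter) * N * N' * ?q"
      by (simp add: exp_dist2_def power2_eq_square algebra_simps)
    finally show "\<bar>F \<theta> * G \<theta> - F \<sigma> * G \<sigma> - (F \<sigma> *\<^sub>R c + G \<sigma> *\<^sub>R b) \<bullet> ?d\<bar> \<le> (3 + exp_diameter) * N * N' * ?q" .
  qed
qed

lemma exp_polynomials_jet:
  assumes "F \<in> exp_polynomials" and \<sigma>: "\<sigma> \<in> \<Theta>"
  shows "\<exists>N. jet \<sigma> F N"
  using assms(1)
proof (induction F)
  case (monomial k)
  have ex: "\<exists>N. jet \<sigma> (\<lambda>\<theta>. exp (\<theta> $ l)) N" for l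
  proof -
    obtain C where C: "\<And>\<theta>. \<theta> \<in> \<Theta> \<Longrightarrow> \<bar>exp (\<theta> $ l)\<bar> \<le> C"
      using exp_polynomials_bounded[OF exp_polynomials_exp] by blast
    have "jet \<sigma> (\<lambda>\<theta>. exp (\<theta> $ l)) (\<bar>C\<bar> + 1)"
      unfolding jet_def
    proof (intro exI[of _ "axis l 1"] conjI ballI)
      fix \<theta> assume "\<theta> \<in> \<Theta>"
      then show "\<bar>exp (\<theta> $ l)\<bar> \<le> \<bar>C\<bar> + 1" using C[of \<theta>] by linarith
      show "\<bar>exp (\<theta> $ l) - exp (\<sigma> $ l) - axis l 1 \<bullet> (exp_vec \<theta> - exp_vec \<sigma>)\<bar> \<le> (\<bar>C\<bar> + 1) * exp_dist2 \<sigma> \<theta>"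
        by (simp add: inner_axis' exp_vec_def exp_dist2_nonneg)
    qed (simp add: norm_axis_1)
    then show ?thesis ..
  qed
  have pow: "\<exists>N. jet \<sigma> (\<lambda>\<theta>. exp (\<theta> $ l) ^ n) N" for l n
    by (induction n) (use jet_const[of \<sigma> 1] ex[of l] jet_mult[OF _ _ \<sigma>] in \<open>auto, blast+\<close>)
  have "\<exists>N. jet \<sigma> (\<lambda>\<theta>. \<Prod>l\<in>A. exp (\<theta> $ l) ^ k l) N" if "finite A" for A
    using that by (induction A rule: finite_induct) (use jet_const[of \<sigma> 1] pow jet_mult[OF _ _ \<sigma>] in \<open>auto, blast+\<close>)
  from this[of UNIV] show ?case
    by (simp add: exp_monomial_def[abs_def] exp_sum exp_of_nat_mult)
next
  case (add F G) then show ?case using jet_add by blast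
next
  case (scale F c) then show ?case using jet_mult[OF jet_const _ \<sigma>] by blast
qed

end

section \<open>Deviations from a finitely supported mixing distribution\<close>

locale true_mixture = parameter_space B \<Theta> for B :: "'d::finite set" and \<Theta> :: "(real ^ 'd) set" +
  fixes g0 :: "(real ^ 'd) measure"
  assumes g0: "g0 \<in> mixing_measures \<Theta>"
begin

abbreviation "f0 \<equiv> mixture_density B g0"

definition true_law :: "'d observation measure" where
  "true_law = density \<mu> (\<lambda>x. ennreal (f0 x))"

lemma sets_true_law [measurable_cong]: "sets true_law = sets \<mu>"
  by (simp add: true_law_def)

lemma f0_pos: "f0 x > 0" by (rule mixture_density_pos[OF g0])

lemma f0_measurable [measurable]: "f0 \<in> borel_measurable \<mu>" by (rule mixture_density_measurable[OF g0])

lemma prob_space_true_law: "prob_space true_law"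
proof
  have "(\<integral>\<^sup>+x. ennreal (f0 x) \<partial>\<mu>) = ennreal (LINT x|\<mu>. f0 x)"
    using mixture_density_integral(1)[OF g0] f0_pos by (intro nn_integral_eq_integral) (auto simp: less_imp_le)
  then show "emeasure true_law (space true_law) = 1"
    using mixture_density_integral(2)[OF g0] by (simp add: true_law_def emeasure_density)
qed

lemma integral_true_law:
  fixes h :: "'d observation \<Rightarrow> real"
  assumes [measurable]: "h \<in> borel_measurable \<mu>"
  shows "(LINT x|true_law. h x) = (LINT x|\<mu>. f0 x * h x)"
    and "integrable true_law h \<longleftrightarrow> integrable \<mu> (\<lambda>x. f0 x * h x)"
  unfolding true_law_def using f0_pos
  by (subst integral_real_density integrable_real_density; auto simp: less_imp_le)+

text \<open>
The functions \<open>s * h\<close> of the introduction; \<open>s\<close> is called \<open>chi g\<close>.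
\<close>

definition rel_dev :: "(real ^ 'd) measure \<Rightarrow> 'd observation \<Rightarrow> real" where
  "rel_dev g x = mixture_density B g x / f0 x - 1"

definition chi :: "(real ^ 'd) measure \<Rightarrow> real" where
  "chi g = sqrt (LINT x|true_law. (rel_dev g x)\<^sup>2)"

lemma rel_dev_measurable: "g \<in> mixing_measures \<Theta> \<Longrightarrow> rel_dev g \<in> borel_measurable \<mu>"
  unfolding rel_dev_def[abs_def] using mixture_density_measurable by measurable

lemma chi_nonneg: "chi g \<ge> 0" by (simp add: chi_def)

lemma chi_square_eq:
  assumes "g \<in> mixing_measures \<Theta>" "integrable true_law (\<lambda>x. (rel_dev g x)\<^sup>2)"
  shows "chi_square \<mu> (mixture_density B g) f0 = ennreal ((chi g)\<^sup>2)"
  using nn_integral_eq_integral[OF assms(2)] by (simp add: chi_square_def chi_def rel_dev_def true_law_def)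

lemma integrable_test_function_square_true: "integrable true_law (\<lambda>x. (test_function B k x)\<^sup>2)"
  using integrable_test_function_square[OF g0, of k] by (subst integral_true_law) (auto simp: mult.commute)

lemma integral_test_rel_dev:
  assumes g: "g \<in> mixing_measures \<Theta>"
  shows "integrable true_law (\<lambda>x. test_function B k x * rel_dev g x)"
    and "(LINT x|true_law. test_function B k x * rel_dev g x) = (LINT \<theta>|g. exp_monomial k \<theta>) - (LINT \<theta>|g0. exp_monomial k \<theta>)"
proof -
  note [measurable] = rel_dev_measurable[OF g]
  have eq: "f0 x * (test_function B k x * rel_dev g x) =
      test_function B k x * signed_mixture B g (\<lambda>_. 1) x - test_function B k x * signed_mixture B g0 (\<lambda>_. 1) x" for x
    using f0_pos[of x] by (simp add: rel_dev_def mixture_density_eq_signed field_simps)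
  note i = integral_test_signed_mixture[of _ "\<lambda>_. 1" 1 k, simplified]
  show "integrable true_law (\<lambda>x. test_function B k x * rel_dev g x)"
    by (subst integral_true_law) (auto simp: eq intro!: Bochner_Integration.integrable_diff i g g0)
  show "(LINT x|true_law. test_function B k x * rel_dev g x) = (LINT \<theta>|g. exp_monomial k \<theta>) - (LINT \<theta>|g0. exp_monomial k \<theta>)"
    by (subst integral_true_law, measurable) (simp add: eq Bochner_Integration.integral_diff i g g0)
qed

text \<open>
The pairing of \<open>F\<close> with \<open>g - g0\<close> is of order \<open>chi g\<close>, uniformly in \<open>g\<close>.
\<close>

definition dual_bound :: "(real ^ 'd \<Rightarrow> real) \<Rightarrow> real \<Rightarrow> bool" where
  "dual_bound F C \<longleftrightarrow> C \<ge> 0 \<and> (\<forall>g\<in>mixing_measures \<Theta>. integrable true_law (\<lambda>x. (rel_dev g x)\<^sup>2) \<longrightarrow> chi g > 0 \<longrightarrow>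
      \<bar>(LINT \<theta>|g. F \<theta>) - (LINT \<theta>|g0. F \<theta>)\<bar> \<le> C * chi g)"

text \<open>
The difference of the integrals is the inner product of a test function \<open>t\<close> with the relative
deviation \<open>d\<close>. The Cauchy-Schwarz inequality is used in the form \<open>2 * \<bar>t * d\<bar> \<le> s * t\<^sup>2 + d\<^sup>2 / s\<close>
with \<open>s = chi g\<close>.
\<close>

lemma dual_bound_exp_monomial: "dual_bound (exp_monomial k) (((LINT x|true_law. (test_function B k x)\<^sup>2) + 1) / 2)"
  unfolding dual_bound_def
proof (intro conjI ballI impI)
  fix g assume g: "g \<in> mixing_measures \<Theta>" and i: "integrable true_law (\<lambda>x. (rel_dev g x)\<^sup>2)" and s: "chi g > 0"
  let ?t = "test_function B k" and ?s = "chi g"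
  have "\<bar>LINT x|true_law. ?t x * rel_dev g x\<bar> \<le> (LINT x|true_law. \<bar>?t x * rel_dev g x\<bar>)" by (rule integral_abs_bound)
  also have "\<dots> \<le> (LINT x|true_law. ?s / 2 * (?t x)\<^sup>2 + (rel_dev g x)\<^sup>2 / (2 * ?s))"
  proof (rule integral_mono)
    show "integrable true_law (\<lambda>x. \<bar>?t x * rel_dev g x\<bar>)"
      using integral_test_rel_dev(1)[OF g] by simp
    show "integrable true_law (\<lambda>x. ?s / 2 * (?t x)\<^sup>2 + (rel_dev g x)\<^sup>2 / (2 * ?s))"
      using i integrable_test_function_square_true by auto
    fix x
    have "0 \<le> (?s * \<bar>?t x\<bar> - \<bar>rel_dev g x\<bar>)\<^sup>2 / (2 * ?s)" using s by simp
    also have "\<dots> = ?s / 2 * (?t x)\<^sup>2 + (rel_dev g x)\<^sup>2 / (2 * ?s) - \<bar>?t x * rel_dev g x\<bar>"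
      using s by (simp add: power2_diff power_mult_distrib abs_mult field_simps power2_eq_square)
    finally show "\<bar>?t x * rel_dev g x\<bar> \<le> ?s / 2 * (?t x)\<^sup>2 + (rel_dev g x)\<^sup>2 / (2 * ?s)" by simp
  qed
  also have "\<dots> = ?s / 2 * (LINT x|true_law. (?t x)\<^sup>2) + (LINT x|true_law. (rel_dev g x)\<^sup>2) / (2 * ?s)"
    using i integrable_test_function_square_true by simp
  also have "(LINT x|true_law. (rel_dev g x)\<^sup>2) = ?s\<^sup>2" by (simp add: chi_def)
  also have "?s / 2 * (LINT x|true_law. (?t x)\<^sup>2) + ?s\<^sup>2 / (2 * ?s) = ((LINT x|true_law. (?t x)\<^sup>2) + 1) / 2 * ?s"
    using s by (simp add: power2_eq_square field_simps)
  finally show "\<bar>(LINT \<theta>|g. exp_monomial k \<theta>) - (LINT \<theta>|g0. exp_monomial k \<theta>)\<bar> \<le>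
      ((LINT x|true_law. (?t x)\<^sup>2) + 1) / 2 * ?s"
    by (simp add: integral_test_rel_dev(2)[OF g])
qed simp

lemma dual_bound_add:
  assumes F: "F \<in> exp_polynomials" "dual_bound F C" and G: "G \<in> exp_polynomials" "dual_bound G C'"
  shows "dual_bound (\<lambda>\<theta>. F \<theta> + G \<theta>) (C + C')"
  unfolding dual_bound_def
proof (intro conjI ballI impI)
  fix g assume g: "g \<in> mixing_measures \<Theta>" "integrable true_law (\<lambda>x. (rel_dev g x)\<^sup>2)" "chi g > 0"
  have "\<bar>(LINT \<theta>|g. F \<theta>) - (LINT \<theta>|g0. F \<theta>)\<bar> \<le> C * chi g" "\<bar>(LINT \<theta>|g. G \<theta>) - (LINT \<theta>|g0. G \<theta>)\<bar> \<le> C' * chi g"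
    using F G g by (auto simp: dual_bound_def)
  then show "\<bar>(LINT \<theta>|g. F \<theta> + G \<theta>) - (LINT \<theta>|g0. F \<theta> + G \<theta>)\<bar> \<le> (C + C') * chi g"
    using exp_polynomials_integrable F(1) G(1) g(1) g0 by (simp add: distrib_right) 
qed (use F G in \<open>auto simp: dual_bound_def\<close>)

lemma dual_bound_scale:
  assumes F: "dual_bound F C" shows "dual_bound (\<lambda>\<theta>. c * F \<theta>) (\<bar>c\<bar> * C)"
  using assms by (auto simp: dual_bound_def abs_mult right_diff_distrib[symmetric] mult.assoc mult_left_mono)

lemma exp_polynomials_dual_bound: "F \<in> exp_polynomials \<Longrightarrow> \<exists>C. dual_bound F C"
proof (induction F rule: exp_polynomials.induct)
  case (monomial k) then show ?case using dual_bound_exp_monomial by blast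
next
  case (add F G) then show ?case using dual_bound_add by blast
next
  case (scale F c) then show ?case using dual_bound_scale by blast
qed

end

locale finitely_supported_truth = true_mixture B \<Theta> g0
  for B :: "'d::finite set" and \<Theta> and g0 +
  fixes S :: "(real ^ 'd) set"
  assumes S_finite: "finite S" and S_subset: "S \<subseteq> \<Theta>" and S_AE: "AE \<theta> in g0. \<theta> \<in> S"
begin

lemma S_nonempty: "S \<noteq> {}"
proof
  interpret prob_space g0 using g0 by (simp add: mixing_measures_def)
  assume "S = {}" then show False using S_AE by simp
qed

text \<open>
Ingredients of Hermite interpolation at the points of \<open>S\<close> by exponential polynomials. The function
\<open>vanishing\<close> has double zeros at the points of \<open>S\<close>. The function \<open>pre_bump \<sigma>\<close> is one at \<open>\<sigma>\<close> and has
double zeros at the other points. Since \<open>bump \<sigma> = 1 - (1 - pre_bump \<sigma>)\<^sup>2\<close>, it has in addition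
vanishing gradient at \<open>\<sigma>\<close>.
\<close>

definition vanishing :: "real ^ 'd \<Rightarrow> real" where
  "vanishing \<theta> = (\<Prod>\<tau>\<in>S. exp_dist2 \<tau> \<theta>)"

definition pre_bump :: "real ^ 'd \<Rightarrow> real ^ 'd \<Rightarrow> real" where
  "pre_bump \<sigma> \<theta> = (\<Prod>\<tau>\<in>S - {\<sigma>}. 1 / exp_dist2 \<tau> \<sigma> * exp_dist2 \<tau> \<theta>)"

definition bump :: "real ^ 'd \<Rightarrow> real ^ 'd \<Rightarrow> real" where
  "bump \<sigma> \<theta> = pre_bump \<sigma> \<theta> * (2 - pre_bump \<sigma> \<theta>)"

lemma vanishing_poly: "vanishing \<in> exp_polynomials"
proof -
  have "(\<lambda>\<theta>. vanishing \<theta>) \<in> exp_polynomials" unfolding vanishing_def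
    by (intro exp_polynomials_prod S_finite exp_polynomials_exp_dist2)
  then show ?thesis .
qed

lemma pre_bump_poly: "pre_bump \<sigma> \<in> exp_polynomials"
proof -
  have "(\<lambda>\<theta>. pre_bump \<sigma> \<theta>) \<in> exp_polynomials" unfolding pre_bump_def
    by (intro exp_polynomials_prod exp_polynomials.scale exp_polynomials_exp_dist2) (simp add: S_finite)
  then show ?thesis .
qed

lemma bump_poly: "bump \<sigma> \<in> exp_polynomials"
proof -
  have "(\<lambda>\<theta>. bump \<sigma> \<theta>) \<in> exp_polynomials" unfolding bump_def
    by (intro exp_polynomials_mult exp_polynomials_diff exp_polynomials_const pre_bump_poly)
  then show ?thesis .
qed

lemma pre_bump_nonneg: "pre_bump \<sigma> \<theta> \<ge> 0"
  unfolding pre_bump_def by (intro prod_nonneg) (simp add: exp_dist2_nonneg)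

lemma vanishing_nonneg: "vanishing \<theta> \<ge> 0"
  unfolding vanishing_def by (intro prod_nonneg) (simp add: exp_dist2_nonneg)

lemma pre_bump_self: "pre_bump \<sigma> \<sigma> = 1"
  unfolding pre_bump_def by (intro prod.neutral) (auto simp: exp_dist2_pos less_imp_neq[symmetric] dest: exp_dist2_pos)

lemma vanishing_eq_0: "\<theta> \<in> S \<Longrightarrow> vanishing \<theta> = 0"
  unfolding vanishing_def using exp_dist2_self by (intro prod_zero[OF S_finite]) blast

definition bump_const :: "real ^ 'd \<Rightarrow> real" where
  "bump_const \<sigma> = (\<Prod>\<tau>\<in>S - {\<sigma>}. 1 / exp_dist2 \<tau> \<sigma>)"

lemma bump_const_pos: "bump_const \<sigma> > 0"
  unfolding bump_const_def by (intro prod_pos) (auto simp: exp_dist2_pos)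

lemma dist_times_pre_bump:
  assumes "\<sigma> \<in> S" shows "exp_dist2 \<sigma> \<theta> * pre_bump \<sigma> \<theta> = bump_const \<sigma> * vanishing \<theta>"
  unfolding pre_bump_def vanishing_def bump_const_def prod.distrib
  using prod.remove[OF S_finite assms, of "\<lambda>\<tau>. exp_dist2 \<tau> \<theta>"] by simp

text \<open>
At most one factor of \<open>vanishing\<close> can be small. If \<open>\<sigma>\<close> is the support point nearest to \<open>\<theta>\<close> then,
by the triangle inequality, the distance of \<open>\<theta>\<close> to every other \<open>\<tau>\<close> is at least half the distance
of \<open>\<sigma>\<close> and \<open>\<tau>\<close>; squaring costs the factors \<open>4\<close>.
\<close>

lemma nearest_support_point:
  assumes "\<theta> \<in> \<Theta>"
  shows "\<exists>\<sigma>\<in>S. exp_dist2 \<sigma> \<theta> \<le> (\<Sum>\<tau>\<in>S. 4 ^ card S * bump_const \<tau>) * vanishing \<theta>"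
proof -
  obtain \<sigma> where \<sigma>: "\<sigma> \<in> S" "\<And>\<tau>. \<tau> \<in> S \<Longrightarrow> norm (exp_vec \<theta> - exp_vec \<sigma>) \<le> norm (exp_vec \<theta> - exp_vec \<tau>)"
    using arg_min_if_finite[OF S_finite S_nonempty, of "\<lambda>\<sigma>. norm (exp_vec \<theta> - exp_vec \<sigma>)"] by (meson not_le)
  have far: "1 \<le> 4 * (1 / exp_dist2 \<tau> \<sigma> * exp_dist2 \<tau> \<theta>)" if "\<tau> \<in> S - {\<sigma>}" for \<tau>
  proof -
    have "norm (exp_vec \<sigma> - exp_vec \<tau>) \<le> norm (exp_vec \<theta> - exp_vec \<tau>) + norm (exp_vec \<theta> - exp_vec \<sigma>)"
      using norm_triangle_ineq4[of "exp_vec \<theta> - exp_vec \<tau>" "exp_vec \<theta> - exp_vec \<sigma>"] by simp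
    also have "\<dots> \<le> 2 * norm (exp_vec \<theta> - exp_vec \<tau>)" using \<sigma>(2)[of \<tau>] that by simp
    finally have "(norm (exp_vec \<sigma> - exp_vec \<tau>))\<^sup>2 \<le> (2 * norm (exp_vec \<theta> - exp_vec \<tau>))\<^sup>2" by (intro power_mono) auto
    then have "exp_dist2 \<tau> \<sigma> \<le> 4 * exp_dist2 \<tau> \<theta>" by (simp add: exp_dist2_def power_mult_distrib)
    moreover have "exp_dist2 \<tau> \<sigma> > 0" using that by (intro exp_dist2_pos) auto
    ultimately show ?thesis by (simp add: field_simps)
  qed
  have "1 \<le> (\<Prod>\<tau>\<in>S - {\<sigma>}. 4 * (1 / exp_dist2 \<tau> \<sigma> * exp_dist2 \<tau> \<theta>))"
    using far by (intro prod_ge_1) auto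
  also have "\<dots> = 4 ^ card (S - {\<sigma>}) * pre_bump \<sigma> \<theta>"
    by (simp only: pre_bump_def prod.distrib prod_constant)
  also have "\<dots> \<le> 4 ^ card S * pre_bump \<sigma> \<theta>"
    using pre_bump_nonneg S_finite by (intro mult_right_mono power_increasing card_mono) auto
  finally have "exp_dist2 \<sigma> \<theta> * 1 \<le> exp_dist2 \<sigma> \<theta> * (4 ^ card S * pre_bump \<sigma> \<theta>)"
    by (intro mult_left_mono exp_dist2_nonneg)
  also have "\<dots> = (4 ^ card S * bump_const \<sigma>) * vanishing \<theta>"
    using dist_times_pre_bump[OF \<sigma>(1), of \<theta>] by (simp add: mult_ac)
  also have "\<dots> \<le> (\<Sum>\<tau>\<in>S. 4 ^ card S * bump_const \<tau>) * vanishing \<theta>"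
    using bump_const_pos S_finite \<sigma>(1) vanishing_nonneg
    by (intro mult_right_mono member_le_sum) (auto simp: less_imp_le)
  finally show ?thesis using \<sigma>(1) by auto
qed

lemma uniform_constant:
  assumes "finite T" and G: "\<And>x::'x. 0 \<le> G x"
    and ex: "\<And>\<tau>. \<tau> \<in> T \<Longrightarrow> \<exists>C\<ge>0. \<forall>x\<in>A. F \<tau> x \<le> C * G x"
  shows "\<exists>C\<ge>0. \<forall>\<tau>\<in>T. \<forall>x\<in>A. F \<tau> x \<le> C * (G x :: real)"
proof -
  from ex obtain C where C: "\<And>\<tau>. \<tau> \<in> T \<Longrightarrow> C \<tau> \<ge> 0 \<and> (\<forall>x\<in>A. F \<tau> x \<le> C \<tau> * G x)" by metis
  have "F \<tau> x \<le> (\<Sum>\<tau>\<in>T. C \<tau>) * G x" if "\<tau> \<in> T" "x \<in> A" for \<tau> x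
  proof -
    have "C \<tau> \<le> (\<Sum>\<tau>\<in>T. C \<tau>)" using that C assms(1) by (intro member_le_sum) auto
    then show ?thesis using C[OF that(1)] that(2) G[of x] by (meson mult_right_mono order_trans)
  qed
  moreover have "(\<Sum>\<tau>\<in>T. C \<tau>) \<ge> 0" using C by (intro sum_nonneg) auto
  ultimately show ?thesis by blast
qed

text \<open>
Each \<open>bump \<tau>\<close> contains the factor \<open>exp_dist2 \<sigma>\<close>, and the remaining factors are bounded.
\<close>

lemma bump_near_other:
  assumes \<sigma>: "\<sigma> \<in> S" shows "\<exists>C\<ge>0. \<forall>\<tau>\<in>S - {\<sigma>}. \<forall>\<theta>\<in>\<Theta>. \<bar>bump \<tau> \<theta>\<bar> \<le> C * exp_dist2 \<sigma> \<theta>"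
proof (rule uniform_constant)
  show "\<exists>C\<ge>0. \<forall>\<theta>\<in>\<Theta>. \<bar>bump \<tau> \<theta>\<bar> \<le> C * exp_dist2 \<sigma> \<theta>" if \<tau>: "\<tau> \<in> S - {\<sigma>}" for \<tau>
  proof -
    let ?rest = "\<lambda>\<theta>. 1 / exp_dist2 \<sigma> \<tau> * (\<Prod>\<rho>\<in>S - {\<tau>} - {\<sigma>}. 1 / exp_dist2 \<rho> \<tau> * exp_dist2 \<rho> \<theta>) * (2 - pre_bump \<tau> \<theta>)"
    have "?rest \<in> exp_polynomials"
      by (intro exp_polynomials_mult exp_polynomials_diff exp_polynomials_const pre_bump_poly exp_polynomials_prod exp_polynomials.scale exp_polynomials_exp_dist2)
        (simp add: S_finite)
    then obtain C where C: "\<And>\<theta>. \<theta> \<in> \<Theta> \<Longrightarrow> \<bar>?rest \<theta>\<bar> \<le> C" by (rule exp_polynomials_bounded) blast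
    have eq: "bump \<tau> \<theta> = ?rest \<theta> * exp_dist2 \<sigma> \<theta>" for \<theta>
      unfolding bump_def
      by (subst (1) pre_bump_def, subst prod.remove[of _ \<sigma>]) (use S_finite \<sigma> \<tau> in \<open>auto simp: mult_ac\<close>)
    have "\<bar>bump \<tau> \<theta>\<bar> \<le> \<bar>C\<bar> * exp_dist2 \<sigma> \<theta>" if "\<theta> \<in> \<Theta>" for \<theta>
      unfolding eq abs_mult[of "?rest \<theta>"] abs_of_nonneg[OF exp_dist2_nonneg]
      by (intro mult_right_mono exp_dist2_nonneg order_trans[OF C[OF that] abs_ge_self])
    then show ?thesis by (intro exI[of _ "\<bar>C\<bar>"]) auto
  qed
qed (use S_finite exp_dist2_nonneg in auto)

text \<open>
Near each support point the bumps add up to one with an error of second order; the nearest support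
point turns this into the global bound.
\<close>

lemma bump_partition:
  "\<exists>C\<ge>0. \<forall>\<theta>\<in>\<Theta>. \<bar>1 - (\<Sum>\<tau>\<in>S. bump \<tau> \<theta>)\<bar> \<le> C * vanishing \<theta>"
proof -
  have loc: "\<exists>C\<ge>0. \<forall>\<theta>\<in>\<Theta>. \<bar>1 - (\<Sum>\<tau>\<in>S. bump \<tau> \<theta>)\<bar> \<le> C * exp_dist2 \<sigma> \<theta>" if \<sigma>: "\<sigma> \<in> S" for \<sigma>
  proof -
    have \<sigma>\<Theta>: "\<sigma> \<in> \<Theta>" using \<sigma> S_subset by auto
    obtain N where N: "jet \<sigma> (pre_bump \<sigma>) N" using exp_polynomials_jet[OF pre_bump_poly \<sigma>\<Theta>] by blast
    obtain C where C: "C \<ge> 0" "\<And>\<tau> \<theta>. \<tau> \<in> S - {\<sigma>} \<Longrightarrow> \<theta> \<in> \<Theta> \<Longrightarrow> \<bar>bump \<tau> \<theta>\<bar> \<le> C * exp_dist2 \<sigma> \<theta>"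
      using bump_near_other[OF \<sigma>] by blast
    define lip where "lip = N * (1 + exp_diameter)"
    have "\<bar>1 - (\<Sum>\<tau>\<in>S. bump \<tau> \<theta>)\<bar> \<le> (lip\<^sup>2 + card S * C) * exp_dist2 \<sigma> \<theta>" if t: "\<theta> \<in> \<Theta>" for \<theta>
    proof -
      have "1 - (\<Sum>\<tau>\<in>S. bump \<tau> \<theta>) = (pre_bump \<sigma> \<theta> - 1)\<^sup>2 - (\<Sum>\<tau>\<in>S - {\<sigma>}. bump \<tau> \<theta>)"
        using sum.remove[OF S_finite \<sigma>, of "\<lambda>\<tau>. bump \<tau> \<theta>"] by (simp add: bump_def power2_eq_square algebra_simps)
      then have "\<bar>1 - (\<Sum>\<tau>\<in>S. bump \<tau> \<theta>)\<bar> \<le> (pre_bump \<sigma> \<theta> - 1)\<^sup>2 + \<bar>\<Sum>\<tau>\<in>S - {\<sigma>}. bump \<tau> \<theta>\<bar>"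
        using abs_triangle_ineq4[of "(pre_bump \<sigma> \<theta> - 1)\<^sup>2" "\<Sum>\<tau>\<in>S - {\<sigma>}. bump \<tau> \<theta>"] by simp
      also have "(pre_bump \<sigma> \<theta> - 1)\<^sup>2 \<le> (lip * norm (exp_vec \<theta> - exp_vec \<sigma>))\<^sup>2"
        using power_mono[OF jet_lipschitz[OF N \<sigma>\<Theta> t], of 2] by (simp add: pre_bump_self lip_def)
      also have "\<bar>\<Sum>\<tau>\<in>S - {\<sigma>}. bump \<tau> \<theta>\<bar> \<le> (\<Sum>\<tau>\<in>S - {\<sigma>}. C * exp_dist2 \<sigma> \<theta>)"
        by (rule order_trans[OF sum_abs]) (intro sum_mono C(2) t)
      also have "\<dots> \<le> (\<Sum>\<tau>\<in>S. C * exp_dist2 \<sigma> \<theta>)"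
        using S_finite C(1) exp_dist2_nonneg by (intro sum_mono2) (auto intro!: mult_nonneg_nonneg)
      finally show ?thesis by (simp add: exp_dist2_def power_mult_distrib algebra_simps)
    qed
    then show ?thesis using C(1) by (intro exI[of _ "lip\<^sup>2 + card S * C"]) auto
  qed
  then obtain C where C: "\<And>\<sigma>. \<sigma> \<in> S \<Longrightarrow> C \<sigma> \<ge> 0 \<and> (\<forall>\<theta>\<in>\<Theta>. \<bar>1 - (\<Sum>\<tau>\<in>S. bump \<tau> \<theta>)\<bar> \<le> C \<sigma> * exp_dist2 \<sigma> \<theta>)"
    by metis
  define K where "K = (\<Sum>\<tau>\<in>S. 4 ^ card S * bump_const \<tau>)"
  have K: "K \<ge> 0" unfolding K_def using bump_const_pos by (intro sum_nonneg) (auto simp: less_imp_le)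
  have "\<bar>1 - (\<Sum>\<tau>\<in>S. bump \<tau> \<theta>)\<bar> \<le> ((\<Sum>\<sigma>\<in>S. C \<sigma>) * K) * vanishing \<theta>" if t: "\<theta> \<in> \<Theta>" for \<theta>
  proof -
    obtain \<sigma> where \<sigma>: "\<sigma> \<in> S" "exp_dist2 \<sigma> \<theta> \<le> K * vanishing \<theta>"
      using nearest_support_point[OF t] by (auto simp: K_def)
    have "\<bar>1 - (\<Sum>\<tau>\<in>S. bump \<tau> \<theta>)\<bar> \<le> C \<sigma> * exp_dist2 \<sigma> \<theta>" using C[OF \<sigma>(1)] t by auto
    also have "\<dots> \<le> (\<Sum>\<sigma>\<in>S. C \<sigma>) * (K * vanishing \<theta>)"
      using C \<sigma> S_finite exp_dist2_nonneg by (intro mult_mono member_le_sum sum_nonneg) auto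
    finally show ?thesis by (simp add: mult.assoc)
  qed
  moreover have "(\<Sum>\<sigma>\<in>S. C \<sigma>) * K \<ge> 0" using C K by (intro mult_nonneg_nonneg sum_nonneg) auto
  ultimately show ?thesis by blast
qed

lemma bump_second_order:
  "\<exists>C\<ge>0. \<forall>\<sigma>\<in>S. \<forall>\<theta>\<in>\<Theta>. \<bar>bump \<sigma> \<theta>\<bar> * exp_dist2 \<sigma> \<theta> \<le> C * vanishing \<theta>"
proof (rule uniform_constant)
  show "\<exists>C\<ge>0. \<forall>\<theta>\<in>\<Theta>. \<bar>bump \<sigma> \<theta>\<bar> * exp_dist2 \<sigma> \<theta> \<le> C * vanishing \<theta>" if \<sigma>: "\<sigma> \<in> S" for \<sigma>
  proof -
    have "(\<lambda>\<theta>. 2 - pre_bump \<sigma> \<theta>) \<in> exp_polynomials"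
      by (intro exp_polynomials_diff exp_polynomials_const pre_bump_poly)
    then obtain C where C: "\<And>\<theta>. \<theta> \<in> \<Theta> \<Longrightarrow> \<bar>2 - pre_bump \<sigma> \<theta>\<bar> \<le> C" by (rule exp_polynomials_bounded) blast
    have "\<bar>bump \<sigma> \<theta>\<bar> * exp_dist2 \<sigma> \<theta> \<le> (\<bar>C\<bar> * bump_const \<sigma>) * vanishing \<theta>" if "\<theta> \<in> \<Theta>" for \<theta>
    proof -
      have "\<bar>bump \<sigma> \<theta>\<bar> * exp_dist2 \<sigma> \<theta> = \<bar>2 - pre_bump \<sigma> \<theta>\<bar> * (exp_dist2 \<sigma> \<theta> * pre_bump \<sigma> \<theta>)"
        using pre_bump_nonneg[of \<sigma> \<theta>] by (simp add: bump_def abs_mult)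
      also have "\<dots> \<le> \<bar>C\<bar> * (bump_const \<sigma> * vanishing \<theta>)"
        unfolding dist_times_pre_bump[OF \<sigma>] using C[OF that] bump_const_pos[of \<sigma>] vanishing_nonneg[of \<theta>]
        by (intro mult_right_mono) (auto simp: less_imp_le)
      finally show ?thesis by (simp add: mult.assoc)
    qed
    then show ?thesis using bump_const_pos[of \<sigma>] by (intro exI[of _ "\<bar>C\<bar> * bump_const \<sigma>"]) (auto simp: less_imp_le)
  qed
qed (use S_finite vanishing_nonneg in auto)

text \<open>
Let \<open>LF\<close> be the Hermite interpolation of \<open>F\<close> at the support of \<open>g0\<close>. The remainder \<open>F - LF\<close> is at
most a multiple of \<open>N * vanishing\<close> on \<open>\<Theta>\<close>, and the integral of \<open>vanishing\<close> against \<open>g\<close> equals its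
integral against \<open>g - g0\<close>, because \<open>vanishing\<close> is zero on the support of \<open>g0\<close>. It is therefore of
order \<open>chi g\<close>, as \<open>vanishing\<close> is an exponential polynomial. The same holds for the fixed, finitely
many exponential polynomials of which \<open>LF\<close> is a combination with coefficients bounded by \<open>N\<close>.
\<close>

theorem jet_dual_bound:
  "\<exists>C\<ge>0. \<forall>F N. F \<in> borel_measurable borel \<longrightarrow> (\<forall>\<sigma>\<in>S. jet \<sigma> F N) \<longrightarrow> dual_bound F (C * N)"
proof -
  define lin where "lin \<sigma> l = (\<lambda>\<theta>. (exp (\<theta> $ l) - exp (\<sigma> $ l)) * bump \<sigma> \<theta>)" for \<sigma> l
  have lin_poly: "lin \<sigma> l \<in> exp_polynomials" for \<sigma> l unfolding lin_def
    by (intro exp_polynomials_mult exp_polynomials_diff exp_polynomials_exp exp_polynomials_const bump_poly)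
  obtain C0 where C0: "dual_bound vanishing C0" using exp_polynomials_dual_bound[OF vanishing_poly] by blast
  obtain C1 where C1: "\<And>\<sigma>. dual_bound (bump \<sigma>) (C1 \<sigma>)" using exp_polynomials_dual_bound[OF bump_poly] by metis
  obtain C2 where C2: "\<And>\<sigma> l. dual_bound (lin \<sigma> l) (C2 \<sigma> l)" using exp_polynomials_dual_bound[OF lin_poly] by metis
  obtain D1 where D1: "D1 \<ge> 0" "\<And>\<theta>. \<theta> \<in> \<Theta> \<Longrightarrow> \<bar>1 - (\<Sum>\<tau>\<in>S. bump \<tau> \<theta>)\<bar> \<le> D1 * vanishing \<theta>" using bump_partition by blast
  obtain D2 where D2: "D2 \<ge> 0" "\<And>\<sigma> \<theta>. \<sigma> \<in> S \<Longrightarrow> \<theta> \<in> \<Theta> \<Longrightarrow> \<bar>bump \<sigma> \<theta>\<bar> * exp_dist2 \<sigma> \<theta> \<le> D2 * vanishing \<theta>"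
    using bump_second_order by blast
  define C where "C = (\<Sum>\<sigma>\<in>S. C1 \<sigma> + (\<Sum>l\<in>UNIV. C2 \<sigma> l)) + (D1 + card S * D2) * C0"
  have nn: "C0 \<ge> 0" "C1 \<sigma> \<ge> 0" "C2 \<sigma> l \<ge> 0" for \<sigma> l using C0 C1 C2 by (auto simp: dual_bound_def)
  have Cnn: "C \<ge> 0" unfolding C_def using nn D1 D2 by (intro add_nonneg_nonneg sum_nonneg mult_nonneg_nonneg) auto
  have "dual_bound F (C * N)" if F [measurable]: "F \<in> borel_measurable borel" and jets: "\<forall>\<sigma>\<in>S. jet \<sigma> F N" for F N
  proof -
    have N: "N \<ge> 0" using jets S_nonempty jet_nonneg by blast
    have "\<forall>\<sigma>\<in>S. \<exists>b. norm b \<le> N \<and> (\<forall>\<theta>\<in>\<Theta>. \<bar>F \<theta>\<bar> \<le> N \<and>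
      \<bar>F \<theta> - F \<sigma> - b \<bullet> (exp_vec \<theta> - exp_vec \<sigma>)\<bar> \<le> N * exp_dist2 \<sigma> \<theta>)"
      using jets by (simp add: jet_def)
    then obtain b where b: "\<And>\<sigma>. \<sigma> \<in> S \<Longrightarrow> norm (b \<sigma>) \<le> N"
      "\<And>\<sigma> \<theta>. \<sigma> \<in> S \<Longrightarrow> \<theta> \<in> \<Theta> \<Longrightarrow> \<bar>F \<theta>\<bar> \<le> N"
      "\<And>\<sigma> \<theta>. \<sigma> \<in> S \<Longrightarrow> \<theta> \<in> \<Theta> \<Longrightarrow> \<bar>F \<theta> - F \<sigma> - b \<sigma> \<bullet> (exp_vec \<theta> - exp_vec \<sigma>)\<bar> \<le> N * exp_dist2 \<sigma> \<theta>"
      by metis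
    have Fb: "\<bar>F \<theta>\<bar> \<le> N" if "\<theta> \<in> \<Theta>" for \<theta> using b(2) S_nonempty that by blast
    define LF where "LF \<theta> = (\<Sum>\<sigma>\<in>S. F \<sigma> * bump \<sigma> \<theta> + (\<Sum>l\<in>UNIV. b \<sigma> $ l * lin \<sigma> l \<theta>))" for \<theta>
    have LF_eq: "LF \<theta> = (\<Sum>\<sigma>\<in>S. (F \<sigma> + b \<sigma> \<bullet> (exp_vec \<theta> - exp_vec \<sigma>)) * bump \<sigma> \<theta>)" for \<theta>
      unfolding LF_def by (intro sum.cong refl) (simp add: lin_def inner_vec_def exp_vec_def distrib_right sum_distrib_right mult.assoc)
    have LF_poly: "LF \<in> exp_polynomials"
    proof -
      have "(\<lambda>\<theta>. LF \<theta>) \<in> exp_polynomials" unfolding LF_def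
        by (intro exp_polynomials_sum exp_polynomials.add exp_polynomials.scale bump_poly lin_poly S_finite finite)
      then show ?thesis .
    qed
    have rem: "\<bar>F \<theta> - LF \<theta>\<bar> \<le> N * (D1 + card S * D2) * vanishing \<theta>" if t: "\<theta> \<in> \<Theta>" for \<theta>
    proof -
      have eq: "F \<theta> - LF \<theta> = F \<theta> * (1 - (\<Sum>\<sigma>\<in>S. bump \<sigma> \<theta>)) +
          (\<Sum>\<sigma>\<in>S. (F \<theta> - F \<sigma> - b \<sigma> \<bullet> (exp_vec \<theta> - exp_vec \<sigma>)) * bump \<sigma> \<theta>)"
        by (simp add: LF_eq sum_distrib_left algebra_simps sum.distrib sum_subtractf)
      have "\<bar>F \<theta> - LF \<theta>\<bar> \<le> \<bar>F \<theta>\<bar> * \<bar>1 - (\<Sum>\<sigma>\<in>S. bump \<sigma> \<theta>)\<bar> +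
          (\<Sum>\<sigma>\<in>S. \<bar>F \<theta> - F \<sigma> - b \<sigma> \<bullet> (exp_vec \<theta> - exp_vec \<sigma>)\<bar> * \<bar>bump \<sigma> \<theta>\<bar>)"
        unfolding eq abs_mult[symmetric] by (rule order_trans[OF abs_triangle_ineq]) (intro add_mono order_refl sum_abs)
      also have "\<dots> \<le> N * (D1 * vanishing \<theta>) + (\<Sum>\<sigma>\<in>S. N * (D2 * vanishing \<theta>))"
      proof (intro add_mono sum_mono)
        show "\<bar>F \<theta>\<bar> * \<bar>1 - (\<Sum>\<sigma>\<in>S. bump \<sigma> \<theta>)\<bar> \<le> N * (D1 * vanishing \<theta>)"
          by (intro mult_mono Fb D1 t N) simp
        fix \<sigma> assume \<sigma>: "\<sigma> \<in> S"
        have "\<bar>F \<theta> - F \<sigma> - b \<sigma> \<bullet> (exp_vec \<theta> - exp_vec \<sigma>)\<bar> * \<bar>bump \<sigma> \<theta>\<bar> \<le> (N * exp_dist2 \<sigma> \<theta>) * \<bar>bump \<sigma> \<theta>\<bar>"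
          by (intro mult_right_mono b \<sigma> t) simp
        also have "\<dots> = N * (\<bar>bump \<sigma> \<theta>\<bar> * exp_dist2 \<sigma> \<theta>)" by simp
        also have "\<dots> \<le> N * (D2 * vanishing \<theta>)" by (intro mult_left_mono D2 \<sigma> t N)
        finally show "\<bar>F \<theta> - F \<sigma> - b \<sigma> \<bullet> (exp_vec \<theta> - exp_vec \<sigma>)\<bar> * \<bar>bump \<sigma> \<theta>\<bar> \<le> N * (D2 * vanishing \<theta>)" .
      qed
      also have "\<dots> = N * (D1 + card S * D2) * vanishing \<theta>" by (simp add: algebra_simps)
      finally show ?thesis .
    qed
    show ?thesis unfolding dual_bound_def
    proof (intro conjI ballI impI)
      show "C * N \<ge> 0" using Cnn N by simp
      fix g assume g: "g \<in> mixing_measures \<Theta>" and i: "integrable true_law (\<lambda>x. (rel_dev g x)\<^sup>2)" and s: "chi g > 0"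
      let ?\<Delta> = "\<lambda>G. (LINT \<theta>|g. G \<theta>) - (LINT \<theta>|g0. G \<theta>)"
      have db: "\<bar>?\<Delta> G\<bar> \<le> c * chi g" if "dual_bound G c" for G c using that g i s by (auto simp: dual_bound_def)
      note ints = exp_polynomials_integrable[OF _ g] exp_polynomials_integrable[OF _ g0]
      have iF: "integrable g F" "integrable g0 F"
        using integrable_bounded_on_parameters[OF g F Fb] integrable_bounded_on_parameters[OF g0 F Fb] by auto
      have [measurable]: "LF \<in> borel_measurable borel" by (rule exp_polynomials_measurable[OF LF_poly])
      have LI: "(LINT \<theta>|h. LF \<theta>) = (\<Sum>\<sigma>\<in>S. F \<sigma> * (LINT \<theta>|h. bump \<sigma> \<theta>) + (\<Sum>l\<in>UNIV. b \<sigma> $ l * (LINT \<theta>|h. lin \<sigma> l \<theta>)))"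
        if "\<And>G. G \<in> exp_polynomials \<Longrightarrow> integrable h G" for h
        unfolding LF_def using that[OF bump_poly] that[OF lin_poly] by simp
      have "\<bar>?\<Delta> LF\<bar> = \<bar>\<Sum>\<sigma>\<in>S. F \<sigma> * ?\<Delta> (bump \<sigma>) + (\<Sum>l\<in>UNIV. b \<sigma> $ l * ?\<Delta> (lin \<sigma> l))\<bar>"
        by (simp add: LI[OF ints(1)] LI[OF ints(2)] sum.distrib sum_subtractf right_diff_distrib)
      also have "\<dots> \<le> (\<Sum>\<sigma>\<in>S. N * (C1 \<sigma> * chi g) + (\<Sum>l\<in>UNIV. N * (C2 \<sigma> l * chi g)))"
      proof (rule order_trans[OF sum_abs], rule sum_mono)
        fix \<sigma> assume \<sigma>: "\<sigma> \<in> S"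
        have "\<bar>F \<sigma> * ?\<Delta> (bump \<sigma>)\<bar> \<le> N * (C1 \<sigma> * chi g)"
          unfolding abs_mult using Fb \<sigma> S_subset N by (intro mult_mono db C1) auto
        moreover have "\<bar>\<Sum>l\<in>UNIV. b \<sigma> $ l * ?\<Delta> (lin \<sigma> l)\<bar> \<le> (\<Sum>l\<in>UNIV. N * (C2 \<sigma> l * chi g))"
        proof (rule order_trans[OF sum_abs], rule sum_mono)
          fix l
          have "\<bar>b \<sigma> $ l\<bar> \<le> N" using component_le_norm_cart[of "b \<sigma>" l] b(1)[OF \<sigma>] by linarith
          then show "\<bar>b \<sigma> $ l * ?\<Delta> (lin \<sigma> l)\<bar> \<le> N * (C2 \<sigma> l * chi g)"
            unfolding abs_mult using N by (intro mult_mono db C2) auto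
        qed
        ultimately show "\<bar>F \<sigma> * ?\<Delta> (bump \<sigma>) + (\<Sum>l\<in>UNIV. b \<sigma> $ l * ?\<Delta> (lin \<sigma> l))\<bar> \<le>
            N * (C1 \<sigma> * chi g) + (\<Sum>l\<in>UNIV. N * (C2 \<sigma> l * chi g))" by linarith
      qed
      also have "\<dots> = (\<Sum>\<sigma>\<in>S. C1 \<sigma> + (\<Sum>l\<in>UNIV. C2 \<sigma> l)) * N * chi g"
        by (simp add: sum_distrib_left sum_distrib_right algebra_simps sum.distrib)
      finally have A: "\<bar>?\<Delta> LF\<bar> \<le> (\<Sum>\<sigma>\<in>S. C1 \<sigma> + (\<Sum>l\<in>UNIV. C2 \<sigma> l)) * N * chi g" .
      \<comment> \<open>On the support of \<open>g0\<close> the interpolation is exact.\<close>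
      have "AE \<theta> in g0. F \<theta> = LF \<theta>"
        using S_AE
      proof eventually_elim
        case (elim \<theta>)
        then show ?case using rem[of \<theta>] S_subset by (auto simp: vanishing_eq_0)
      qed
      then have eq0: "(LINT \<theta>|g0. F \<theta>) = (LINT \<theta>|g0. LF \<theta>)"
        using g0 by (intro integral_cong_AE) (auto simp: mixing_measures_def cong: measurable_cong_sets)
      have "AE \<theta> in g0. vanishing \<theta> = 0" using S_AE by eventually_elim (rule vanishing_eq_0)
      then have v0: "(LINT \<theta>|g0. vanishing \<theta>) = 0" by (intro integral_eq_zero_AE)
      have "\<bar>LINT \<theta>|g. F \<theta> - LF \<theta>\<bar> \<le> (LINT \<theta>|g. N * (D1 + card S * D2) * vanishing \<theta>)"
        using ints(1)[OF vanishing_poly] by (intro abs_integral_le_on_parameters[OF g] rem) auto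
      then have "\<bar>LINT \<theta>|g. F \<theta> - LF \<theta>\<bar> \<le> N * (D1 + card S * D2) * ?\<Delta> vanishing" by (simp add: v0)
      moreover have "N * (D1 + card S * D2) * ?\<Delta> vanishing \<le> N * (D1 + card S * D2) * (C0 * chi g)"
        using db[OF C0] N D1 D2 by (intro mult_left_mono) auto
      ultimately have "\<bar>LINT \<theta>|g. F \<theta> - LF \<theta>\<bar> \<le> N * (D1 + card S * D2) * (C0 * chi g)"
        by (rule order_trans)
      then have "\<bar>(LINT \<theta>|g. F \<theta>) - (LINT \<theta>|g. LF \<theta>)\<bar> \<le> N * (D1 + card S * D2) * (C0 * chi g)"
        using iF ints(1)[OF LF_poly] by simp
      then have "\<bar>?\<Delta> F\<bar> \<le> (\<Sum>\<sigma>\<in>S. C1 \<sigma> + (\<Sum>l\<in>UNIV. C2 \<sigma> l)) * N * chi g + N * (D1 + card S * D2) * (C0 * chi g)"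
        using A unfolding eq0 by linarith
      also have "\<dots> = C * N * chi g" by (simp add: C_def algebra_simps)
      finally show "\<bar>?\<Delta> F\<bar> \<le> C * N * chi g" .
    qed
  qed
  then show ?thesis using Cnn by blast
qed

end

section \<open>Power series of the component densities\<close>

text \<open>
An enumeration of the multi-indices without repetition, which turns multiple series into series over
the natural numbers.
\<close>

definition multi_index :: "nat \<Rightarrow> 'd::finite \<Rightarrow> nat" where
  "multi_index = from_nat_into UNIV"

lemma bij_multi_index: "bij_betw (multi_index :: nat \<Rightarrow> 'd::finite \<Rightarrow> nat) UNIV UNIV"
proof -
  have "infinite (UNIV :: ('d \<Rightarrow> nat) set)" using finite_fun_UNIVD2 by auto
  then show ?thesis unfolding multi_index_def by (intro bij_betw_from_nat_into) auto
qed

lemma product_of_series: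
  fixes f :: "'d::finite \<Rightarrow> nat \<Rightarrow> real"
  assumes "\<And>l. summable (\<lambda>k. \<bar>f l k\<bar>)"
  shows "summable (\<lambda>i. \<bar>\<Prod>l\<in>UNIV. f l (multi_index i l)\<bar>)"
    and "(\<lambda>i. \<Prod>l\<in>UNIV. f l (multi_index i l)) sums (\<Prod>l\<in>UNIV. \<Sum>k. f l k)"
proof -
  have abs: "Infinite_Set_Sum.abs_summable_on (f l) UNIV" for l
    using assms[of l] by (simp add: abs_summable_on_nat_iff')
  have PiE: "PiE (UNIV :: 'd set) (\<lambda>_. UNIV :: nat set) = UNIV" by auto
  have P: "Infinite_Set_Sum.abs_summable_on (\<lambda>g. \<Prod>l\<in>UNIV. f l (g l)) (UNIV :: ('d \<Rightarrow> nat) set)"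
    using abs_summable_on_prod_PiE[of "UNIV :: 'd set" "\<lambda>_. UNIV" f] abs unfolding PiE by auto
  have S: "infsetsum (\<lambda>g. \<Prod>l\<in>UNIV. f l (g l)) (UNIV :: ('d \<Rightarrow> nat) set) = (\<Prod>l\<in>UNIV. infsetsum (f l) UNIV)"
    using infsetsum_prod_PiE[of "UNIV :: 'd set" "\<lambda>_. UNIV" f] abs unfolding PiE by auto
  have N: "Infinite_Set_Sum.abs_summable_on (\<lambda>i. \<Prod>l\<in>UNIV. f l (multi_index i l)) (UNIV :: nat set)"
    using abs_summable_on_reindex_bij_betw[OF bij_multi_index, of "\<lambda>g. \<Prod>l\<in>UNIV. f l (g l)"] P by simp
  then show "summable (\<lambda>i. \<bar>\<Prod>l\<in>UNIV. f l (multi_index i l)\<bar>)" by (simp add: abs_summable_on_nat_iff')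
  show "(\<lambda>i. \<Prod>l\<in>UNIV. f l (multi_index i l)) sums (\<Prod>l\<in>UNIV. \<Sum>k. f l k)"
    using sums_infsetsum_nat'[OF N] infsetsum_reindex_bij_betw[OF bij_multi_index, of "\<lambda>g. \<Prod>l\<in>UNIV. f l (g l)"] S
      infsetsum_nat'[OF abs] by simp
qed

text \<open>
The component density at \<open>x\<close> is the sum over multi-indices \<open>\<alpha>\<close> of
\<open>coefficient B \<alpha> \<theta> * basis_function B \<alpha> x\<close>. In a Gaussian coordinate this is the series of
\<open>exp (\<theta> * x)\<close> in \<open>std_normal_density (x - \<theta>) = std_normal_density x * exp (- \<theta>\<^sup>2 / 2) * exp (\<theta> * x)\<close>;
in a Poisson coordinate only the term with \<open>\<alpha> l = x l\<close> is nonzero. The exponents in \<open>weight\<close> are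
written as products so that the second-order calculus applies directly.
\<close>

definition weight :: "'d::finite set \<Rightarrow> real ^ 'd \<Rightarrow> real" where
  "weight B \<theta> = exp (\<Sum>l\<in>UNIV. if l \<in> B then - (1 / 2) * (\<theta> $ l * \<theta> $ l) else - 1 * \<theta> $ l)"

definition coefficient :: "'d::finite set \<Rightarrow> ('d \<Rightarrow> nat) \<Rightarrow> real ^ 'd \<Rightarrow> real" where
  "coefficient B \<alpha> \<theta> = weight B \<theta> * (\<Prod>l\<in>UNIV. (\<theta> $ l) ^ \<alpha> l)"

definition basis_factor :: "'d::finite set \<Rightarrow> 'd observation \<Rightarrow> 'd \<Rightarrow> nat \<Rightarrow> real" where
  "basis_factor B x l k = (if l \<in> B then (fst x l) ^ k / fact k else if snd x l = k then 1 / fact k else 0)"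

definition basis_function :: "'d::finite set \<Rightarrow> ('d \<Rightarrow> nat) \<Rightarrow> 'd observation \<Rightarrow> real" where
  "basis_function B \<alpha> x = (\<Prod>l\<in>B. std_normal_density (fst x l)) * (\<Prod>l\<in>UNIV. basis_factor B x l (\<alpha> l))"

text \<open>
The envelope bounds the basis functions even after multiplication with \<open>D\<close> to the power of the
degree; the base \<open>2 * D\<close> instead of \<open>D\<close> leaves a geometric factor for summation.
\<close>

definition envelope_factor :: "'d::finite set \<Rightarrow> real \<Rightarrow> 'd observation \<Rightarrow> 'd \<Rightarrow> real" where
  "envelope_factor B D x l = (if l \<in> B then exp (2 * D * \<bar>fst x l\<bar>) else (2 * D) ^ snd x l / fact (snd x l))"

definition envelope :: "'d::finite set \<Rightarrow> real \<Rightarrow> 'd observation \<Rightarrow> real" where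
  "envelope B D x = (\<Prod>l\<in>B. std_normal_density (fst x l)) * (\<Prod>l\<in>UNIV. envelope_factor B D x l)"

lemma basis_factor_le:
  assumes D: "D \<ge> 0"
  shows "D ^ k * \<bar>basis_factor B x l k\<bar> \<le> (1 / 2) ^ k * envelope_factor B D x l"
proof (cases "l \<in> B")
  case True
  have "D ^ k * \<bar>basis_factor B x l k\<bar> = (1 / 2) ^ k * ((2 * D * \<bar>fst x l\<bar>) ^ k / fact k)"
    using True by (simp add: basis_factor_def power_mult_distrib power_abs power_one_over)
  also have "\<dots> \<le> (1 / 2) ^ k * exp (2 * D * \<bar>fst x l\<bar>)"
    using D by (intro mult_left_mono power_over_fact_le_exp) auto
  finally show ?thesis using True by (simp add: envelope_factor_def)
next
  case False
  show ?thesis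
  proof (cases "snd x l = k")
    case True
    with False show ?thesis
      by (simp add: basis_factor_def envelope_factor_def power_mult_distrib power_one_over)
  next
    case neq: False
    with False D show ?thesis by (simp add: basis_factor_def envelope_factor_def)
  qed
qed

lemma basis_function_le:
  assumes D: "D \<ge> 0"
  shows "(\<Prod>l\<in>UNIV. D ^ \<alpha> l) * \<bar>basis_function B \<alpha> x\<bar> \<le> (\<Prod>l\<in>UNIV. (1 / 2) ^ \<alpha> l) * envelope B D x"
proof -
  let ?p = "\<Prod>l\<in>B. std_normal_density (fst x l)"
  have p: "?p \<ge> 0" by (intro prod_nonneg) auto
  have "(\<Prod>l\<in>UNIV. D ^ \<alpha> l) * \<bar>basis_function B \<alpha> x\<bar> = ?p * (\<Prod>l\<in>UNIV. D ^ \<alpha> l * \<bar>basis_factor B x l (\<alpha> l)\<bar>)"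
    using p by (simp add: basis_function_def abs_mult abs_prod prod.distrib)
  also have "\<dots> \<le> ?p * (\<Prod>l\<in>UNIV. (1 / 2) ^ \<alpha> l * envelope_factor B D x l)"
    using D p by (intro mult_left_mono prod_mono) (auto intro: basis_factor_le)
  also have "\<dots> = (\<Prod>l\<in>UNIV. (1 / 2) ^ \<alpha> l) * envelope B D x"
    by (simp add: envelope_def prod.distrib)
  finally show ?thesis .
qed

lemma exp_power_sums: "(\<lambda>k. t ^ k * (y ^ k / fact k)) sums exp (t * y :: real)"
  using exp_converges[of "t * y"] by (simp add: divide_inverse power_mult_distrib mult_ac)

lemma component_density_sums:
  "(\<lambda>i. coefficient B (multi_index i) \<theta> * basis_function B (multi_index i) x) sums component_density B \<theta> x"
proof -
  let ?f = "\<lambda>l k. (\<theta> $ l) ^ k * basis_factor B x l k"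
  have sum1: "?f l sums (if l \<in> B then exp (\<theta> $ l * fst x l) else (\<theta> $ l) ^ snd x l / fact (snd x l))" for l
  proof (cases "l \<in> B")
    case True then show ?thesis using exp_power_sums[of "\<theta> $ l" "fst x l"] by (simp add: basis_factor_def)
  next
    case False
    have "(\<lambda>k. if k = snd x l then (\<theta> $ l) ^ k / fact k else 0) sums ((\<theta> $ l) ^ snd x l / fact (snd x l))"
      by (rule sums_single)
    moreover have "?f l = (\<lambda>k. if k = snd x l then (\<theta> $ l) ^ k / fact k else 0)"
      using False by (auto simp: basis_factor_def)
    ultimately show ?thesis using False by simp
  qed
  have abs: "summable (\<lambda>k. \<bar>?f l k\<bar>)" for l
  proof (cases "l \<in> B")
    case True
    have "(\<lambda>k. \<bar>?f l k\<bar>) = (\<lambda>k. \<bar>\<theta> $ l\<bar> ^ k * (\<bar>fst x l\<bar> ^ k / fact k))"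
      using True by (auto simp: basis_factor_def abs_mult power_abs)
    then show ?thesis using sums_summable[OF exp_power_sums[of "\<bar>\<theta> $ l\<bar>" "\<bar>fst x l\<bar>"]] by simp
  next
    case False
    then show ?thesis by (intro summable_finite[of "{snd x l}"]) (auto simp: basis_factor_def)
  qed
  let ?p = "\<Prod>l\<in>B. std_normal_density (fst x l)"
  have "(\<lambda>i. (weight B \<theta> * ?p) * (\<Prod>l\<in>UNIV. ?f l (multi_index i l))) sums ((weight B \<theta> * ?p) * (\<Prod>l\<in>UNIV. \<Sum>k. ?f l k))"
    by (intro sums_mult product_of_series(2) abs)
  also have "(\<lambda>i. (weight B \<theta> * ?p) * (\<Prod>l\<in>UNIV. ?f l (multi_index i l))) =
      (\<lambda>i. coefficient B (multi_index i) \<theta> * basis_function B (multi_index i) x)"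
    by (simp add: coefficient_def basis_function_def prod.distrib mult_ac)
  also have "(\<Prod>l\<in>UNIV. \<Sum>k. ?f l k) = (\<Prod>l\<in>UNIV. if l \<in> B then exp (\<theta> $ l * fst x l) else (\<theta> $ l) ^ snd x l / fact (snd x l))"
    using sum1 by (simp add: sums_iff)
  also have "\<dots> = (\<Prod>l\<in>B. exp (\<theta> $ l * fst x l)) * (\<Prod>l\<in>- B. (\<theta> $ l) ^ snd x l / fact (snd x l))"
    by (subst prod.If_cases) (auto simp: Collect_neg_eq)
  also have "weight B \<theta> = (\<Prod>l\<in>B. exp (- (1 / 2) * (\<theta> $ l * \<theta> $ l))) * (\<Prod>l\<in>- B. exp (- (\<theta> $ l)))"
    unfolding weight_def exp_sum[OF finite] if_distrib[of exp]
    by (subst prod.If_cases) (auto simp: Collect_neg_eq)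
  also have "((\<Prod>l\<in>B. exp (- (1 / 2) * (\<theta> $ l * \<theta> $ l))) * (\<Prod>l\<in>- B. exp (- (\<theta> $ l))) * ?p) *
       ((\<Prod>l\<in>B. exp (\<theta> $ l * fst x l)) * (\<Prod>l\<in>- B. (\<theta> $ l) ^ snd x l / fact (snd x l))) =
     (\<Prod>l\<in>B. exp (- (1 / 2) * (\<theta> $ l * \<theta> $ l)) * std_normal_density (fst x l) * exp (\<theta> $ l * fst x l)) *
     (\<Prod>l\<in>- B. (\<theta> $ l) ^ snd x l / fact (snd x l) * exp (- (\<theta> $ l)))"
    by (simp only: prod.distrib mult_ac)
  also have "\<dots> = component_density B \<theta> x"
    unfolding component_density_def
    by (intro arg_cong2[where f="(*)"] prod.cong refl)
      (simp add: std_normal_density_def mult_exp_exp power2_eq_square field_simps)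
  finally show ?thesis .
qed

lemma basis_function_measurable [measurable]: "basis_function B \<alpha> \<in> borel_measurable (base_measure B)"
proof -
  have "basis_function B \<alpha> = (\<lambda>x. (\<Prod>l\<in>B. std_normal_density (fst x l) * ((fst x l) ^ \<alpha> l / fact (\<alpha> l))) *
      (\<Prod>l\<in>- B. if snd x l = \<alpha> l then 1 / fact (\<alpha> l) else 0))"
    unfolding basis_function_def[abs_def] basis_factor_def
    by (subst prod.If_cases) (auto simp: Collect_neg_eq prod.distrib mult_ac simp del: times_divide_eq_left times_divide_eq_right)
  then show ?thesis
    using borel_measurable_base_product[where f="\<lambda>l y. std_normal_density y * (y ^ \<alpha> l / fact (\<alpha> l))"
       and h="\<lambda>l n. if n = \<alpha> l then 1 / fact (\<alpha> l) else 0" and B=B] by simp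
qed

lemma envelope_eq:
  "envelope B D x = (\<Prod>l\<in>B. std_normal_density (fst x l) * exp (2 * D * \<bar>fst x l\<bar>)) *
      (\<Prod>l\<in>- B. (2 * D) ^ snd x l / fact (snd x l))"
  unfolding envelope_def envelope_factor_def
  by (subst prod.If_cases) (auto simp: Collect_neg_eq prod.distrib mult_ac)

lemma envelope_measurable [measurable]: "envelope B D \<in> borel_measurable (base_measure B)"
  unfolding envelope_eq[abs_def]
  by (rule borel_measurable_base_product[where h="\<lambda>l n. (2 * D) ^ n / fact n"]) measurable

text \<open>
The quotient \<open>std_normal_density y ^ 4 / std_normal_density (y - t) ^ 3\<close> is a multiple of the
Gaussian density with mean \<open>- 3 * t\<close>, which integrates every exponential.
\<close>

lemma gaussian_envelope_integral_finite:
  "(\<integral>\<^sup>+y. ennreal ((std_normal_density y * exp (2 * D * \<bar>y\<bar>)) ^ 4 / std_normal_density (y - t) ^ 3) \<partial>lborel) < \<infinity>"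
proof -
  \<comment> \<open>A dominating function for each sign of \<open>y\<close>, in the form of the moment generating function.\<close>
  let ?e = "\<lambda>a y. exp (a\<^sup>2 / 2 + 6 * t\<^sup>2) * (exp (a * y - a\<^sup>2 / 2) * std_normal_density (y - (- 3 * t)))"
  have bound: "(std_normal_density y * exp (2 * D * \<bar>y\<bar>)) ^ 4 / std_normal_density (y - t) ^ 3 \<le> ?e (8 * D) y + ?e (- (8 * D)) y" for y
  proof -
    let ?c = "1 / sqrt (2 * pi)"
    have c: "?c > 0" by simp
    have e4: "std_normal_density y ^ 4 = ?c ^ 4 * exp (- 2 * y\<^sup>2)"
      by (simp add: std_normal_density_def power_mult_distrib exp_of_nat_mult[symmetric] power_divide)
    have e3: "std_normal_density (y - t) ^ 3 = ?c ^ 3 * exp (- 3 * (y - t)\<^sup>2 / 2)"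
      by (simp add: std_normal_density_def power_mult_distrib exp_of_nat_mult[symmetric] power_divide)
    have "std_normal_density y ^ 4 / std_normal_density (y - t) ^ 3 = ?c * (exp (- 2 * y\<^sup>2) / exp (- 3 * (y - t)\<^sup>2 / 2))"
      unfolding e4 e3 using c by (simp add: field_simps power_numeral_reduce)
    also have "exp (- 2 * y\<^sup>2) / exp (- 3 * (y - t)\<^sup>2 / 2) = exp (6 * t\<^sup>2) * exp (- (y - (- 3 * t))\<^sup>2 / 2)"
      by (simp add: exp_diff[symmetric] mult_exp_exp power2_eq_square field_simps)
    finally have main: "std_normal_density y ^ 4 / std_normal_density (y - t) ^ 3 = exp (6 * t\<^sup>2) * std_normal_density (y - (- 3 * t))"
      by (simp add: std_normal_density_def)
    have "(std_normal_density y * exp (2 * D * \<bar>y\<bar>)) ^ 4 / std_normal_density (y - t) ^ 3 =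
        (std_normal_density y ^ 4 / std_normal_density (y - t) ^ 3) * exp (8 * D * \<bar>y\<bar>)"
      by (simp add: power_mult_distrib exp_of_nat_mult[symmetric])
    also have "\<dots> \<le> (exp (6 * t\<^sup>2) * std_normal_density (y - (- 3 * t))) * (exp (8 * D * y) + exp (- (8 * D) * y))"
      unfolding main by (intro mult_left_mono) (auto simp: abs_if)
    also have "\<dots> = ?e (8 * D) y + ?e (- (8 * D)) y"
    proof -
      have r: "?e a y = (exp (6 * t\<^sup>2) * std_normal_density (y - (- 3 * t))) * exp (a * y)" for a
      proof -
        have "exp (a\<^sup>2 / 2 + 6 * t\<^sup>2) * exp (a * y - a\<^sup>2 / 2) = exp (6 * t\<^sup>2) * exp (a * y)"
          by (simp add: mult_exp_exp)
        then show ?thesis by (simp only: mult.assoc[symmetric]) (simp only: mult_ac)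
      qed
      show ?thesis unfolding r by (simp only: distrib_left)
    qed
    finally show ?thesis .
  qed
  have fin: "(\<integral>\<^sup>+y. ennreal (?e a y) \<partial>lborel) < \<infinity>" for a
  proof -
    have "(\<integral>\<^sup>+y. ennreal (?e a y) \<partial>lborel) = (\<integral>\<^sup>+y. ennreal (exp (a\<^sup>2 / 2 + 6 * t\<^sup>2)) * ennreal (exp (a * y - a\<^sup>2 / 2) * std_normal_density (y - (- 3 * t))) \<partial>lborel)"
      by (intro nn_integral_cong ennreal_mult) auto
    also have "\<dots> = ennreal (exp (a\<^sup>2 / 2 + 6 * t\<^sup>2)) * ennreal (exp (a * (- 3 * t)))"
      by (subst nn_integral_cmult, measurable, subst nn_integral_exp_std_normal, rule refl)
    finally show ?thesis by (simp add: ennreal_mult_less_top)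
  qed
  have "(\<integral>\<^sup>+y. ennreal ((std_normal_density y * exp (2 * D * \<bar>y\<bar>)) ^ 4 / std_normal_density (y - t) ^ 3) \<partial>lborel) \<le>
      (\<integral>\<^sup>+y. ennreal (?e (8 * D) y) + ennreal (?e (- (8 * D)) y) \<partial>lborel)"
  proof (rule nn_integral_mono)
    fix y
    have "ennreal (?e (8 * D) y) + ennreal (?e (- (8 * D)) y) = ennreal (?e (8 * D) y + ?e (- (8 * D)) y)"
      by (rule ennreal_plus[symmetric]) auto
    with bound[of y] show "ennreal ((std_normal_density y * exp (2 * D * \<bar>y\<bar>)) ^ 4 / std_normal_density (y - t) ^ 3) \<le>
       ennreal (?e (8 * D) y) + ennreal (?e (- (8 * D)) y)" by (simp only: ennreal_leI)
  qed
  also have "\<dots> = (\<integral>\<^sup>+y. ennreal (?e (8 * D) y) \<partial>lborel) + (\<integral>\<^sup>+y. ennreal (?e (- (8 * D)) y) \<partial>lborel)"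
    by (rule nn_integral_add) measurable
  also have "\<dots> < \<infinity>" using fin[of "8 * D"] fin[of "- (8 * D)"] by simp
  finally show ?thesis .
qed

text \<open>
One factorial survives in the quotient, so the sum is an exponential series.
\<close>

lemma poisson_envelope_integral_finite:
  assumes "t > 0"
  shows "(\<integral>\<^sup>+n. ennreal ((a ^ n / fact n) ^ 4 / (t ^ n / fact n * exp (- t)) ^ 3) \<partial>count_space UNIV) < \<infinity>"
proof -
  let ?z = "a ^ 4 / t ^ 3"
  have z: "?z \<ge> 0" using assms by simp
  have "(a ^ n / fact n) ^ 4 / (t ^ n / fact n * exp (- t)) ^ 3 = exp (3 * t) * (?z ^ n / fact n)" for n
  proof -
    have e: "exp (- t) ^ 3 = 1 / exp (3 * t)"
      using exp_of_nat_mult[of 3 "- t"] by (simp add: exp_minus inverse_eq_divide)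
    have p: "(a ^ n) ^ 4 = (a ^ 4) ^ n" "(t ^ n) ^ 3 = (t ^ 3) ^ n" by (simp_all add: power_mult[symmetric] mult.commute)
    show ?thesis
      unfolding power_mult_distrib power_divide e p using assms by (simp add: field_simps power_numeral_reduce)
  qed
  then have "ennreal ((a ^ n / fact n) ^ 4 / (t ^ n / fact n * exp (- t)) ^ 3) = ennreal (exp (3 * t)) * ennreal (?z ^ n / fact n)" for n
    using z by (simp only:) (rule ennreal_mult, auto)
  then have "(\<integral>\<^sup>+n. ennreal ((a ^ n / fact n) ^ 4 / (t ^ n / fact n * exp (- t)) ^ 3) \<partial>count_space UNIV) =
     (\<integral>\<^sup>+n. ennreal (exp (3 * t)) * ennreal (?z ^ n / fact n) \<partial>count_space UNIV)"
    by (simp only:)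
  also have "\<dots> = ennreal (exp (3 * t)) * ennreal (exp ?z)"
    using z by (subst nn_integral_cmult) (auto simp: nn_integral_power_over_fact)
  finally show ?thesis by (simp add: ennreal_mult_less_top)
qed

lemma envelope_integral_finite:
  fixes B :: "'d::finite set"
  assumes pos: "\<And>l. l \<notin> B \<Longrightarrow> 0 < \<sigma> $ l" and D: "D \<ge> 0"
  shows "(\<integral>\<^sup>+x. ennreal (envelope B D x ^ 4 / component_density B \<sigma> x ^ 3) \<partial>base_measure B) < \<infinity>"
proof -
  let ?f = "\<lambda>l y. (std_normal_density y * exp (2 * D * \<bar>y\<bar>)) ^ 4 / std_normal_density (y - \<sigma> $ l) ^ 3"
  let ?h = "\<lambda>l n. ((2 * D) ^ n / fact n) ^ 4 / ((\<sigma> $ l) ^ n / fact n * exp (- (\<sigma> $ l))) ^ 3"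
  have quotient: "(\<Prod>i\<in>A. u i ^ 4 / v i ^ 3) = (\<Prod>i\<in>A. u i) ^ 4 / (\<Prod>i\<in>A. v i) ^ 3" for A and u v :: "'d \<Rightarrow> real"
    by (simp only: prod_dividef prod_power_distrib)
  have "envelope B D x ^ 4 / component_density B \<sigma> x ^ 3 = (\<Prod>l\<in>B. ?f l (fst x l)) * (\<Prod>l\<in>- B. ?h l (snd x l))" for x
    unfolding envelope_eq component_density_def power_mult_distrib[of "prod _ _"] quotient
    by (simp only: times_divide_times_eq)
  then have "(\<integral>\<^sup>+x. ennreal (envelope B D x ^ 4 / component_density B \<sigma> x ^ 3) \<partial>base_measure B) =
     (\<Prod>l\<in>B. \<integral>\<^sup>+y. ennreal (?f l y) \<partial>lborel) * (\<Prod>l\<in>- B. \<integral>\<^sup>+n. ennreal (?h l n) \<partial>count_space UNIV)"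
    using pos D by (simp only:) (rule nn_integral_base_measure_real_product, auto simp: less_imp_le)
  also have "\<dots> < \<infinity>"
  proof -
    have ennreal_prod_less_top: "(\<Prod>i\<in>A. u i) < (\<top> :: ennreal)" if "\<And>i. i \<in> A \<Longrightarrow> u i < \<top>" for A :: "'d set" and u
      using finite[of A] that by (induction A rule: finite_induct) (auto simp: ennreal_mult_less_top)
    have "(\<Prod>l\<in>B. \<integral>\<^sup>+y. ennreal (?f l y) \<partial>lborel) < \<top>"
      using gaussian_envelope_integral_finite by (intro ennreal_prod_less_top) simp
    moreover have "(\<Prod>l\<in>- B. \<integral>\<^sup>+n. ennreal (?h l n) \<partial>count_space UNIV) < \<top>"
    proof (rule ennreal_prod_less_top)
      fix l assume "l \<in> - B"
      then have "l \<notin> B" by simp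
      from poisson_envelope_integral_finite[OF pos[OF this], of "2 * D"]
      show "(\<integral>\<^sup>+n. ennreal (?h l n) \<partial>count_space UNIV) < \<top>" by (simp only: infinity_ennreal_def)
    qed
    ultimately show ?thesis by (simp add: ennreal_mult_less_top)
  qed
  finally show ?thesis .
qed

section \<open>Bounded chi-square divergence under finite support\<close>

lemma abs_exp_minus_one_le: "\<bar>exp y - 1\<bar> \<le> \<bar>y\<bar> * exp \<bar>y\<bar>" for y :: real
proof (cases "y \<ge> 0")
  case True
  have "1 - y \<le> exp (- y)" using exp_ge_add_one_self[of "- y"] by simp
  then have "(1 - y) * exp y \<le> exp (- y) * exp y" by (intro mult_right_mono) auto
  then have "exp y - y * exp y \<le> 1" by (simp add: mult_exp_exp algebra_simps)
  then show ?thesis using True by simp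
next
  case False
  have "1 + y \<le> exp y" by (rule exp_ge_add_one_self)
  moreover have "- y * 1 \<le> - y * exp (- y)" using False by (intro mult_left_mono) auto
  moreover have "\<bar>exp y - 1\<bar> = 1 - exp y" "\<bar>y\<bar> = - y" using False by auto
  ultimately show ?thesis by (simp only: mult_1_right)
qed

lemma exp_second_order: "\<bar>exp y - 1 - y\<bar> \<le> y\<^sup>2 * exp \<bar>y\<bar>" for y :: real
proof -
  have "1 - y \<le> exp (- y)" using exp_ge_add_one_self[of "- y"] by simp
  then have "(1 - y) * exp y \<le> exp (- y) * exp y" by (intro mult_right_mono) auto
  then have "exp y - 1 - y \<le> y * (exp y - 1)" by (simp add: mult_exp_exp algebra_simps)
  also have "\<dots> \<le> \<bar>y\<bar> * \<bar>exp y - 1\<bar>" by (metis abs_ge_self abs_mult)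
  also have "\<dots> \<le> \<bar>y\<bar> * (\<bar>y\<bar> * exp \<bar>y\<bar>)" by (intro mult_left_mono abs_exp_minus_one_le) simp
  also have "\<dots> = y\<^sup>2 * exp \<bar>y\<bar>" by (simp add: power2_eq_square)
  finally have le: "exp y - 1 - y \<le> y\<^sup>2 * exp \<bar>y\<bar>" .
  have "0 \<le> exp y - 1 - y" using exp_ge_add_one_self[of y] by linarith
  then show ?thesis using le by (simp only: abs_of_nonneg)
qed

lemma log_second_order: "\<bar>y - (exp y - 1)\<bar> \<le> exp (- y) * (exp y - 1)\<^sup>2" for y :: real
proof -
  have "1 - y \<le> exp (- y)" using exp_ge_add_one_self[of "- y"] by simp
  moreover have "exp (- y) * (exp y - 1)\<^sup>2 = exp y - 2 + exp (- y)"
    by (simp add: power2_eq_square algebra_simps mult_exp_exp)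
  moreover have "\<bar>y - (exp y - 1)\<bar> = exp y - 1 - y"
    using exp_ge_add_one_self[of y] by (subst abs_minus_commute, intro trans[OF abs_of_nonneg]) linarith+
  ultimately show ?thesis by linarith
qed

context parameter_space begin

text \<open>
As a function of \<open>exp (\<theta> $ l)\<close> the coordinate is a logarithm, whose second-order Taylor remainder is
bounded on bounded sets.
\<close>

lemma jet_coordinate:
  assumes \<sigma>: "\<sigma> \<in> \<Theta>"
  shows "\<exists>N. jet \<sigma> (\<lambda>\<theta>. \<theta> $ l) N"
proof -
  obtain R where R: "R > 0" "\<And>\<theta> l. \<theta> \<in> \<Theta> \<Longrightarrow> \<bar>\<theta> $ l\<bar> \<le> R" using coordinates_bounded by blast
  let ?N = "R + exp (4 * R)"
  have RN: "exp R \<le> ?N" using R by (simp add: add_increasing)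
  have "jet \<sigma> (\<lambda>\<theta>. \<theta> $ l) ?N"
    unfolding jet_def
  proof (intro exI[of _ "exp (- (\<sigma> $ l)) *\<^sub>R axis l 1"] conjI ballI)
    have "exp (- (\<sigma> $ l)) \<le> exp R" using R(2)[OF \<sigma>, of l] by (simp add: abs_le_iff)
    from order_trans[OF this RN]
    show "norm (exp (- (\<sigma> $ l)) *\<^sub>R (axis l 1 :: real ^ 'd)) \<le> ?N" by (simp add: norm_axis_1)
    fix \<theta> assume t: "\<theta> \<in> \<Theta>"
    show "\<bar>\<theta> $ l\<bar> \<le> ?N" using R(2)[OF t, of l] by (simp add: add_increasing2)
    define y where "y = \<theta> $ l - \<sigma> $ l"
    have yR: "\<bar>y\<bar> \<le> 2 * R" using R(2)[OF t, of l] R(2)[OF \<sigma>, of l] by (simp add: y_def)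
    have e: "exp (- (\<sigma> $ l)) * (exp (\<theta> $ l) - exp (\<sigma> $ l)) = exp y - 1"
      by (simp add: y_def right_diff_distrib mult_exp_exp)
    have "\<bar>\<theta> $ l - \<sigma> $ l - (exp (- (\<sigma> $ l)) *\<^sub>R axis l 1) \<bullet> (exp_vec \<theta> - exp_vec \<sigma>)\<bar> = \<bar>y - (exp y - 1)\<bar>"
      using e by (simp add: inner_axis' exp_vec_def y_def)
    also have "\<dots> \<le> exp (- y) * (exp y - 1)\<^sup>2" by (rule log_second_order)
    also have "(exp y - 1)\<^sup>2 = exp (- 2 * \<sigma> $ l) * (exp (\<theta> $ l) - exp (\<sigma> $ l))\<^sup>2"
      unfolding e[symmetric] by (simp add: power_mult_distrib exp_double[symmetric])
    also have "exp (- y) * (exp (- 2 * \<sigma> $ l) * (exp (\<theta> $ l) - exp (\<sigma> $ l))\<^sup>2) =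
        exp (- y - 2 * \<sigma> $ l) * (exp (\<theta> $ l) - exp (\<sigma> $ l))\<^sup>2"
      by (simp add: mult_exp_exp)
    also have "\<dots> \<le> exp (4 * R) * (exp (\<theta> $ l) - exp (\<sigma> $ l))\<^sup>2"
      using yR R(2)[OF \<sigma>, of l] by (intro mult_right_mono) (auto simp: abs_le_iff)
    also have "\<dots> \<le> exp (4 * R) * exp_dist2 \<sigma> \<theta>"
    proof (rule mult_left_mono)
      have "(exp (\<theta> $ l) - exp (\<sigma> $ l))\<^sup>2 \<le> (\<Sum>l\<in>UNIV. (exp (\<theta> $ l) - exp (\<sigma> $ l))\<^sup>2)"
        by (rule member_le_sum) auto
      then show "(exp (\<theta> $ l) - exp (\<sigma> $ l))\<^sup>2 \<le> exp_dist2 \<sigma> \<theta>" by (simp add: exp_dist2_eq power2_eq_square)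
    qed simp
    also have "\<dots> \<le> ?N * exp_dist2 \<sigma> \<theta>" using R by (intro mult_right_mono exp_dist2_nonneg) auto
    finally show "\<bar>\<theta> $ l - \<sigma> $ l - (exp (- (\<sigma> $ l)) *\<^sub>R axis l 1) \<bullet> (exp_vec \<theta> - exp_vec \<sigma>)\<bar> \<le> ?N * exp_dist2 \<sigma> \<theta>" .
  qed
  then show ?thesis ..
qed

lemma jet_exp:
  assumes F: "jet \<sigma> F N" and \<sigma>: "\<sigma> \<in> \<Theta>"
  shows "\<exists>N'. jet \<sigma> (\<lambda>\<theta>. exp (F \<theta>)) N'"
proof -
  obtain b where b: "norm b \<le> N" "\<forall>\<theta>\<in>\<Theta>. \<bar>F \<theta>\<bar> \<le> N \<and> \<bar>F \<theta> - F \<sigma> - b \<bullet> (exp_vec \<theta> - exp_vec \<sigma>)\<bar> \<le> N * exp_dist2 \<sigma> \<theta>"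
    using F by (auto simp: jet_def)
  have N: "N \<ge> 0" by (rule jet_nonneg[OF F])
  define lip where "lip = N * (1 + exp_diameter)"
  define A where "A = exp N * (lip\<^sup>2 * exp (2 * N) + N)"
  define N' where "N' = exp N + exp N * N + A"
  have A: "A \<ge> 0" using N by (simp add: A_def)
  have F\<sigma>: "\<bar>F \<sigma>\<bar> \<le> N" using b(2) \<sigma> by auto
  then have e\<sigma>: "exp (F \<sigma>) \<le> exp N" by simp
  have "jet \<sigma> (\<lambda>\<theta>. exp (F \<theta>)) N'"
    unfolding jet_def
  proof (intro exI[of _ "exp (F \<sigma>) *\<^sub>R b"] conjI ballI)
    have "norm (exp (F \<sigma>) *\<^sub>R b) \<le> exp N * N" using e\<sigma> b(1) by (simp add: mult_mono)
    then show "norm (exp (F \<sigma>) *\<^sub>R b) \<le> N'" using A exp_ge_zero[of N] unfolding N'_def by linarith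
    fix \<theta> assume t: "\<theta> \<in> \<Theta>"
    have Ft: "\<bar>F \<theta>\<bar> \<le> N" using b(2) t by auto
    then show "\<bar>exp (F \<theta>)\<bar> \<le> N'" using A N unfolding N'_def
      by (simp add: abs_le_iff) (smt (verit) exp_gt_zero exp_le_cancel_iff mult_nonneg_nonneg)
    let ?d = "exp_vec \<theta> - exp_vec \<sigma>"
    define y where "y = F \<theta> - F \<sigma>"
    have y1: "\<bar>y\<bar> \<le> 2 * N" using Ft F\<sigma> by (simp add: y_def)
    have "\<bar>y\<bar> \<le> lip * norm ?d" using jet_lipschitz[OF F \<sigma> t] by (simp add: y_def lip_def)
    then have y2: "y\<^sup>2 \<le> lip\<^sup>2 * exp_dist2 \<sigma> \<theta>"
      using power_mono[of "\<bar>y\<bar>" "lip * norm ?d" 2] by (simp add: exp_dist2_def power_mult_distrib)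
    have y3: "\<bar>exp y - 1 - b \<bullet> ?d\<bar> \<le> \<bar>exp y - 1 - y\<bar> + \<bar>y - b \<bullet> ?d\<bar>" by linarith
    have "\<bar>exp y - 1 - y\<bar> \<le> (lip\<^sup>2 * exp_dist2 \<sigma> \<theta>) * exp (2 * N)"
      by (rule order_trans[OF exp_second_order]) (use y1 y2 exp_dist2_nonneg in \<open>auto intro!: mult_mono mult_nonneg_nonneg\<close>)
    moreover have "\<bar>y - b \<bullet> ?d\<bar> \<le> N * exp_dist2 \<sigma> \<theta>" using b(2) t by (simp add: y_def)
    ultimately have y4: "\<bar>exp y - 1 - b \<bullet> ?d\<bar> \<le> (lip\<^sup>2 * exp (2 * N) + N) * exp_dist2 \<sigma> \<theta>"
      using y3 by (simp add: algebra_simps)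
    have "exp (F \<theta>) - exp (F \<sigma>) - (exp (F \<sigma>) *\<^sub>R b) \<bullet> ?d = exp (F \<sigma>) * (exp y - 1 - b \<bullet> ?d)"
      by (simp add: y_def right_diff_distrib mult_exp_exp)
    then have "\<bar>exp (F \<theta>) - exp (F \<sigma>) - (exp (F \<sigma>) *\<^sub>R b) \<bullet> ?d\<bar> = exp (F \<sigma>) * \<bar>exp y - 1 - b \<bullet> ?d\<bar>"
      by (simp add: abs_mult)
    also have "\<dots> \<le> exp N * ((lip\<^sup>2 * exp (2 * N) + N) * exp_dist2 \<sigma> \<theta>)"
      using y4 e\<sigma> by (intro mult_mono) auto
    also have "\<dots> = A * exp_dist2 \<sigma> \<theta>" by (simp add: A_def)
    also have "\<dots> \<le> N' * exp_dist2 \<sigma> \<theta>" using N by (intro mult_right_mono exp_dist2_nonneg) (simp add: N'_def)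
    finally show "\<bar>exp (F \<theta>) - exp (F \<sigma>) - (exp (F \<sigma>) *\<^sub>R b) \<bullet> ?d\<bar> \<le> N' * exp_dist2 \<sigma> \<theta>" .
  qed
  then show ?thesis ..
qed

lemma jet_weight:
  assumes \<sigma>: "\<sigma> \<in> \<Theta>"
  shows "\<exists>N. jet \<sigma> (weight B) N"
proof -
  have c: "\<exists>N. jet \<sigma> (\<lambda>\<theta>. c * \<theta> $ l) N" for c l
    using jet_coordinate[OF \<sigma>] jet_mult[OF jet_const _ \<sigma>] by blast
  have c2: "\<exists>N. jet \<sigma> (\<lambda>\<theta>. c * (\<theta> $ l * \<theta> $ l)) N" for c l
    using jet_coordinate[OF \<sigma>, of l] jet_mult[OF jet_const _ \<sigma>] jet_mult[OF _ _ \<sigma>] by blast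
  have term1: "\<exists>N. jet \<sigma> (\<lambda>\<theta>. if l \<in> B then - (1 / 2) * (\<theta> $ l * \<theta> $ l) else - 1 * \<theta> $ l) N" for l
    using c2[of "- (1 / 2)" l] c[of "- 1" l] by (cases "l \<in> B") auto
  have "\<exists>N. jet \<sigma> (\<lambda>\<theta>. \<Sum>l\<in>A. if l \<in> B then - (1 / 2) * (\<theta> $ l * \<theta> $ l) else - 1 * \<theta> $ l) N" if "finite A" for A
    using that
  proof (induction A rule: finite_induct)
    case empty then show ?case using jet_const[of \<sigma> 0] by auto
  next
    case (insert l A)
    obtain N1 N2 where "jet \<sigma> (\<lambda>\<theta>. if l \<in> B then - (1 / 2) * (\<theta> $ l * \<theta> $ l) else - 1 * \<theta> $ l) N1"
      "jet \<sigma> (\<lambda>\<theta>. \<Sum>l\<in>A. if l \<in> B then - (1 / 2) * (\<theta> $ l * \<theta> $ l) else - 1 * \<theta> $ l) N2"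
      using term1[of l] insert.IH by blast
    from jet_add[OF this] insert.hyps show ?case by (auto simp del: minus_mult_minus)
  qed
  from this[of UNIV] show ?thesis unfolding weight_def[abs_def] using jet_exp[OF _ \<sigma>] by fastforce
qed

lemma jet_monomial:
  assumes \<sigma>: "\<sigma> \<in> \<Theta>" and N: "\<And>l. jet \<sigma> (\<lambda>\<theta>. \<theta> $ l) N"
  shows "jet \<sigma> (\<lambda>\<theta>. \<Prod>l\<in>UNIV. (\<theta> $ l) ^ \<alpha> l) (\<Prod>l\<in>UNIV. ((3 + exp_diameter) * N) ^ \<alpha> l)"
proof -
  let ?D = "(3 + exp_diameter) * N"
  have pow: "jet \<sigma> (\<lambda>\<theta>. G \<theta> * (\<theta> $ l) ^ n) (K * ?D ^ n)" if "jet \<sigma> G K" for l n G K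
  proof (induction n)
    case (Suc n)
    from jet_mult[OF Suc.IH N[of l] \<sigma>] show ?case by (simp add: mult_ac)
  qed (use that in simp)
  have "jet \<sigma> (\<lambda>\<theta>. \<Prod>l\<in>A. (\<theta> $ l) ^ \<alpha> l) (\<Prod>l\<in>A. ?D ^ \<alpha> l)" if "finite A" for A
    using that
  proof (induction A rule: finite_induct)
    case empty then show ?case using jet_const[of \<sigma> 1] by simp
  next
    case (insert l A)
    from pow[OF insert.IH, of l "\<alpha> l"] insert.hyps show ?case by (simp add: mult_ac)
  qed
  then show ?thesis by simp
qed

end

context finitely_supported_truth begin

text \<open>
Uniformly over the finitely many support points, the constants of the coefficients grow at most
exponentially with the degree.
\<close>

lemma jet_coefficients:
  "\<exists>A D. A > 0 \<and> D > 0 \<and> (\<forall>\<alpha>. \<forall>\<sigma>\<in>S. jet \<sigma> (coefficient B \<alpha>) (A * (\<Prod>l\<in>UNIV. D ^ \<alpha> l)))"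
proof -
  obtain N1 where N1: "\<And>\<sigma> l. \<sigma> \<in> S \<Longrightarrow> jet \<sigma> (\<lambda>\<theta>. \<theta> $ l) (N1 \<sigma> l)"
    using jet_coordinate S_subset by (metis subsetD)
  obtain N2 where N2: "\<And>\<sigma>. \<sigma> \<in> S \<Longrightarrow> jet \<sigma> (weight B) (N2 \<sigma>)"
    using jet_weight S_subset by (metis subsetD)
  define M1 where "M1 = (\<Sum>\<sigma>\<in>S. \<Sum>l\<in>UNIV. \<bar>N1 \<sigma> l\<bar>) + 1"
  define M2 where "M2 = (\<Sum>\<sigma>\<in>S. \<bar>N2 \<sigma>\<bar>) + 1"
  have "N1 \<sigma> l \<le> M1" if "\<sigma> \<in> S" for \<sigma> l
  proof -
    have "\<bar>N1 \<sigma> l\<bar> \<le> (\<Sum>l\<in>UNIV. \<bar>N1 \<sigma> l\<bar>)" by (rule member_le_sum) auto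
    also have "\<dots> \<le> (\<Sum>\<sigma>\<in>S. \<Sum>l\<in>UNIV. \<bar>N1 \<sigma> l\<bar>)"
      using that S_finite by (intro member_le_sum[where f="\<lambda>\<sigma>. \<Sum>l\<in>UNIV. \<bar>N1 \<sigma> l\<bar>"]) (auto intro: sum_nonneg)
    finally show ?thesis by (simp add: M1_def)
  qed
  then have j1: "jet \<sigma> (\<lambda>\<theta>. \<theta> $ l) M1" if "\<sigma> \<in> S" for \<sigma> l using jet_mono N1 that by blast
  have "N2 \<sigma> \<le> M2" if "\<sigma> \<in> S" for \<sigma>
    using member_le_sum[of \<sigma> S "\<lambda>\<sigma>. \<bar>N2 \<sigma>\<bar>"] that S_finite by (simp add: M2_def)
  then have j2: "jet \<sigma> (weight B) M2" if "\<sigma> \<in> S" for \<sigma> using jet_mono N2 that by blast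
  have M: "M1 > 0" "M2 > 0" unfolding M1_def M2_def by (simp_all add: add_nonneg_pos sum_nonneg)
  have "jet \<sigma> (coefficient B \<alpha>) ((3 + exp_diameter) * M2 * (\<Prod>l\<in>UNIV. ((3 + exp_diameter) * M1) ^ \<alpha> l))" if "\<sigma> \<in> S" for \<sigma> \<alpha>
    unfolding coefficient_def[abs_def] using that S_subset by (intro jet_mult jet_monomial j1 j2) auto
  moreover have "(3 + exp_diameter) * M2 > 0" "(3 + exp_diameter) * M1 > 0"
    using M exp_diameter(1) by (auto intro!: mult_pos_pos)
  ultimately show ?thesis by blast
qed

lemma coefficient_measurable: "coefficient B \<alpha> \<in> borel_measurable borel"
proof -
  have "continuous_on UNIV (\<lambda>\<theta>::real ^ 'd. if l \<in> B then - (1 / 2) * (\<theta> $ l * \<theta> $ l) else - 1 * \<theta> $ l)" for l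
    by (cases "l \<in> B") (auto intro!: continuous_intros)
  then show ?thesis
    unfolding coefficient_def[abs_def] weight_def by (intro borel_measurable_continuous_onI continuous_intros)
qed

lemma true_density_ge_component: "\<exists>\<sigma>\<in>S. \<exists>w>0. \<forall>x. w * component_density B \<sigma> x \<le> f0 x"
proof -
  interpret prob_space g0 using g0 by (simp add: mixing_measures_def)
  have sets: "sets g0 = sets borel" using g0 by (simp add: mixing_measures_def)
  have fin: "{\<sigma>} \<in> sets g0" for \<sigma> by (simp add: sets)
  have "S \<in> sets g0" using S_finite by (simp add: sets finite_imp_closed)
  then have "prob S = 1" using S_AE prob_eq_1 by simp
  then have "(\<Sum>\<sigma>\<in>S. prob {\<sigma>}) = 1"
    using finite_measure_eq_sum_singleton[OF S_finite, of] fin by simp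
  then obtain \<sigma> where \<sigma>: "\<sigma> \<in> S" "prob {\<sigma>} \<noteq> 0" by (metis (mono_tags, lifting) sum.neutral zero_neq_one)
  then have w: "prob {\<sigma>} > 0" by (simp add: zero_less_measure_iff)
  have "prob {\<sigma>} * component_density B \<sigma> x \<le> f0 x" for x
  proof -
    have "prob {\<sigma>} * component_density B \<sigma> x = (LINT \<theta>|g0. component_density B \<sigma> x * indicator {\<sigma>} \<theta>)"
      using fin by simp
    also have "\<dots> \<le> (LINT \<theta>|g0. component_density B \<theta> x)"
    proof (rule integral_mono_AE)
      show "integrable g0 (\<lambda>\<theta>. component_density B \<sigma> x * indicator {\<sigma>} \<theta>)"
        using fin by (intro integrable_mult_right integrable_indicator) (auto simp: less_top[symmetric])
      show "integrable g0 (\<lambda>\<theta>. component_density B \<theta> x)" by (rule integrable_component[OF g0])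
      show "AE \<theta> in g0. component_density B \<sigma> x * indicator {\<sigma>} \<theta> \<le> component_density B \<theta> x"
        using S_AE
      proof eventually_elim
        case (elim \<theta>)
        then show ?case using S_subset component_nonneg[of \<theta> x] by (cases "\<theta> = \<sigma>") auto
      qed
    qed
    finally show ?thesis by (simp add: mixture_density_def)
  qed
  with \<sigma> w show ?thesis by blast
qed

text \<open>
The true density is at least a multiple of the component of some support point, so the fourth moment
reduces to a product of one-dimensional integrals.
\<close>

lemma envelope_fourth_moment:
  assumes D: "D \<ge> 0"
  shows "integrable true_law (\<lambda>x. (envelope B D x / f0 x) ^ 4)"
proof -
  obtain \<sigma> w where \<sigma>: "\<sigma> \<in> S" "w > 0" "\<And>x. w * component_density B \<sigma> x \<le> f0 x"
    using true_density_ge_component by blast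
  have p: "component_density B \<sigma> x > 0" for x
    by (rule component_density_pos) (use \<sigma> S_subset \<Theta>_pos in auto)
  have le: "f0 x * (envelope B D x / f0 x) ^ 4 \<le> 1 / w ^ 3 * (envelope B D x ^ 4 / component_density B \<sigma> x ^ 3)" for x
  proof -
    have "f0 x * (envelope B D x / f0 x) ^ 4 = envelope B D x ^ 4 / f0 x ^ 3"
      using f0_pos[of x] by (simp add: power_divide power_numeral_reduce field_simps)
    also have "\<dots> \<le> envelope B D x ^ 4 / (w * component_density B \<sigma> x) ^ 3"
      using \<sigma> p[of x] f0_pos[of x] by (intro divide_left_mono power_mono) (auto simp: less_imp_le)
    finally show ?thesis by (simp add: power_mult_distrib)
  qed
  have "integrable \<mu> (\<lambda>x. envelope B D x ^ 4 / component_density B \<sigma> x ^ 3)"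
  proof (rule integrableI_bounded)
    have "(\<integral>\<^sup>+x. ennreal (norm (envelope B D x ^ 4 / component_density B \<sigma> x ^ 3)) \<partial>\<mu>) =
       (\<integral>\<^sup>+x. ennreal (envelope B D x ^ 4 / component_density B \<sigma> x ^ 3) \<partial>\<mu>)"
      using p by (intro nn_integral_cong) (auto simp: less_imp_le abs_of_pos)
    also have "\<dots> < \<infinity>" using \<sigma>(1) S_subset \<Theta>_pos D by (intro envelope_integral_finite) auto
    finally show "(\<integral>\<^sup>+x. ennreal (norm (envelope B D x ^ 4 / component_density B \<sigma> x ^ 3)) \<partial>\<mu>) < \<infinity>" .
  qed measurable
  then have "integrable \<mu> (\<lambda>x. 1 / w ^ 3 * (envelope B D x ^ 4 / component_density B \<sigma> x ^ 3))"
    by (rule integrable_mult_right)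
  then have "integrable \<mu> (\<lambda>x. f0 x * (envelope B D x / f0 x) ^ 4)"
  proof (rule Bochner_Integration.integrable_bound)
    show "AE x in \<mu>. norm (f0 x * (envelope B D x / f0 x) ^ 4) \<le>
        norm (1 / w ^ 3 * (envelope B D x ^ 4 / component_density B \<sigma> x ^ 3))"
    proof (rule AE_I2)
      fix x
      have "0 \<le> f0 x * (envelope B D x / f0 x) ^ 4" using f0_pos[of x] by simp
      then show "norm (f0 x * (envelope B D x / f0 x) ^ 4) \<le>
          norm (1 / w ^ 3 * (envelope B D x ^ 4 / component_density B \<sigma> x ^ 3))"
        unfolding real_norm_def by (simp only: abs_of_nonneg) (rule order_trans[OF le abs_ge_self])
    qed
  qed measurable
  then show ?thesis by (subst integral_true_law) auto
qed


text \<open>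
All relative deviations are series in the same functions of \<open>x\<close>. The coefficients are bounded by a
constant outright, which makes every chi-square divergence finite, and by \<open>chi g\<close> through
\<open>jet_dual_bound\<close>, which puts the normalised deviations into the class of coefficients at most one.
\<close>

lemma relative_expansion:
  "\<exists>K D (R::real). K > 0 \<and> D > 0 \<and>
    (\<forall>g\<in>mixing_measures \<Theta>. \<exists>a. (\<forall>i. \<bar>a i\<bar> \<le> R) \<and>
       (\<forall>x. (\<lambda>i. a i * (K * (\<Prod>l\<in>(UNIV :: 'd set). D ^ multi_index i l) * (basis_function B (multi_index i) x / f0 x))) sums rel_dev g x) \<and>
       (integrable true_law (\<lambda>x. (rel_dev g x)\<^sup>2) \<longrightarrow> chi g > 0 \<longrightarrow> (\<forall>i. \<bar>a i\<bar> \<le> chi g)))"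
proof -
  obtain A D where A: "A > 0" and D: "D > 0"
    and jets: "\<And>\<alpha> \<sigma>. \<sigma> \<in> S \<Longrightarrow> jet \<sigma> (coefficient B \<alpha>) (A * (\<Prod>l\<in>UNIV. D ^ \<alpha> l))"
    using jet_coefficients by blast
  obtain C where C: "C \<ge> 0" and dual: "\<And>F N. F \<in> borel_measurable borel \<Longrightarrow> \<forall>\<sigma>\<in>S. jet \<sigma> F N \<Longrightarrow> dual_bound F (C * N)"
    using jet_dual_bound by blast
  \<comment> \<open>At least \<open>A\<close> for the outright bound, and at least \<open>C * A\<close> for the dual bound.\<close>
  define K where "K = (C + 1) * A"
  have "K > 0" unfolding K_def using A C by (intro mult_pos_pos) auto
  then have K: "K > 0" "C * A \<le> K" "A \<le> K" using A C by (auto simp: K_def algebra_simps)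
  define P where "P i = (\<Prod>l\<in>(UNIV :: 'd set). D ^ multi_index i l)" for i
  have P: "P i > 0" for i unfolding P_def using D by (intro prod_pos) auto
  let ?c = "\<lambda>i. coefficient B (multi_index i)" and ?b = "\<lambda>i. basis_function B (multi_index i)"
  have cle: "\<bar>?c i \<theta>\<bar> \<le> A * P i" if "\<theta> \<in> \<Theta>" for i \<theta>
    using jets[of _ "multi_index i"] S_nonempty that by (fastforce simp: jet_def P_def)
  have summ: "summable (\<lambda>i. A * (P i * \<bar>?b i x\<bar>))" for x
  proof (rule summable_mult, rule summable_comparison_test'[of "\<lambda>i. \<bar>\<Prod>l\<in>(UNIV :: 'd set). (1 / 2 :: real) ^ multi_index i l\<bar> * envelope B D x" 0])
    show "summable (\<lambda>i. \<bar>\<Prod>l\<in>(UNIV :: 'd set). (1 / 2 :: real) ^ multi_index i l\<bar> * envelope B D x)"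
      by (intro summable_mult2 product_of_series(1)) (simp add: summable_geometric)
    fix i
    show "norm (P i * \<bar>?b i x\<bar>) \<le> \<bar>\<Prod>l\<in>(UNIV :: 'd set). (1 / 2 :: real) ^ multi_index i l\<bar> * envelope B D x"
      using basis_function_le[of D "multi_index i" B x] D P[of i]
      by (simp add: P_def abs_mult abs_of_nonneg[OF prod_nonneg] less_imp_le)
  qed
  have expand: "(\<lambda>i. (LINT \<theta>|g. ?c i \<theta>) * ?b i x) sums mixture_density B g x"
    and int_c: "integrable g (?c i)" and abs_c: "\<bar>LINT \<theta>|g. ?c i \<theta>\<bar> \<le> A * P i"
    if g: "g \<in> mixing_measures \<Theta>" for g x i
  proof -
    interpret g: prob_space g using g by (simp add: mixing_measures_def)
    note ic = integrable_bounded_on_parameters[OF g coefficient_measurable cle]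
    show "integrable g (?c i)" by (rule ic)
    have le1: "(LINT \<theta>|g. \<bar>?c i \<theta>\<bar>) \<le> A * P i" for i
    proof -
      have "(LINT \<theta>|g. \<bar>?c i \<theta>\<bar>) \<le> (LINT \<theta>|g. A * P i)"
        using ic g_AE[OF g] cle by (intro integral_mono_AE) (auto elim!: eventually_mono)
      then show ?thesis by (simp add: g.prob_space)
    qed
    then show "\<bar>LINT \<theta>|g. ?c i \<theta>\<bar> \<le> A * P i"
      using integral_abs_bound[of g "?c i"] order_trans by blast
    have "(\<lambda>i. LINT \<theta>|g. ?c i \<theta> * ?b i x) sums (LINT \<theta>|g. (\<Sum>i. ?c i \<theta> * ?b i x))"
    proof (rule sums_integral)
      show "integrable g (\<lambda>\<theta>. ?c i \<theta> * ?b i x)" for i using ic by simp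
      show "AE \<theta> in g. summable (\<lambda>i. norm (?c i \<theta> * ?b i x))"
        using g_AE[OF g]
      proof eventually_elim
        case (elim \<theta>)
        show ?case
          by (rule summable_comparison_test'[OF summ[of x], of 0])
            (use mult_right_mono[OF cle[OF elim], of "\<bar>?b i x\<bar>" for i] in \<open>simp add: abs_mult mult.assoc\<close>)
      qed
      show "summable (\<lambda>i. LINT \<theta>|g. norm (?c i \<theta> * ?b i x))"
        by (rule summable_comparison_test'[OF summ[of x], of 0])
          (use mult_right_mono[OF le1, of "\<bar>?b i x\<bar>" for i] in \<open>simp add: abs_mult mult.assoc\<close>)
    qed
    also have "(\<lambda>\<theta>. (\<Sum>i. ?c i \<theta> * ?b i x)) = (\<lambda>\<theta>. component_density B \<theta> x)"
      using component_density_sums[of B _ x] by (simp add: sums_iff)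
    finally show "(\<lambda>i. (LINT \<theta>|g. ?c i \<theta>) * ?b i x) sums mixture_density B g x"
      by (simp add: mixture_density_def)
  qed
  have "\<exists>a. (\<forall>i. \<bar>a i\<bar> \<le> 2) \<and>
       (\<forall>x. (\<lambda>i. a i * (K * P i * (?b i x / f0 x))) sums rel_dev g x) \<and>
       (integrable true_law (\<lambda>x. (rel_dev g x)\<^sup>2) \<longrightarrow> chi g > 0 \<longrightarrow> (\<forall>i. \<bar>a i\<bar> \<le> chi g))"
    if g: "g \<in> mixing_measures \<Theta>" for g
  proof (intro exI[of _ "\<lambda>i. ((LINT \<theta>|g. ?c i \<theta>) - (LINT \<theta>|g0. ?c i \<theta>)) / (K * P i)"] conjI allI impI)
    fix i x
    have KP: "K * P i > 0" using K P by simp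
    have "\<bar>(LINT \<theta>|g. ?c i \<theta>) - (LINT \<theta>|g0. ?c i \<theta>)\<bar> \<le> 2 * (A * P i)"
      using abs_c[OF g, of i] abs_c[OF g0, of i] by linarith
    also have "\<dots> \<le> 2 * (K * P i)" using K P[of i] by (intro mult_left_mono mult_right_mono) auto
    finally show "\<bar>((LINT \<theta>|g. ?c i \<theta>) - (LINT \<theta>|g0. ?c i \<theta>)) / (K * P i)\<bar> \<le> 2"
      using KP by (simp add: field_simps)
    have "(\<lambda>i. ((LINT \<theta>|g. ?c i \<theta>) * ?b i x - (LINT \<theta>|g0. ?c i \<theta>) * ?b i x) / f0 x) sums ((mixture_density B g x - f0 x) / f0 x)"
      by (intro sums_divide sums_diff expand g g0)
    also have "(mixture_density B g x - f0 x) / f0 x = rel_dev g x"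
      using f0_pos[of x] by (simp add: rel_dev_def field_simps)
    also have "(\<lambda>i. ((LINT \<theta>|g. ?c i \<theta>) * ?b i x - (LINT \<theta>|g0. ?c i \<theta>) * ?b i x) / f0 x) =
       (\<lambda>i. ((LINT \<theta>|g. ?c i \<theta>) - (LINT \<theta>|g0. ?c i \<theta>)) / (K * P i) * (K * P i * (?b i x / f0 x)))"
      using K P f0_pos[of x] by (auto simp: fun_eq_iff field_simps less_imp_neq[symmetric])
    finally show "(\<lambda>i. ((LINT \<theta>|g. ?c i \<theta>) - (LINT \<theta>|g0. ?c i \<theta>)) / (K * P i) * (K * P i * (?b i x / f0 x))) sums rel_dev g x" .
  next
    fix i assume i: "integrable true_law (\<lambda>x. (rel_dev g x)\<^sup>2)" and s: "chi g > 0"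
    have KP: "K * P i > 0" using K P by simp
    have "dual_bound (?c i) (C * (A * P i))"
      using jets by (intro dual coefficient_measurable) (auto simp: P_def)
    then have "\<bar>(LINT \<theta>|g. ?c i \<theta>) - (LINT \<theta>|g0. ?c i \<theta>)\<bar> \<le> C * (A * P i) * chi g"
      using g i s by (auto simp: dual_bound_def)
    also have "\<dots> \<le> K * P i * chi g"
      using K P[of i] s by (intro mult_right_mono) (auto simp: mult.assoc[symmetric] intro: mult_right_mono)
    finally show "\<bar>((LINT \<theta>|g. ?c i \<theta>) - (LINT \<theta>|g0. ?c i \<theta>)) / (K * P i)\<bar> \<le> chi g"
      using KP by (simp add: field_simps)
  qed
  then show ?thesis using K D unfolding P_def by blast
qed

text \<open>
For large \<open>n\<close> this is the uniform likelihood ratio bound for the normalised relative deviations; for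
the finitely many small \<open>n\<close> the divergences themselves are bounded uniformly in \<open>g\<close>.
\<close>

theorem likelihood_set_chi_bounded:
  assumes iid: "iid_sample M true_law X" and \<epsilon>: "\<epsilon> > 0" and c: "c \<ge> 0"
  shows "\<exists>K. \<forall>n. \<exists>E\<in>sets M. measure M E \<le> \<epsilon> \<and>
    (\<forall>\<omega>\<in>space M - E. \<forall>g\<in>mixing_measures \<Theta>.
       log_likelihood n (\<lambda>i. X i \<omega>) (mixture_density B g) \<ge> log_likelihood n (\<lambda>i. X i \<omega>) f0 - c \<longrightarrow>
       of_nat n * chi_square \<mu> (mixture_density B g) f0 \<le> ennreal K)"
proof -
  interpret iid_sample M true_law X by (rule iid)
  interpret L: prob_space true_law by (rule prob_space_true_law)
  obtain K D R where K: "K > 0" and D: "D > 0" and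
    ex: "\<forall>g\<in>mixing_measures \<Theta>. \<exists>a. (\<forall>i. \<bar>a i\<bar> \<le> (R::real)) \<and>
       (\<forall>x. (\<lambda>i. a i * (K * (\<Prod>l\<in>(UNIV :: 'd set). D ^ multi_index i l) * (basis_function B (multi_index i) x / f0 x))) sums rel_dev g x) \<and>
       (integrable true_law (\<lambda>x. (rel_dev g x)\<^sup>2) \<longrightarrow> chi g > 0 \<longrightarrow> (\<forall>i. \<bar>a i\<bar> \<le> chi g))"
    using relative_expansion by blast
  define \<psi> where "\<psi> i x = K * (\<Prod>l\<in>(UNIV :: 'd set). D ^ multi_index i l) * (basis_function B (multi_index i) x / f0 x)" for i x
  define r where "r i = (\<Prod>l\<in>(UNIV :: 'd set). (1 / 2 :: real) ^ multi_index i l)" for i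
  define \<Psi> where "\<Psi> x = K * (envelope B D x / f0 x)" for x
  have r: "r i > 0" for i unfolding r_def by (intro prod_pos) auto
  have \<psi>_le: "\<bar>\<psi> i x\<bar> \<le> r i * \<Psi> x" for i x
  proof -
    have "\<bar>\<psi> i x\<bar> = K / f0 x * ((\<Prod>l\<in>(UNIV :: 'd set). D ^ multi_index i l) * \<bar>basis_function B (multi_index i) x\<bar>)"
      using K D f0_pos[of x] by (simp add: \<psi>_def abs_mult abs_of_nonneg[OF prod_nonneg] less_imp_le)
    also have "\<dots> \<le> K / f0 x * (r i * envelope B D x)"
      unfolding r_def using K D f0_pos[of x] by (intro mult_left_mono basis_function_le) (auto simp: less_imp_le)
    finally show ?thesis by (simp add: \<Psi>_def mult_ac)
  qed
  interpret dominated_series M true_law X \<psi> r \<Psi>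
  proof
    show "\<psi> i \<in> borel_measurable true_law" for i unfolding \<psi>_def[abs_def] by measurable
    show "\<Psi> \<in> borel_measurable true_law" unfolding \<Psi>_def[abs_def] by measurable
    show "summable r" using product_of_series(1)[of "\<lambda>_ k. (1 / 2 :: real) ^ k"] r
      by (simp add: r_def[abs_def] abs_of_nonneg[OF prod_nonneg] summable_geometric)
    show "integrable true_law (\<lambda>x. (\<Psi> x) ^ 4)"
      unfolding \<Psi>_def power_mult_distrib using envelope_fourth_moment[of D] D by simp
  qed (use r \<psi>_le in auto)
  let ?r = "suminf r"
  have rel_le: "\<bar>rel_dev g x\<bar> \<le> \<bar>R\<bar> * ?r * \<Psi> x" if g: "g \<in> mixing_measures \<Theta>" for g x
  proof -
    obtain a where a: "\<And>i. \<bar>a i\<bar> \<le> R" "(\<lambda>i. a i * \<psi> i x) sums rel_dev g x" using ex g unfolding \<psi>_def by blast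
    have le: "\<bar>a i * \<psi> i x\<bar> \<le> \<bar>R\<bar> * (r i * \<Psi> x)" for i
      unfolding abs_mult using a(1)[of i] \<psi>_le[of i x] by (intro mult_mono) auto
    have s: "summable (\<lambda>i. \<bar>R\<bar> * (r i * \<Psi> x))" by (intro summable_mult summable_mult2 r_summable)
    have s2: "summable (\<lambda>i. \<bar>a i * \<psi> i x\<bar>)"
      by (rule summable_comparison_test'[OF s, of 0]) (use le in auto)
    have "\<bar>rel_dev g x\<bar> = \<bar>\<Sum>i. a i * \<psi> i x\<bar>" using a(2) by (simp add: sums_iff)
    also have "\<dots> \<le> (\<Sum>i. \<bar>a i * \<psi> i x\<bar>)" by (rule summable_rabs[OF s2])
    also have "\<dots> \<le> (\<Sum>i. \<bar>R\<bar> * (r i * \<Psi> x))" by (rule suminf_le[OF le s2 s])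
    also have "\<dots> = \<bar>R\<bar> * ?r * \<Psi> x"
      by (simp add: suminf_mult summable_mult2 r_summable suminf_mult2[symmetric] mult.assoc)
    finally show ?thesis .
  qed
  define V where "V = (\<bar>R\<bar> * ?r)\<^sup>2 * (LINT x|true_law. (\<Psi> x)\<^sup>2)"
  have rel_int: "integrable true_law (\<lambda>x. (rel_dev g x)\<^sup>2)" and chi_le: "(chi g)\<^sup>2 \<le> V" if g: "g \<in> mixing_measures \<Theta>" for g
  proof -
    have [measurable]: "rel_dev g \<in> borel_measurable \<mu>" by (rule rel_dev_measurable[OF g])
    have sq: "(rel_dev g x)\<^sup>2 \<le> (\<bar>R\<bar> * ?r)\<^sup>2 * (\<Psi> x)\<^sup>2" for x
      using power_mono[OF rel_le[OF g, of x], of 2] by (simp add: power_mult_distrib)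
    show i: "integrable true_law (\<lambda>x. (rel_dev g x)\<^sup>2)"
      by (rule Bochner_Integration.integrable_bound[of true_law "\<lambda>x. (\<bar>R\<bar> * ?r)\<^sup>2 * (\<Psi> x)\<^sup>2"])
         (use \<Psi>2 sq in \<open>auto intro!: AE_I2\<close>)
    have "(LINT x|true_law. (rel_dev g x)\<^sup>2) \<le> (LINT x|true_law. (\<bar>R\<bar> * ?r)\<^sup>2 * (\<Psi> x)\<^sup>2)"
      using i \<Psi>2 sq by (intro integral_mono) auto
    then show "(chi g)\<^sup>2 \<le> V" by (simp add: chi_def V_def)
  qed
  have V: "V \<ge> 0" unfolding V_def by simp
  obtain K1 N where KN: "\<And>n. n \<ge> N \<Longrightarrow> \<exists>E\<in>events. prob E \<le> \<epsilon> \<and> (\<forall>\<omega>\<in>space M - E. scale_bound_holds n c K1 \<omega>)"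
    using likelihood_ratio_scale_bounded[OF \<epsilon> c] by blast
  define Kf where "Kf = max \<bar>K1\<bar> (real N * V)"
  show ?thesis
  proof (rule exI[of _ Kf], intro allI)
    fix n
    have goal: "of_nat n * chi_square \<mu> (mixture_density B g) f0 \<le> ennreal Kf"
      if g: "g \<in> mixing_measures \<Theta>" and le: "real n * (chi g)\<^sup>2 \<le> Kf" for g
    proof -
      have "of_nat n * chi_square \<mu> (mixture_density B g) f0 = ennreal (real n * (chi g)\<^sup>2)"
        by (simp add: chi_square_eq[OF g rel_int[OF g]] ennreal_mult ennreal_of_nat_eq_real_of_nat)
      then show ?thesis using le by (simp add: ennreal_leI)
    qed
    show "\<exists>E\<in>sets M. measure M E \<le> \<epsilon> \<and>
    (\<forall>\<omega>\<in>space M - E. \<forall>g\<in>mixing_measures \<Theta>.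
       log_likelihood n (\<lambda>i. X i \<omega>) (mixture_density B g) \<ge> log_likelihood n (\<lambda>i. X i \<omega>) f0 - c \<longrightarrow>
       of_nat n * chi_square \<mu> (mixture_density B g) f0 \<le> ennreal Kf)"
    proof (cases "n \<ge> N")
      case False
      have "real n * (chi g)\<^sup>2 \<le> Kf" if "g \<in> mixing_measures \<Theta>" for g
      proof -
        have "real n * (chi g)\<^sup>2 \<le> real N * V" using False chi_le[OF that] by (intro mult_mono) auto
        then show ?thesis by (simp add: Kf_def)
      qed
      then show ?thesis using \<epsilon> goal by (intro bexI[of _ "{}"]) auto
    next
      case True
      obtain E where E: "E \<in> events" "prob E \<le> \<epsilon>" and bnd: "\<And>\<omega>. \<omega> \<in> space M - E \<Longrightarrow> scale_bound_holds n c K1 \<omega>"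
        using KN[OF True] by blast
      show ?thesis
      proof (rule bexI[OF _ E(1)], intro conjI ballI impI E(2))
        fix \<omega> g assume \<omega>: "\<omega> \<in> space M - E" and g: "g \<in> mixing_measures \<Theta>"
          and ll: "log_likelihood n (\<lambda>i. X i \<omega>) (mixture_density B g) \<ge> log_likelihood n (\<lambda>i. X i \<omega>) f0 - c"
        have "real n * (chi g)\<^sup>2 \<le> Kf"
        proof (cases "chi g = 0")
          case True
          then show ?thesis by (simp add: Kf_def)
        next
          case False
          then have s: "chi g > 0" using chi_nonneg[of g] by simp
          obtain a where a: "\<And>i. \<bar>a i\<bar> \<le> chi g" "\<And>x. (\<lambda>i. a i * \<psi> i x) sums rel_dev g x"
            using ex g rel_int[OF g] s unfolding \<psi>_def by blast
          let ?h = "\<lambda>x. rel_dev g x / chi g"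
          have ratio: "1 + chi g * ?h x = mixture_density B g x / f0 x" for x
            using s by (simp add: rel_dev_def)
          have e1: "\<bar>a i / chi g\<bar> \<le> 1" for i using a(1)[of i] s by simp
          have e2: "?h x = (\<Sum>i. a i / chi g * \<psi> i x)" for x
            using sums_divide[OF a(2)[of x], of "chi g"] by (simp add: sums_iff)
          have mean: "(LINT x|true_law. rel_dev g x) = 0"
          proof -
            interpret gg: prob_space g using g by (simp add: mixing_measures_def)
            interpret gg0: prob_space g0 using g0 by (simp add: mixing_measures_def)
            have "test_function B (\<lambda>_. 0) x = 1" for x by (simp add: test_function_def)
            moreover have "exp_monomial (\<lambda>_. 0) \<theta> = 1" for \<theta> :: "real ^ 'd" by (simp add: exp_monomial_def)
            ultimately show ?thesis
              using integral_test_rel_dev(2)[OF g, of "\<lambda>_. 0"] by (simp add: gg.prob_space gg0.prob_space)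
          qed
          have e3: "(LINT x|true_law. ?h x) = 0" using mean by simp
          have "(LINT x|true_law. (?h x)\<^sup>2) = (LINT x|true_law. (rel_dev g x)\<^sup>2) / (chi g)\<^sup>2"
            by (simp add: power_divide)
          also have "(LINT x|true_law. (rel_dev g x)\<^sup>2) = (chi g)\<^sup>2" by (simp add: chi_def)
          finally have e4: "(LINT x|true_law. (?h x)\<^sup>2) = 1" using s by simp
          have e5: "1 + chi g * ?h (X m \<omega>) > 0" for m
            unfolding ratio using f0_pos mixture_density_pos[OF g] by simp
          have "(\<Sum>m<n. ln (1 + chi g * ?h (X m \<omega>))) =
              log_likelihood n (\<lambda>i. X i \<omega>) (mixture_density B g) - log_likelihood n (\<lambda>i. X i \<omega>) f0"
            unfolding ratio log_likelihood_def sum_subtractf[symmetric]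
            using f0_pos mixture_density_pos[OF g] by (intro sum.cong refl ln_divide_pos)
          then have "(\<Sum>m<n. ln (1 + chi g * ?h (X m \<omega>))) \<ge> - c" using ll by linarith
          then have "real n * (chi g)\<^sup>2 \<le> K1"
            using bnd[OF \<omega>] e1 e2 e3 e4 e5 s unfolding scale_bound_holds_def
            by (elim allE[of _ "\<lambda>i. a i / chi g"] allE[of _ ?h] allE[of _ "chi g"]) auto
          then show ?thesis by (simp add: Kf_def)
        qed
        then show "of_nat n * chi_square \<mu> (mixture_density B g) f0 \<le> ennreal Kf" by (rule goal[OF g])
      qed
    qed
  qed
qed

end

section \<open>Orthonormal scores under infinite support\<close>

text \<open>
Gaussian elimination, stated for arbitrary index sets so that the number of equations can vary.
\<close>

lemma underdetermined_system:
  fixes A :: "'i \<Rightarrow> 'j \<Rightarrow> real"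
  assumes "finite I" "finite J" "card I < card J"
  shows "\<exists>a. (\<exists>j\<in>J. a j \<noteq> 0) \<and> (\<forall>i\<in>I. (\<Sum>j\<in>J. A i j * a j) = 0)"
  using assms
proof (induction I arbitrary: J A rule: finite_induct)
  case empty
  then obtain j where "j \<in> J" by fastforce
  then show ?case by (intro exI[of _ "\<lambda>_. 1"]) auto
next
  case (insert i0 I)
  show ?case
  proof (cases "\<forall>j\<in>J. A i0 j = 0")
    case True
    with insert.IH[of J A] insert.prems insert.hyps show ?thesis by auto
  next
    case False
    then obtain j0 where j0: "j0 \<in> J" "A i0 j0 \<noteq> 0" by auto
    define A' where "A' i j = A i j - A i j0 * A i0 j / A i0 j0" for i j
    have "card I < card (J - {j0})" using insert.prems insert.hyps j0 by simp
    from insert.IH[OF _ this, of A'] insert.prems obtain a where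
      a: "\<exists>j\<in>J - {j0}. a j \<noteq> 0" "\<And>i. i \<in> I \<Longrightarrow> (\<Sum>j\<in>J - {j0}. A' i j * a j) = 0" by auto
    let ?a0 = "- (\<Sum>j\<in>J - {j0}. A i0 j * a j) / A i0 j0"
    have split: "(\<Sum>j\<in>J. A i j * (a(j0 := ?a0)) j) = A i j0 * ?a0 + (\<Sum>j\<in>J - {j0}. A i j * a j)" for i
      using j0 insert.prems by (subst sum.remove[of J j0]) (auto intro!: sum.cong)
    have "(\<Sum>j\<in>J. A i j * (a(j0 := ?a0)) j) = 0" if "i \<in> I" for i
    proof -
      have "(\<Sum>j\<in>J - {j0}. A' i j * a j) = (\<Sum>j\<in>J - {j0}. A i j * a j) - A i j0 / A i0 j0 * (\<Sum>j\<in>J - {j0}. A i0 j * a j)"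
        unfolding A'_def sum_distrib_left sum_subtractf[symmetric]
        by (intro sum.cong refl) (simp add: algebra_simps)
      with a(2)[OF that] show ?thesis unfolding split by simp
    qed
    moreover have "(\<Sum>j\<in>J. A i0 j * (a(j0 := ?a0)) j) = 0" unfolding split using j0 by simp
    ultimately show ?thesis using a(1) by (intro exI[of _ "a(j0 := ?a0)"]) auto
  qed
qed

text \<open>
The complement of the topological support is a null set, by second countability. If the support were
finite it would be a finite set of full measure.
\<close>

lemma charged_points_infinite:
  fixes g :: "(real ^ 'd::finite) measure"
  assumes "prob_space g" and sets: "sets g = sets borel" and nfd: "\<not> finitely_discrete g"
  shows "infinite {x. \<forall>V. open V \<longrightarrow> x \<in> V \<longrightarrow> emeasure g V > 0}" (is "infinite ?supp")
proof
  interpret prob_space g by fact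
  assume fin: "finite ?supp"
  obtain \<B> :: "(real ^ 'd) set set" where \<B>: "countable \<B>" "topological_basis \<B>" using ex_countable_basis by blast
  let ?N = "\<Union>{b \<in> \<B>. emeasure g b = 0}"
  have "(\<Union>b\<in>{b \<in> \<B>. emeasure g b = 0}. b) \<in> null_sets g"
    using \<B> by (intro null_sets_UN') (auto simp: null_sets_def sets topological_basis_open)
  then have N: "?N \<in> null_sets g" by simp
  have "- ?N \<subseteq> ?supp"
  proof (intro subsetI CollectI allI impI)
    fix x V assume x: "x \<in> - ?N" and V: "open V" "x \<in> V"
    obtain b where b: "b \<in> \<B>" "x \<in> b" "b \<subseteq> V" using topological_basisE[OF \<B>(2) V] .
    then have "emeasure g b > 0" using x by (auto simp: zero_less_iff_neq_zero)
    also have "emeasure g b \<le> emeasure g V" using b V by (intro emeasure_mono) (auto simp: sets)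
    finally show "emeasure g V > 0" .
  qed
  then have "AE x in g. x \<in> ?supp" by (intro AE_I'[OF N]) blast
  moreover have S: "?supp \<in> events" using fin by (simp add: sets finite_imp_closed)
  ultimately have "emeasure g ?supp = 1" using emeasure_eq_1_AE by blast
  with fin S nfd show False by (auto simp: finitely_discrete_def)
qed

lemma disjoint_charged_balls:
  fixes g :: "(real ^ 'd::finite) measure" and m :: nat
  assumes "prob_space g" "sets g = sets borel" "\<not> finitely_discrete g"
  shows "\<exists>\<sigma> \<epsilon>. \<epsilon> > 0 \<and> (\<forall>j<m. emeasure g (ball (\<sigma> j) \<epsilon>) > 0) \<and>
     (\<forall>j<m. \<forall>l<m. j \<noteq> l \<longrightarrow> ball (\<sigma> j) \<epsilon> \<inter> ball (\<sigma> l) \<epsilon> = {})"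
proof -
  from infinite_arbitrarily_large[OF charged_points_infinite[OF assms], of m]
  obtain T where T: "finite T" "card T = m" "T \<subseteq> {x. \<forall>V. open V \<longrightarrow> x \<in> V \<longrightarrow> emeasure g V > 0}" by auto
  obtain \<sigma> where \<sigma>: "bij_betw \<sigma> {..<m} T"
    using ex_bij_betw_nat_finite[OF T(1)] T(2) by (auto simp: lessThan_atLeast0)
  have "\<exists>d>0. \<forall>x\<in>T. x \<noteq> a \<longrightarrow> d \<le> dist a x" for a using finite_set_avoid[OF T(1)] by blast
  then obtain d where d: "\<And>a. d a > 0" "\<And>a x. x \<in> T \<Longrightarrow> x \<noteq> a \<Longrightarrow> d a \<le> dist a x" by metis
  \<comment> \<open>The element \<open>1\<close> covers the case of an empty set \<open>T\<close>.\<close>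
  define \<epsilon> where "\<epsilon> = Min (insert 1 (d ` T)) / 2"
  have \<epsilon>: "\<epsilon> > 0" unfolding \<epsilon>_def using T(1) d(1) by (subst half_gt_zero_iff, subst Min_gr_iff) auto
  have far: "2 * \<epsilon> \<le> dist a x" if "a \<in> T" "x \<in> T" "x \<noteq> a" for a x
  proof -
    have "2 * \<epsilon> \<le> d a" unfolding \<epsilon>_def using T(1) that by (simp add: Min_le)
    with d(2)[OF that(2,3)] show ?thesis by linarith
  qed
  have "ball (\<sigma> j) \<epsilon> \<inter> ball (\<sigma> l) \<epsilon> = {}" if "j < m" "l < m" "j \<noteq> l" for j l
  proof -
    have "\<sigma> j \<in> T" "\<sigma> l \<in> T" "\<sigma> l \<noteq> \<sigma> j"
      using \<sigma> that by (auto simp: bij_betw_def inj_on_def)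
    from far[OF this] show ?thesis by (intro disjoint_ballI) simp
  qed
  moreover have "emeasure g (ball (\<sigma> j) \<epsilon>) > 0" if "j < m" for j
  proof -
    have "\<sigma> j \<in> T" using \<sigma> that by (auto simp: bij_betw_def)
    then show ?thesis using T(3) \<epsilon> by auto
  qed
  ultimately show ?thesis using \<epsilon> by blast
qed

context true_mixture begin

text \<open>
The derivative at \<open>0\<close> of the log-density of the mixture along the tilts \<open>(1 + t * \<phi>) dg0\<close>.
\<close>

definition score :: "(real ^ 'd \<Rightarrow> real) \<Rightarrow> 'd observation \<Rightarrow> real" where
  "score \<phi> x = signed_mixture B g0 \<phi> x / f0 x"

definition bounded_weight :: "(real ^ 'd \<Rightarrow> real) \<Rightarrow> real \<Rightarrow> bool" where
  "bounded_weight \<phi> D \<longleftrightarrow> \<phi> \<in> borel_measurable borel \<and> (\<forall>\<theta>. \<bar>\<phi> \<theta>\<bar> \<le> D)"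

lemma score_measurable: "bounded_weight \<phi> D \<Longrightarrow> score \<phi> \<in> borel_measurable \<mu>"
proof -
  assume "bounded_weight \<phi> D"
  then have [measurable]: "signed_mixture B g0 \<phi> \<in> borel_measurable \<mu>"
    by (intro signed_mixture_measurable[OF g0, where D=D]) (auto simp: bounded_weight_def)
  show ?thesis unfolding score_def[abs_def] by measurable
qed

lemma score_bounded:
  assumes "bounded_weight \<phi> D" shows "\<bar>score \<phi> x\<bar> \<le> D"
proof -
  have \<phi>: "\<phi> \<in> borel_measurable borel" "\<And>\<theta>. \<bar>\<phi> \<theta>\<bar> \<le> D" using assms by (auto simp: bounded_weight_def)
  have "\<bar>signed_mixture B g0 \<phi> x\<bar> \<le> (LINT \<theta>|g0. D * component_density B \<theta> x)"
    unfolding signed_mixture_def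
  proof (rule abs_integral_le_on_parameters[OF g0])
    show "(\<lambda>\<theta>. \<phi> \<theta> * component_density B \<theta> x) \<in> borel_measurable borel"
      using \<phi>(1) density_measurable_parameter[OF g0, of x] by measurable
    show "integrable g0 (\<lambda>\<theta>. D * component_density B \<theta> x)"
      by (intro integrable_mult_right integrable_component[OF g0])
    show "\<bar>\<phi> \<theta> * component_density B \<theta> x\<bar> \<le> D * component_density B \<theta> x" if "\<theta> \<in> \<Theta>" for \<theta>
      using component_nonneg[OF that] \<phi>(2) by (simp add: abs_mult mult_right_mono)
  qed
  then have "\<bar>signed_mixture B g0 \<phi> x\<bar> \<le> D * f0 x" by (simp add: mixture_density_def)
  then show ?thesis using f0_pos[of x] by (simp add: score_def field_simps)
qed

lemma integrable_score_times_score: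
  assumes "bounded_weight \<phi> D" "bounded_weight \<psi> D'"
  shows "integrable true_law (\<lambda>x. score \<phi> x * score \<psi> x)"
proof -
  interpret L: prob_space true_law by (rule prob_space_true_law)
  note [measurable] = score_measurable[OF assms(1)] score_measurable[OF assms(2)]
  show ?thesis
  proof (rule L.integrable_const_bound[where B="\<bar>D\<bar> * \<bar>D'\<bar>"])
    show "AE x in true_law. norm (score \<phi> x * score \<psi> x) \<le> \<bar>D\<bar> * \<bar>D'\<bar>"
    proof (rule AE_I2)
      fix x
      have "\<bar>score \<phi> x\<bar> \<le> \<bar>D\<bar>" "\<bar>score \<psi> x\<bar> \<le> \<bar>D'\<bar>"
        using score_bounded[OF assms(1), of x] score_bounded[OF assms(2), of x] by linarith+
      then show "norm (score \<phi> x * score \<psi> x) \<le> \<bar>D\<bar> * \<bar>D'\<bar>"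
        unfolding real_norm_def abs_mult by (intro mult_mono) auto
    qed
  qed measurable
qed

lemma score_sum:
  assumes "finite J" "\<And>j. j \<in> J \<Longrightarrow> bounded_weight (\<phi> j) D"
  shows "score (\<lambda>\<theta>. \<Sum>j\<in>J. a j * \<phi> j \<theta>) x = (\<Sum>j\<in>J. a j * score (\<phi> j) x)"
proof -
  have i: "integrable g0 (\<lambda>\<theta>. \<phi> j \<theta> * component_density B \<theta> x)" if "j \<in> J" for j
    using assms(2)[OF that] integrable_signed_mixture[OF g0, of "\<phi> j" D x] by (simp add: bounded_weight_def)
  have "signed_mixture B g0 (\<lambda>\<theta>. \<Sum>j\<in>J. a j * \<phi> j \<theta>) x = (LINT \<theta>|g0. (\<Sum>j\<in>J. a j * (\<phi> j \<theta> * component_density B \<theta> x)))"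
    by (simp add: signed_mixture_def sum_distrib_right mult.assoc)
  also have "\<dots> = (\<Sum>j\<in>J. a j * signed_mixture B g0 (\<phi> j) x)"
    using i by (simp add: signed_mixture_def)
  finally show ?thesis by (simp add: score_def sum_divide_distrib)
qed

lemma score_scale: "score (\<lambda>\<theta>. c * \<phi> \<theta>) x = c * score \<phi> x"
  by (simp only: score_def signed_mixture_def mult.assoc integral_mult_right_zero times_divide_eq_right)

lemma integral_score:
  assumes "bounded_weight \<phi> D"
  shows "(LINT x|true_law. score \<phi> x) = (LINT \<theta>|g0. \<phi> \<theta>)"
proof -
  have \<phi>: "\<phi> \<in> borel_measurable borel" "\<And>\<theta>. \<bar>\<phi> \<theta>\<bar> \<le> D" using assms by (auto simp: bounded_weight_def)
  have "(LINT x|true_law. score \<phi> x) = (LINT x|\<mu>. f0 x * score \<phi> x)"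
    using score_measurable[OF assms] by (rule integral_true_law)
  also have "\<dots> = (LINT x|\<mu>. test_function B (\<lambda>_. 0) x * signed_mixture B g0 \<phi> x)"
    using f0_pos by (intro Bochner_Integration.integral_cong refl) (simp add: score_def test_function_def less_imp_neq[symmetric])
  also have "\<dots> = (LINT \<theta>|g0. \<phi> \<theta>)"
    using integral_test_signed_mixture(2)[OF g0 \<phi>, of "\<lambda>_. 0"] by (simp add: exp_monomial_def)
  finally show ?thesis .
qed

text \<open>
Identifiability of the mixing measure. A vanishing score makes the signed measure \<open>\<phi> dg0\<close> annihilate
all exponential monomials; these span an algebra that separates points, which is dense in the
continuous functions on the compact closure of \<open>\<Theta>\<close>.
\<close>

lemma score_zero_imp_orthogonal:
  assumes \<phi>: "bounded_weight \<phi> D" and zero: "(LINT x|true_law. (score \<phi> x)\<^sup>2) = 0"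
    and F: "continuous_on UNIV F"
  shows "(LINT \<theta>|g0. \<phi> \<theta> * F \<theta>) = 0"
proof -
  have \<phi>': "\<phi> \<in> borel_measurable borel" "\<And>\<theta>. \<bar>\<phi> \<theta>\<bar> \<le> D" using \<phi> by (auto simp: bounded_weight_def)
  note [measurable] = \<phi>'(1)
  have D: "D \<ge> 0" using \<phi>'(2)[of 0] by linarith
  note [measurable] = score_measurable[OF \<phi>]
  have "AE x in true_law. (score \<phi> x)\<^sup>2 = 0"
    using zero integrable_score_times_score[OF \<phi> \<phi>] by (subst (asm) integral_nonneg_eq_0_iff_AE) (auto simp: power2_eq_square)
  then have "AE x in true_law. signed_mixture B g0 \<phi> x = 0"
    by eventually_elim (use f0_pos in \<open>simp add: score_def less_imp_neq[symmetric]\<close>)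
  then have "AE x in \<mu>. 0 < ennreal (f0 x) \<longrightarrow> signed_mixture B g0 \<phi> x = 0"
    unfolding true_law_def by (subst (asm) AE_density) auto
  then have AE: "AE x in \<mu>. signed_mixture B g0 \<phi> x = 0"
    by eventually_elim (use f0_pos in auto)
  have mono: "(LINT \<theta>|g0. \<phi> \<theta> * exp_monomial k \<theta>) = 0" for k
  proof -
    have "(LINT x|\<mu>. test_function B k x * signed_mixture B g0 \<phi> x) = 0"
      using AE by (intro integral_eq_zero_AE) (auto elim: eventually_mono)
    then show ?thesis using integral_test_signed_mixture(2)[OF g0 \<phi>'] by simp
  qed
  have int: "integrable g0 (\<lambda>\<theta>. \<phi> \<theta> * Q \<theta>)" if Q: "continuous_on UNIV Q" for Q
  proof -
    have "compact (Q ` closure \<Theta>)"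
      using bounded_\<Theta> Q by (intro compact_continuous_image) (auto simp: compact_closure intro: continuous_on_subset)
    then obtain C where C: "\<forall>y\<in>Q ` closure \<Theta>. \<bar>y\<bar> \<le> C"
      using compact_imp_bounded bounded_iff by (metis real_norm_def)
    have [measurable]: "Q \<in> borel_measurable borel" using Q by (rule borel_measurable_continuous_onI)
    show ?thesis
    proof (rule integrable_bounded_on_parameters[OF g0, where C="D * C"])
      fix \<theta> assume "\<theta> \<in> \<Theta>"
      then have "\<bar>Q \<theta>\<bar> \<le> C" using C closure_subset by blast
      then show "\<bar>\<phi> \<theta> * Q \<theta>\<bar> \<le> D * C" unfolding abs_mult using \<phi>'(2) D by (intro mult_mono) auto
    qed measurable
  qed
  have poly: "(LINT \<theta>|g0. \<phi> \<theta> * Q \<theta>) = 0" if "Q \<in> exp_polynomials" for Q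
    using that
  proof (induction Q)
    case (add F G)
    then show ?case using int[OF exp_polynomials_continuous] by (simp add: distrib_left)
  next
    case (scale F c)
    have "(LINT \<theta>|g0. \<phi> \<theta> * (c * F \<theta>)) = (LINT \<theta>|g0. c * (\<phi> \<theta> * F \<theta>))" by (simp add: mult_ac)
    then show ?case using scale by simp
  qed (rule mono)
  interpret g0: prob_space g0 using g0 by (simp add: mixing_measures_def)
  have "\<bar>LINT \<theta>|g0. \<phi> \<theta> * F \<theta>\<bar> \<le> D * e" if e: "e > 0" for e
  proof -
    have "\<exists>Q. Q \<in> exp_polynomials \<and> (\<forall>\<theta>\<in>closure \<Theta>. \<bar>F \<theta> - Q \<theta>\<bar> < e)"
    proof (rule Stone_Weierstrass_HOL[where P="\<lambda>Q. Q \<in> exp_polynomials" and S="closure \<Theta>"])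
      show "compact (closure \<Theta>)" using bounded_\<Theta> by (simp add: compact_closure)
      show "\<exists>Q. Q \<in> exp_polynomials \<and> Q x \<noteq> Q y" if "x \<in> closure \<Theta> \<and> y \<in> closure \<Theta> \<and> x \<noteq> y" for x y
      proof -
        from that obtain l where "x $ l \<noteq> y $ l" by (auto simp: vec_eq_iff)
        then show ?thesis using exp_polynomials_exp[of l] by (intro exI[of _ "\<lambda>\<theta>. exp (\<theta> $ l)"]) auto
      qed
    qed (use F e in \<open>auto intro: exp_polynomials_const exp_polynomials_continuous exp_polynomials.add exp_polynomials_mult continuous_on_subset\<close>)
    then obtain Q where Q: "Q \<in> exp_polynomials" "\<And>\<theta>. \<theta> \<in> closure \<Theta> \<Longrightarrow> \<bar>F \<theta> - Q \<theta>\<bar> < e" by blast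
    have [measurable]: "F \<in> borel_measurable borel" "Q \<in> borel_measurable borel"
      using F exp_polynomials_continuous[OF Q(1)] by (auto intro: borel_measurable_continuous_onI)
    have "(LINT \<theta>|g0. \<phi> \<theta> * F \<theta>) = (LINT \<theta>|g0. \<phi> \<theta> * F \<theta>) - (LINT \<theta>|g0. \<phi> \<theta> * Q \<theta>)" using poly[OF Q(1)] by simp
    also have "\<dots> = (LINT \<theta>|g0. \<phi> \<theta> * (F \<theta> - Q \<theta>))"
      using int[OF F] int[OF exp_polynomials_continuous[OF Q(1)]] by (simp add: right_diff_distrib)
    finally have eq: "(LINT \<theta>|g0. \<phi> \<theta> * F \<theta>) = (LINT \<theta>|g0. \<phi> \<theta> * (F \<theta> - Q \<theta>))" .
    have "\<bar>LINT \<theta>|g0. \<phi> \<theta> * (F \<theta> - Q \<theta>)\<bar> \<le> (LINT \<theta>|g0. D * e)"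
    proof (rule abs_integral_le_on_parameters[OF g0])
      fix \<theta> assume "\<theta> \<in> \<Theta>"
      then have "\<bar>F \<theta> - Q \<theta>\<bar> \<le> e" using Q(2)[of \<theta>] closure_subset by (meson less_imp_le subsetD)
      then show "\<bar>\<phi> \<theta> * (F \<theta> - Q \<theta>)\<bar> \<le> D * e" unfolding abs_mult using \<phi>'(2) D by (intro mult_mono) auto
    qed auto
    then show ?thesis unfolding eq by (simp add: g0.prob_space)
  qed
  then have le: "\<bar>LINT \<theta>|g0. \<phi> \<theta> * F \<theta>\<bar> \<le> D * e" if "e > 0" for e using that .
  show ?thesis
  proof (rule ccontr)
    assume "(LINT \<theta>|g0. \<phi> \<theta> * F \<theta>) \<noteq> 0"
    define I where "I = \<bar>LINT \<theta>|g0. \<phi> \<theta> * F \<theta>\<bar>"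
    have p: "I > 0" using \<open>(LINT \<theta>|g0. \<phi> \<theta> * F \<theta>) \<noteq> 0\<close> by (simp add: I_def)
    have "I \<le> D * (I / (2 * (D + 1)))" unfolding I_def using le[of "I / (2 * (D + 1))"] p D by (simp add: I_def)
    then have "(D + 2) * I \<le> 0" using D by (simp add: field_simps)
    moreover have "(D + 2) * I > 0" using p D by (intro mult_pos_pos) auto
    ultimately show False by simp
  qed
qed

definition orthonormal_weights :: "nat \<Rightarrow> (nat \<Rightarrow> real ^ 'd \<Rightarrow> real) \<Rightarrow> real \<Rightarrow> bool" where
  "orthonormal_weights k \<phi> D \<longleftrightarrow> (\<forall>j. bounded_weight (\<phi> j) D) \<and> (\<forall>j<k. (LINT \<theta>|g0. \<phi> j \<theta>) = 0) \<and>
     (\<forall>j<k. \<forall>l<k. (LINT x|true_law. score (\<phi> j) x * score (\<phi> l) x) = (if j = l then 1 else 0))"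

text \<open>
Induction on \<open>k\<close>. Among the combinations of the indicators of \<open>k + 2\<close> disjoint balls charged by \<open>g0\<close>,
the \<open>k + 1\<close> conditions of mean zero and orthogonality to the given scores leave a nonzero one. Its
score does not vanish: a tent function on a ball with nonzero coefficient would be orthogonal to the
combination by \<open>score_zero_imp_orthogonal\<close>, although its integral against the combination is nonzero.
\<close>

lemma orthonormal_weights_exist:
  assumes nfd: "\<not> finitely_discrete g0"
  shows "\<exists>\<phi> D. orthonormal_weights k \<phi> D"
proof (induction k)
  case 0
  then show ?case by (intro exI[of _ "\<lambda>_ _. 0"] exI[of _ 0]) (auto simp: orthonormal_weights_def bounded_weight_def)
next
  case (Suc k)
  then obtain \<phi> D where "orthonormal_weights k \<phi> D" by blast
  then have \<phi>: "\<And>j. bounded_weight (\<phi> j) D" "\<And>j. j < k \<Longrightarrow> (LINT \<theta>|g0. \<phi> j \<theta>) = 0"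
    "\<And>j l. j < k \<Longrightarrow> l < k \<Longrightarrow> (LINT x|true_law. score (\<phi> j) x * score (\<phi> l) x) = (if j = l then 1 else 0)"
    by (auto simp: orthonormal_weights_def)
  interpret g0: prob_space g0 using g0 by (simp add: mixing_measures_def)
  have sets: "sets g0 = sets borel" using g0 by (simp add: mixing_measures_def)
  obtain m where m: "m = k + 2" by simp
  obtain \<sigma> \<epsilon> where \<epsilon>: "\<epsilon> > 0" and charged: "\<And>j. j < m \<Longrightarrow> emeasure g0 (ball (\<sigma> j) \<epsilon>) > 0"
    and disj: "\<And>j l. j < m \<Longrightarrow> l < m \<Longrightarrow> j \<noteq> l \<Longrightarrow> ball (\<sigma> j) \<epsilon> \<inter> ball (\<sigma> l) \<epsilon> = {}"
    using disjoint_charged_balls[OF g0.prob_space_axioms sets nfd, of "m"] by blast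
  let ?ind = "\<lambda>j \<theta>. indicator (ball (\<sigma> j) \<epsilon>) \<theta> :: real"
  have ind: "bounded_weight (?ind j) 1" for j by (auto simp: bounded_weight_def indicator_def)
  \<comment> \<open>Row \<open>k\<close> is the condition of mean zero; the rows before it are the orthogonality conditions.\<close>
  define A where "A i j = (if i < k then (LINT x|true_law. score (?ind j) x * score (\<phi> i) x) else (LINT \<theta>|g0. ?ind j \<theta>))" for i j
  have "\<exists>a. (\<exists>j\<in>{..<m}. a j \<noteq> 0) \<and> (\<forall>i\<in>{..<k + 1}. (\<Sum>j<m. A i j * a j) = 0)"
    by (rule underdetermined_system) (auto simp: m)
  then obtain a where a: "\<exists>j\<in>{..<m}. a j \<noteq> 0" "\<forall>i\<in>{..<k + 1}. (\<Sum>j<m. A i j * a j) = 0"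
    by (elim exE conjE)
  define \<psi> where "\<psi> \<theta> = (\<Sum>j<m. a j * ?ind j \<theta>)" for \<theta>
  define D\<psi> where "D\<psi> = (\<Sum>j<m. \<bar>a j\<bar>)"
  have \<psi>: "bounded_weight \<psi> D\<psi>"
    unfolding bounded_weight_def
  proof (intro conjI allI)
    show "\<psi> \<in> borel_measurable borel" unfolding \<psi>_def[abs_def]
      using ind by (intro borel_measurable_sum borel_measurable_times) (auto simp: bounded_weight_def)
    show "\<bar>\<psi> \<theta>\<bar> \<le> D\<psi>" for \<theta> unfolding \<psi>_def D\<psi>_def
      by (rule order_trans[OF sum_abs], rule sum_mono) (auto simp: indicator_def)
  qed
  have score\<psi>: "score \<psi> x = (\<Sum>j<m. a j * score (?ind j) x)" for x
    unfolding \<psi>_def[abs_def] by (rule score_sum[where D=1]) (auto simp: ind)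
  have mean: "(LINT \<theta>|g0. \<psi> \<theta>) = 0"
  proof -
    have i: "integrable g0 (?ind j)" for j
      using ind[of j] by (intro integrable_bounded_on_parameters[OF g0, where C=1]) (auto simp: bounded_weight_def)
    have "(LINT \<theta>|g0. \<psi> \<theta>) = (\<Sum>j<m. a j * (LINT \<theta>|g0. ?ind j \<theta>))"
      unfolding \<psi>_def using i by (subst Bochner_Integration.integral_sum) auto
    then show ?thesis using bspec[OF a(2), of k] by (simp add: A_def mult.commute)
  qed
  have orth: "(LINT x|true_law. score \<psi> x * score (\<phi> i) x) = 0" if "i < k" for i
  proof -
    have "(LINT x|true_law. score \<psi> x * score (\<phi> i) x) = (LINT x|true_law. (\<Sum>j<m. a j * (score (?ind j) x * score (\<phi> i) x)))"
      unfolding score\<psi> by (simp only: sum_distrib_right mult.assoc)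
    also have "\<dots> = (\<Sum>j<m. a j * (LINT x|true_law. score (?ind j) x * score (\<phi> i) x))"
      using integrable_score_times_score[OF ind \<phi>(1)] by (subst Bochner_Integration.integral_sum) auto
    finally show ?thesis using bspec[OF a(2), of i] that by (simp add: A_def mult.commute)
  qed
  define v where "v = (LINT x|true_law. (score \<psi> x)\<^sup>2)"
  have "v \<noteq> 0"
  proof
    assume "v = 0"
    obtain i where i: "i < m" "a i \<noteq> 0" using a(1) by blast
    \<comment> \<open>A tent function supported in the closure of the ball around \<open>\<sigma> i\<close>.\<close>
    let ?F = "\<lambda>\<theta>. max 0 (\<epsilon> - dist (\<sigma> i) \<theta>)"
    have F: "continuous_on UNIV ?F" by (intro continuous_intros)
    have pointwise: "\<psi> \<theta> * ?F \<theta> = a i * ?F \<theta>" for \<theta>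
    proof (cases "\<theta> \<in> ball (\<sigma> i) \<epsilon>")
      case True
      have "\<psi> \<theta> = (\<Sum>j<m. if j = i then a i else 0)"
        unfolding \<psi>_def
      proof (rule sum.cong[OF refl])
        fix j assume "j \<in> {..<m}"
        then show "a j * ?ind j \<theta> = (if j = i then a i else 0)"
          using disj[of j i] i(1) True by (cases "j = i") (auto simp: indicator_def simp del: mem_ball)
      qed
      then show ?thesis using i(1) by simp
    next
      case False then show ?thesis by (simp add: max_def)
    qed
    have "(LINT \<theta>|g0. \<psi> \<theta> * ?F \<theta>) = 0"
      using score_zero_imp_orthogonal[OF \<psi> _ F] \<open>v = 0\<close> by (simp add: v_def)
    then have "(LINT \<theta>|g0. a i * ?F \<theta>) = 0" by (simp only: pointwise)
    then have F0: "(LINT \<theta>|g0. ?F \<theta>) = 0" using i(2) by simp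
    have [measurable]: "?F \<in> borel_measurable borel" using F by (rule borel_measurable_continuous_onI)
    have mF: "?F \<in> borel_measurable g0" using sets by (simp cong: measurable_cong_sets)
    have "integrable g0 ?F"
      using mF \<epsilon> by (intro g0.integrable_const_bound[where B=\<epsilon>]) (auto simp: max_def)
    then have "AE \<theta> in g0. ?F \<theta> = 0" using F0 by (subst (asm) integral_nonneg_eq_0_iff_AE) auto
    then have "AE \<theta> in g0. \<theta> \<notin> ball (\<sigma> i) \<epsilon>" by eventually_elim (auto simp: max_def split: if_splits)
    then have "emeasure g0 (ball (\<sigma> i) \<epsilon>) = 0"
      by (subst (asm) AE_iff_measurable[of "ball (\<sigma> i) \<epsilon>"]) (auto simp: sets sets_eq_imp_space_eq[OF sets])
    with charged[OF i(1)] show False by simp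
  qed
  moreover have "v \<ge> 0" unfolding v_def by simp
  ultimately have v: "v > 0" by simp
  define \<eta> where "\<eta> = (\<lambda>\<theta>. 1 / sqrt v * \<psi> \<theta>)"
  have score\<eta>: "score \<eta> x = 1 / sqrt v * score \<psi> x" for x
    unfolding \<eta>_def by (rule score_scale)
  have \<eta>: "bounded_weight \<eta> (D\<psi> / sqrt v)"
    using \<psi> v by (auto simp: bounded_weight_def \<eta>_def abs_mult divide_right_mono)
  define D' where "D' = max D (D\<psi> / sqrt v)"
  have mono: "bounded_weight f E' " if "bounded_weight f E" "E \<le> E'" for f E E'
    using that order_trans unfolding bounded_weight_def by blast
  have "orthonormal_weights (Suc k) (\<phi>(k := \<eta>)) D'"
    unfolding orthonormal_weights_def
  proof (intro conjI allI impI)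
    show "bounded_weight ((\<phi>(k := \<eta>)) j) D'" for j
      using mono[OF \<phi>(1)] mono[OF \<eta>] by (auto simp: D'_def)
    show "(LINT \<theta>|g0. (\<phi>(k := \<eta>)) j \<theta>) = 0" if "j < Suc k" for j
      using that \<phi>(2)[of j] mean by (cases "j = k") (auto simp: \<eta>_def)
    fix j l assume jl: "j < Suc k" "l < Suc k"
    have one: "(LINT x|true_law. score \<eta> x * score \<eta> x) = 1"
    proof -
      have "score \<eta> x * score \<eta> x = 1 / v * (score \<psi> x)\<^sup>2" for x
        using v by (simp add: score\<eta> power2_eq_square)
      then have "(LINT x|true_law. score \<eta> x * score \<eta> x) = 1 / v * v" by (simp add: v_def)
      then show ?thesis using v by simp
    qed
    have zero: "(LINT x|true_law. score \<eta> x * score (\<phi> i) x) = 0" if "i < k" for i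
      using orth[OF that] by (simp add: score\<eta>)
    show "(LINT x|true_law. score ((\<phi>(k := \<eta>)) j) x * score ((\<phi>(k := \<eta>)) l) x) = (if j = l then 1 else 0)"
      using jl \<phi>(3)[of j l] one zero[of l] zero[of j] by (cases "j = k"; cases "l = k") (auto simp: mult.commute)
  qed
  then show ?case by blast
qed

end

section \<open>Likelier mixtures far from the truth and the dichotomy\<close>

lemma outer_measure_of_le:
  assumes "A \<subseteq> E" "E \<in> sets M" shows "outer_measure_of M A \<le> emeasure M E"
  unfolding outer_measure_of_def using assms by (intro INF_lower) auto

context true_mixture begin

definition tilted :: "(real ^ 'd \<Rightarrow> real) \<Rightarrow> (real ^ 'd) measure" where
  "tilted \<phi> = density g0 (\<lambda>\<theta>. ennreal (1 + \<phi> \<theta>))"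

lemma tilted_mixture:
  assumes \<phi>: "bounded_weight \<phi> D" "\<And>\<theta>. \<phi> \<theta> \<ge> - 1" and mean: "(LINT \<theta>|g0. \<phi> \<theta>) = 0"
  shows "tilted \<phi> \<in> mixing_measures \<Theta>" and "rel_dev (tilted \<phi>) x = score \<phi> x"
proof -
  interpret g0: prob_space g0 using g0 by (simp add: mixing_measures_def)
  have sets: "sets g0 = sets borel" using g0 by (simp add: mixing_measures_def)
  have m: "\<phi> \<in> borel_measurable borel" "\<And>\<theta>. \<bar>\<phi> \<theta>\<bar> \<le> D" using \<phi> by (auto simp: bounded_weight_def)
  have [measurable]: "\<phi> \<in> borel_measurable g0" using m(1) sets by (simp cong: measurable_cong_sets)
  have i: "integrable g0 \<phi>" by (rule g0.integrable_const_bound[where B=D]) (use m in auto)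
  have nn: "0 \<le> 1 + \<phi> \<theta>" for \<theta> using \<phi>(2)[of \<theta>] by linarith
  have "(\<integral>\<^sup>+\<theta>. ennreal (1 + \<phi> \<theta>) \<partial>g0) = ennreal (LINT \<theta>|g0. 1 + \<phi> \<theta>)"
    using i nn by (intro nn_integral_eq_integral) auto
  also have "(LINT \<theta>|g0. 1 + \<phi> \<theta>) = 1" using i mean by (simp add: g0.prob_space)
  finally have "prob_space (tilted \<phi>)"
    by (intro prob_spaceI) (simp add: tilted_def emeasure_density)
  moreover have "AE \<theta> in tilted \<phi>. \<theta> \<in> \<Theta>"
    unfolding tilted_def using g_AE[OF g0] by (subst AE_density) (auto elim: eventually_mono)
  ultimately show "tilted \<phi> \<in> mixing_measures \<Theta>"
    unfolding mixing_measures_def mem_Collect_eq by (intro conjI) (simp_all add: tilted_def sets)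
  have c [measurable]: "(\<lambda>\<theta>. component_density B \<theta> x) \<in> borel_measurable g0"
    using density_measurable_parameter[OF g0, of x] sets by (simp cong: measurable_cong_sets)
  have "mixture_density B (tilted \<phi>) x = (LINT \<theta>|g0. (1 + \<phi> \<theta>) * component_density B \<theta> x)"
    unfolding mixture_density_def tilted_def using nn by (subst integral_real_density) auto
  also have "\<dots> = (LINT \<theta>|g0. component_density B \<theta> x + \<phi> \<theta> * component_density B \<theta> x)"
    by (simp add: distrib_right)
  also have "\<dots> = f0 x + signed_mixture B g0 \<phi> x"
    using integrable_component[OF g0] integrable_signed_mixture[OF g0 m]
    by (simp add: mixture_density_def signed_mixture_def)
  finally show "rel_dev (tilted \<phi>) x = score \<phi> x"
    using f0_pos[of x] by (simp add: rel_dev_def score_def field_simps)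
qed

text \<open>
The number \<open>k\<close> of orthonormal scores is chosen first, large enough for \<open>c\<close>, for \<open>K\<close> and for the
probability \<open>32 / k\<close> of the exceptional event; then \<open>n\<close> is taken large enough for the empirical Gram
matrix to be close to the identity and for the tilt to be a probability measure.
\<close>

theorem likelihood_set_contains_distant_mixture:
  assumes nfd: "\<not> finitely_discrete g0" and iid: "iid_sample M true_law X" and \<epsilon>: "\<epsilon> > 0"
  shows "\<exists>N. \<forall>n\<ge>N. \<exists>E\<in>sets M. measure M E \<le> \<epsilon> \<and>
    (\<forall>\<omega>\<in>space M - E. \<exists>g\<in>mixing_measures \<Theta>.
       log_likelihood n (\<lambda>i. X i \<omega>) (mixture_density B g) \<ge> log_likelihood n (\<lambda>i. X i \<omega>) f0 + c \<and>
       of_nat n * chi_square \<mu> (mixture_density B g) f0 > ennreal K)"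
proof -
  define k where "k = 2 + nat \<lceil>64 / \<epsilon>\<rceil> + nat \<lceil>64 * c\<rceil> + nat \<lceil>256 * \<bar>K\<bar>\<rceil>"
  have k2: "k \<ge> 2" and k\<epsilon>: "64 / \<epsilon> \<le> k" and kc: "64 * c \<le> k" and kK: "256 * \<bar>K\<bar> < k"
    unfolding k_def by linarith+
  obtain \<phi> D where on: "orthonormal_weights k \<phi> D" using orthonormal_weights_exist[OF nfd] by blast
  then have \<phi>: "\<And>j. bounded_weight (\<phi> j) D" "\<And>j. j < k \<Longrightarrow> (LINT \<theta>|g0. \<phi> j \<theta>) = 0"
    "\<And>j l. j < k \<Longrightarrow> l < k \<Longrightarrow> (LINT x|true_law. score (\<phi> j) x * score (\<phi> l) x) = (if j = l then 1 else 0)"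
    by (auto simp: orthonormal_weights_def)
  have \<phi>D: "\<And>j \<theta>. \<bar>\<phi> j \<theta>\<bar> \<le> D" using \<phi>(1) by (auto simp: bounded_weight_def)
  interpret iid_sample M true_law X by (rule iid)
  interpret orthonormal_scores M true_law X k "\<lambda>j. score (\<phi> j)" D
  proof
    show "score (\<phi> j) \<in> borel_measurable true_law" for j
      using score_measurable[OF \<phi>(1)] by (simp cong: measurable_cong_sets add: measurable_cong_sets[OF sets_true_law refl])
    show "(LINT x|true_law. score (\<phi> j) x) = 0" if "j < k" for j
      using integral_score[OF \<phi>(1)] \<phi>(2)[OF that] by simp
  qed (use score_bounded[OF \<phi>(1)] \<phi>(3) in auto)
  define N where "N = 1 + nat \<lceil>48 * real k ^ 3 * D\<^sup>2\<rceil> + nat \<lceil>2 * (real k ^ 4 * D ^ 4) / \<epsilon>\<rceil>"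
  show ?thesis
  proof (rule exI[of _ N], intro allI impI)
    fix n assume "n \<ge> N"
    then have n0: "n > 0" and n1: "48 * real k ^ 3 * D\<^sup>2 \<le> n" and n2: "2 * (real k ^ 4 * D ^ 4) / \<epsilon> \<le> n"
      unfolding N_def by linarith+
    obtain E where E: "E \<in> events" "prob E \<le> 32 / k + real k ^ 4 * D ^ 4 / n" and
      regular: "\<forall>\<omega>\<in>space M - E.
       real k / 4 * n \<le> (\<Sum>j<k. (\<Sum>i<n. score (\<phi> j) (X i \<omega>))\<^sup>2) \<and>
       (\<Sum>j<k. (\<Sum>i<n. score (\<phi> j) (X i \<omega>))\<^sup>2) \<le> 3 * real k * n \<and>
       (\<forall>j<k. \<forall>l<k. \<bar>(\<Sum>i<n. score (\<phi> j) (X i \<omega>) * score (\<phi> l) (X i \<omega>)) - (if j = l then real n else 0)\<bar> \<le> real n / real k)"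
      using typical_event[OF k2 n0] by (elim bexE conjE)
    have "32 / k \<le> \<epsilon> / 2" using k\<epsilon> k2 \<epsilon> by (simp add: field_simps)
    moreover have "real k ^ 4 * D ^ 4 / n \<le> \<epsilon> / 2" using n2 n0 \<epsilon> by (simp add: field_simps)
    ultimately have PE: "prob E \<le> \<epsilon>" using E(2) by linarith
    show "\<exists>E\<in>sets M. measure M E \<le> \<epsilon> \<and>
    (\<forall>\<omega>\<in>space M - E. \<exists>g\<in>mixing_measures \<Theta>.
       log_likelihood n (\<lambda>i. X i \<omega>) (mixture_density B g) \<ge> log_likelihood n (\<lambda>i. X i \<omega>) f0 + c \<and>
       of_nat n * chi_square \<mu> (mixture_density B g) f0 > ennreal K)"
    proof (rule bexI[OF _ E(1)], intro conjI ballI PE)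
      fix \<omega> assume \<omega>E: "\<omega> \<in> space M - E"
      then have \<omega>: "\<omega> \<in> space M" by simp
      define t where "t j = (\<Sum>i<n. score (\<phi> j) (X i \<omega>)) / (8 * real n)" for j
      have n1': "48 * real k ^ 3 * D\<^sup>2 \<le> 64 * n" using n1 by linarith
      note gain = likelihood_gain[OF n0 n1' \<omega>, folded t_def]
      have lower: "real k / 4 * n \<le> (\<Sum>j<k. (\<Sum>i<n. score (\<phi> j) (X i \<omega>))\<^sup>2)"
        and upper: "(\<Sum>j<k. (\<Sum>i<n. score (\<phi> j) (X i \<omega>))\<^sup>2) \<le> 3 * real k * n"
        and gram: "\<forall>j<k. \<forall>l<k. \<bar>(\<Sum>i<n. score (\<phi> j) (X i \<omega>) * score (\<phi> l) (X i \<omega>)) - (if j = l then real n else 0)\<bar> \<le> real n / real k"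
        using bspec[OF regular \<omega>E] by blast+
      define \<psi> where "\<psi> \<theta> = (\<Sum>j<k. t j * \<phi> j \<theta>)" for \<theta>
      have \<psi>_small: "\<bar>\<psi> \<theta>\<bar> \<le> 1 / 2" for \<theta> unfolding \<psi>_def by (rule gain(1)[OF lower upper gram]) (rule \<phi>D)
      have \<psi>: "bounded_weight \<psi> (1 / 2)"
        unfolding bounded_weight_def
      proof (intro conjI allI \<psi>_small)
        show "\<psi> \<in> borel_measurable borel" unfolding \<psi>_def[abs_def]
          using \<phi>(1) by (intro borel_measurable_sum borel_measurable_times) (auto simp: bounded_weight_def)
      qed
      have \<psi>_ge: "\<psi> \<theta> \<ge> - 1" for \<theta> using \<psi>_small[of \<theta>] by (simp add: abs_le_iff)
      interpret g0: prob_space g0 using g0 by (simp add: mixing_measures_def)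
      have "integrable g0 (\<phi> j)" for j
        using \<phi>(1)[of j] by (intro integrable_bounded_on_parameters[OF g0]) (auto simp: bounded_weight_def)
      then have mean: "(LINT \<theta>|g0. \<psi> \<theta>) = 0" unfolding \<psi>_def using \<phi>(2) by simp
      have score\<psi>: "score \<psi> x = (\<Sum>j<k. t j * score (\<phi> j) x)" for x
        unfolding \<psi>_def[abs_def] by (rule score_sum) (auto intro: \<phi>(1))
      note tilt = tilted_mixture[OF \<psi> \<psi>_ge mean]
      have rel2: "integrable true_law (\<lambda>x. (rel_dev (tilted \<psi>) x)\<^sup>2)"
        unfolding tilt(2) power2_eq_square by (rule integrable_score_times_score[OF \<psi> \<psi>])
      have "(chi (tilted \<psi>))\<^sup>2 = (LINT x|true_law. score \<psi> x * score \<psi> x)"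
        unfolding chi_def tilt(2) by (simp add: power2_eq_square)
      also have "\<dots> = (LINT x|true_law. (\<Sum>j<k. \<Sum>l<k. t j * t l * (score (\<phi> j) x * score (\<phi> l) x)))"
        unfolding score\<psi> sum_product by (intro Bochner_Integration.integral_cong refl sum.cong) (simp only: mult_ac)
      also have "\<dots> = (\<Sum>j<k. \<Sum>l<k. t j * t l * (LINT x|true_law. score (\<phi> j) x * score (\<phi> l) x))"
        using integrable_score_times_score[OF \<phi>(1) \<phi>(1)] by simp
      also have "\<dots> = (\<Sum>j<k. \<Sum>l<k. if j = l then (t j)\<^sup>2 else 0)"
        using \<phi>(3) by (intro sum.cong refl) (auto simp: power2_eq_square)
      also have "\<dots> = (\<Sum>j<k. (t j)\<^sup>2)" by simp
      finally have chi2: "(chi (tilted \<psi>))\<^sup>2 = (\<Sum>j<k. (t j)\<^sup>2)" .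
      have "ennreal K < ennreal (n * (\<Sum>j<k. (t j)\<^sup>2))"
        using gain(3)[OF lower upper gram] kK by (intro ennreal_lessI) (auto simp: abs_if split: if_splits)
      also have "\<dots> = of_nat n * chi_square \<mu> (mixture_density B (tilted \<psi>)) f0"
        by (simp add: chi_square_eq[OF tilt(1) rel2] chi2 ennreal_mult sum_nonneg ennreal_of_nat_eq_real_of_nat)
      finally have far: "of_nat n * chi_square \<mu> (mixture_density B (tilted \<psi>)) f0 > ennreal K" .
      have "log_likelihood n (\<lambda>i. X i \<omega>) (mixture_density B (tilted \<psi>)) - log_likelihood n (\<lambda>i. X i \<omega>) f0 =
         (\<Sum>i<n. ln (mixture_density B (tilted \<psi>) (X i \<omega>) / f0 (X i \<omega>)))"
        unfolding log_likelihood_def sum_subtractf[symmetric]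
        using f0_pos mixture_density_pos[OF tilt(1)] by (intro sum.cong refl ln_divide_pos[symmetric])
      also have "\<dots> = (\<Sum>i<n. ln (1 + (\<Sum>j<k. t j * score (\<phi> j) (X i \<omega>))))"
        using tilt(2) by (simp add: rel_dev_def score\<psi> algebra_simps)
      also have "\<dots> \<ge> c" using gain(2)[OF lower upper gram] kc by linarith
      finally have "log_likelihood n (\<lambda>i. X i \<omega>) (mixture_density B (tilted \<psi>)) \<ge> log_likelihood n (\<lambda>i. X i \<omega>) f0 + c"
        by linarith
      with far tilt(1) show "\<exists>g\<in>mixing_measures \<Theta>.
         log_likelihood n (\<lambda>i. X i \<omega>) (mixture_density B g) \<ge> log_likelihood n (\<lambda>i. X i \<omega>) f0 + c \<and>
         of_nat n * chi_square \<mu> (mixture_density B g) f0 > ennreal K" by blast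
    qed
  qed
qed

lemma iid_sample_true_law:
  assumes "prob_space M" "prob_space.indep_vars M (\<lambda>_. \<mu>) X UNIV"
    and dist: "\<And>i. distributed M \<mu> (X i) (\<lambda>x. ennreal (f0 x))"
  shows "iid_sample M true_law X"
proof -
  interpret prob_space M by fact
  have space: "space true_law = space \<mu>" using sets_eq_imp_space_eq[OF sets_true_law] .
  have "indep_vars (\<lambda>_. true_law) X UNIV"
    using assms(2) unfolding indep_vars_def measurable_cong_sets[OF refl sets_true_law] sets_true_law .
  moreover have "distr M true_law (X i) = true_law" for i
  proof -
    have "distr M true_law (X i) = distr M \<mu> (X i)" by (rule distr_cong) (simp_all add: sets_true_law)
    also have "\<dots> = true_law" using distributed_distr_eq_density[OF dist] by (simp add: true_law_def)
    finally show ?thesis .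
  qed
  ultimately show ?thesis by (intro iid_sample.intro iid_sample_axioms.intro prob_space_axioms)
qed

end

lemma finitely_discrete_support:
  fixes g :: "(real ^ 'd::finite) measure"
  assumes g: "g \<in> mixing_measures \<Theta>" and fd: "finitely_discrete g"
  shows "\<exists>S. finite S \<and> S \<subseteq> \<Theta> \<and> (AE \<theta> in g. \<theta> \<in> S)"
proof -
  interpret prob_space g using g by (simp add: mixing_measures_def)
  have AE: "AE \<theta> in g. \<theta> \<in> \<Theta>" using g by (simp add: mixing_measures_def)
  obtain S where S: "finite S" "S \<in> events" "emeasure g S = 1" using fd by (auto simp: finitely_discrete_def)
  then have "prob S = 1" by (simp add: measure_def)
  with S(2) have "AE \<theta> in g. \<theta> \<in> S" by (simp add: prob_eq_1)
  with AE have "AE \<theta> in g. \<theta> \<in> S \<inter> \<Theta>" by eventually_elim auto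
  with S(1) show ?thesis by (intro exI[of _ "S \<inter> \<Theta>"]) auto
qed

theorem theorem2p1:
  fixes B :: "'d::finite set" and \<Theta> :: "(real ^ 'd) set"
    and g0 :: "(real ^ 'd) measure"
    and M :: "'w measure" and X :: "nat \<Rightarrow> 'w \<Rightarrow> 'd observation"
    and ghat :: "nat \<Rightarrow> 'w \<Rightarrow> (real ^ 'd) measure"
  assumes "bounded \<Theta>"
    and "\<And>\<theta> l. \<theta> \<in> \<Theta> \<Longrightarrow> l \<notin> B \<Longrightarrow> 0 < \<theta> $ l"
    and "g0 \<in> mixing_measures \<Theta>"
    and "prob_space M"
    and "prob_space.indep_vars M (\<lambda>_. base_measure B) X UNIV"
    and "\<And>i. distributed M (base_measure B) (X i) (\<lambda>x. ennreal (mixture_density B g0 x))"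
    and "\<And>n \<omega>. \<omega> \<in> space M \<Longrightarrow> \<exists>g. is_NPMLE B \<Theta> n (\<lambda>i. X i \<omega>) g \<Longrightarrow>
           is_NPMLE B \<Theta> n (\<lambda>i. X i \<omega>) (ghat n \<omega>)"
  shows "(finitely_discrete g0 \<longrightarrow>
           (\<forall>c<0. bounded_in_probability M
             (\<lambda>n \<omega>. SUP g \<in> likelihood_set B \<Theta> g0 (ghat n \<omega>) n (\<lambda>i. X i \<omega>) c.
                of_nat n * chi_square (base_measure B) (mixture_density B g) (mixture_density B g0)))) \<and>
         (\<not> finitely_discrete g0 \<longrightarrow>
           (\<forall>c>0. diverges_in_probability M
             (\<lambda>n \<omega>. SUP g \<in> likelihood_set B \<Theta> g0 (ghat n \<omega>) n (\<lambda>i. X i \<omega>) c.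
                of_nat n * chi_square (base_measure B) (mixture_density B g) (mixture_density B g0))))"
proof (intro conjI impI allI)
  interpret true_mixture B \<Theta> g0 by unfold_locales (use assms in auto)
  interpret prob_space M by fact
  let ?Y = "\<lambda>c n \<omega>. SUP g \<in> likelihood_set B \<Theta> g0 (ghat n \<omega>) n (\<lambda>i. X i \<omega>) c.
                of_nat n * chi_square \<mu> (mixture_density B g) f0"
  have iid: "iid_sample M true_law X" by (rule iid_sample_true_law) (use assms in auto)
  {
    fix c :: real assume fd: "finitely_discrete g0" and c: "c < 0"
    obtain S where S: "finite S" "S \<subseteq> \<Theta>" "AE \<theta> in g0. \<theta> \<in> S"
      using finitely_discrete_support[OF g0 fd] by blast
    interpret finitely_supported_truth B \<Theta> g0 S by unfold_locales (use S in auto)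
    show "bounded_in_probability M (?Y c)"
      unfolding bounded_in_probability_def
    proof (intro allI impI)
      fix \<epsilon> :: real assume \<epsilon>: "\<epsilon> > 0"
      have "- c \<ge> 0" using c by simp
      from likelihood_set_chi_bounded[OF iid \<epsilon> this] obtain K where
        K: "\<forall>n. \<exists>E\<in>events. prob E \<le> \<epsilon> \<and>
          (\<forall>\<omega>\<in>space M - E. \<forall>g\<in>mixing_measures \<Theta>.
           log_likelihood n (\<lambda>i. X i \<omega>) (mixture_density B g) \<ge> log_likelihood n (\<lambda>i. X i \<omega>) f0 - - c \<longrightarrow>
           of_nat n * chi_square \<mu> (mixture_density B g) f0 \<le> ennreal K)" ..
      show "\<exists>K::real. \<forall>n. outer_measure_of M {\<omega> \<in> space M. ?Y c n \<omega> > ennreal K} \<le> ennreal \<epsilon>"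
      proof (intro exI[of _ K] allI)
        fix n
        obtain E where E: "E \<in> events" "prob E \<le> \<epsilon>" and bnd: "\<forall>\<omega>\<in>space M - E. \<forall>g\<in>mixing_measures \<Theta>.
           log_likelihood n (\<lambda>i. X i \<omega>) (mixture_density B g) \<ge> log_likelihood n (\<lambda>i. X i \<omega>) f0 - - c \<longrightarrow>
           of_nat n * chi_square \<mu> (mixture_density B g) f0 \<le> ennreal K"
          using spec[OF K, of n] by (elim bexE conjE)
        have "{\<omega> \<in> space M. ?Y c n \<omega> > ennreal K} \<subseteq> E"
        proof
          fix \<omega> assume \<omega>: "\<omega> \<in> {\<omega> \<in> space M. ?Y c n \<omega> > ennreal K}"
          show "\<omega> \<in> E"
          proof (rule ccontr)
            assume "\<omega> \<notin> E"
            then have b: "of_nat n * chi_square \<mu> (mixture_density B g) f0 \<le> ennreal K"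
              if "g \<in> mixing_measures \<Theta>"
               "log_likelihood n (\<lambda>i. X i \<omega>) (mixture_density B g) \<ge> log_likelihood n (\<lambda>i. X i \<omega>) f0 + c" for g
              using bnd \<omega> that by auto
            have "?Y c n \<omega> \<le> ennreal K"
            proof (rule SUP_least)
              fix g assume "g \<in> likelihood_set B \<Theta> g0 (ghat n \<omega>) n (\<lambda>i. X i \<omega>) c"
              then consider "g \<in> mixing_measures \<Theta>"
                 "log_likelihood n (\<lambda>i. X i \<omega>) (mixture_density B g) \<ge> log_likelihood n (\<lambda>i. X i \<omega>) f0 + c"
                | "is_NPMLE B \<Theta> n (\<lambda>i. X i \<omega>) g" by (auto simp: likelihood_set_def)
              then show "of_nat n * chi_square \<mu> (mixture_density B g) f0 \<le> ennreal K"
              proof cases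
                \<comment> \<open>A maximiser is at least as likely as \<open>g0\<close>, and \<open>c\<close> is negative.\<close>
                case 2
                then have "g \<in> mixing_measures \<Theta>"
                  "log_likelihood n (\<lambda>i. X i \<omega>) f0 \<le> log_likelihood n (\<lambda>i. X i \<omega>) (mixture_density B g)"
                  using g0 by (auto simp: is_NPMLE_def)
                with c show ?thesis by (intro b) auto
              qed (rule b)
            qed
            with \<omega> show False by (simp add: not_le[symmetric])
          qed
        qed
        then have "outer_measure_of M {\<omega> \<in> space M. ?Y c n \<omega> > ennreal K} \<le> emeasure M E"
          using E(1) by (rule outer_measure_of_le)
        also have "\<dots> \<le> ennreal \<epsilon>" using E(2) by (simp add: emeasure_eq_measure ennreal_leI)
        finally show "outer_measure_of M {\<omega> \<in> space M. ?Y c n \<omega> > ennreal K} \<le> ennreal \<epsilon>" .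
      qed
    qed
  next
    fix c :: real assume nfd: "\<not> finitely_discrete g0" and c: "0 < c"
    show "diverges_in_probability M (?Y c)"
      unfolding diverges_in_probability_def
    proof (intro allI)
      fix K :: real
      let ?P = "\<lambda>n. outer_measure_of M {\<omega> \<in> space M. ?Y c n \<omega> \<le> ennreal K}"
      have small: "\<exists>N. \<forall>n\<ge>N. ?P n \<le> ennreal \<epsilon>" if \<epsilon>: "\<epsilon> > 0" for \<epsilon>
      proof -
        from likelihood_set_contains_distant_mixture[OF nfd iid \<epsilon>, of c K] obtain N where
          N: "\<forall>n\<ge>N. \<exists>E\<in>events. prob E \<le> \<epsilon> \<and>
          (\<forall>\<omega>\<in>space M - E. \<exists>g\<in>mixing_measures \<Theta>.
             log_likelihood n (\<lambda>i. X i \<omega>) (mixture_density B g) \<ge> log_likelihood n (\<lambda>i. X i \<omega>) f0 + c \<and>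
             of_nat n * chi_square \<mu> (mixture_density B g) f0 > ennreal K)" ..
        have "?P n \<le> ennreal \<epsilon>" if nN: "n \<ge> N" for n
        proof -
          obtain E where E: "E \<in> events" "prob E \<le> \<epsilon>" and far: "\<forall>\<omega>\<in>space M - E. \<exists>g\<in>mixing_measures \<Theta>.
             log_likelihood n (\<lambda>i. X i \<omega>) (mixture_density B g) \<ge> log_likelihood n (\<lambda>i. X i \<omega>) f0 + c \<and>
             of_nat n * chi_square \<mu> (mixture_density B g) f0 > ennreal K"
            using mp[OF spec[OF N, of n] nN] by (elim bexE conjE)
          have "{\<omega> \<in> space M. ?Y c n \<omega> \<le> ennreal K} \<subseteq> E"
          proof
            fix \<omega> assume \<omega>: "\<omega> \<in> {\<omega> \<in> space M. ?Y c n \<omega> \<le> ennreal K}"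
            show "\<omega> \<in> E"
            proof (rule ccontr)
              assume "\<omega> \<notin> E"
              then obtain g where g: "g \<in> mixing_measures \<Theta>"
                "log_likelihood n (\<lambda>i. X i \<omega>) (mixture_density B g) \<ge> log_likelihood n (\<lambda>i. X i \<omega>) f0 + c"
                "of_nat n * chi_square \<mu> (mixture_density B g) f0 > ennreal K"
                using far \<omega> by auto
              have "of_nat n * chi_square \<mu> (mixture_density B g) f0 \<le> ?Y c n \<omega>"
                using g by (intro SUP_upper) (auto simp: likelihood_set_def)
              moreover have "?Y c n \<omega> \<le> ennreal K" using \<omega> by simp
              ultimately show False using g(3) by (meson not_le order_trans)
            qed
          qed
          then have "?P n \<le> emeasure M E" using E(1) by (rule outer_measure_of_le)
          also have "\<dots> \<le> ennreal \<epsilon>" using E(2) by (simp add: emeasure_eq_measure ennreal_leI)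
          finally show ?thesis .
        qed
        then show ?thesis by blast
      qed
      show "?P \<longlonglongrightarrow> 0"
      proof (rule order_tendstoI)
        fix a :: ennreal assume "a > 0"
        then obtain e where e: "e > 0" "ennreal e < a"
          by (metis ennreal_less_zero_iff dense less_top_ennreal order_less_le_trans top_greatest)
        with small[OF e(1)] show "\<forall>\<^sub>F n in sequentially. ?P n < a"
          unfolding eventually_sequentially by (meson le_less_trans)
      qed simp
    qed
  }
qed

end
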